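(* Let $E/\mathbb{F}_q$ be an elliptic function field. Let $Q$ be a rational place of $E$ and let $\tau_Q$ be the translation of $E$ by $Q$. Let $\sigma$ be an automorphism in $\mathrm{Aut}(E,O)$. Let $G=\langle\tau_Q,\sigma\rangle$ be the subgroup of $\mathrm{Aut}(E/\mathbb{F}_q)$ generated by $\tau_Q$ and $\sigma$. Then $G$ is abelian if and only if $\sigma(Q)=Q$.
   Context: $\mathbb{F}_q$ is a finite field of characteristic $p$. An elliptic function field $E/\mathbb{F}_q$ is the function field $\mathbb{F}_q(x,y)$ of an elliptic curve over $\mathbb{F}_q$ given by a nonsingular Weierstrass equation; $O$ is the common pole of $x$ and $y$ (the infinite place). The set $\mathbb{P}_E^1$ of rational (degree one) places of $E$ is an abelian group with zero $O$ and with $P\oplus Q=R$ iff the divisors $P+Q$ and $R+O$ are linearly equivalent. $\mathrm{Aut}(E/\mathbb{F}_q)$ is the group of field automorphisms of $E$ fixing $\mathbb{F}_q$ elementwise, acting on places by $\sigma(P)=\{\sigma(z):z\in P\}$. $\mathrm{Aut}(E,O)=\{\sigma\in\mathrm{Aut}(E/\mathbb{F}_q):\sigma(O)=O\}$. For $Q\in\mathbb{P}_E^1$, $\tau_Q\in\mathrm{Aut}(E/\mathbb{F}_q)$ is the automorphism induced by translation by $Q$: its extension to $E\overline{\mathbb{F}}_q$ sends every rational place $P$ of $E\overline{\mathbb{F}}_q$ to $P\oplus Q$. *)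

theory Defs
  imports
    "HOL-Algebra.Algebraic_Closure_Type"
    "HOL-Algebra.Generated_Fields"
    "HOL-Algebra.Generated_Groups"
    "HOL-Library.Poly_Mapping"
begin

text \<open>
  All fields are subsets \<open>F\<close> of a field type, with constant field \<open>K \<subseteq> F\<close>. The notions of
  HOL-Algebra are applied to the record of ring operations of that type, restricted to the subset
  where necessary.
\<close>

abbreviation type_ring :: "'a::field ring" where
  "type_ring \<equiv> ring_of_type_algebra"

abbreviation ring_on :: "'a::field set \<Rightarrow> 'a ring" where
  "ring_on V \<equiv> type_ring\<lparr>carrier := V\<rparr>"


section \<open>Places and divisors of a function field\<close>

definition valuation_ring :: "'a::field set \<Rightarrow> 'a set \<Rightarrow> 'a set \<Rightarrow> bool" where
  "valuation_ring K F V \<longleftrightarrow>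
     subring V type_ring \<and> K \<subset> V \<and> V \<subset> F \<and> (\<forall>z\<in>F. z \<in> V \<or> inverse z \<in> V)"

definition places :: "'a::field set \<Rightarrow> 'a set \<Rightarrow> 'a set set" where
  "places K F = {P. \<exists>V. valuation_ring K F V \<and> maximalideal P (ring_on V)}"

text \<open>The valuation ring of which \<open>P\<close> is the maximal ideal; it is determined by \<open>P\<close>. The case
  \<open>z = 0\<close> is separate because \<open>inverse 0 = 0 \<in> P\<close>.\<close>

definition place_ring :: "'a::field set \<Rightarrow> 'a set \<Rightarrow> 'a set" where
  "place_ring F P = {z \<in> F. z = 0 \<or> inverse z \<notin> P}"

text \<open>\<open>deg P = [place_ring F P / P : K]\<close>, where \<open>K\<close> is embedded in the residue class field by
  \<open>c \<mapsto> c + P\<close>.\<close>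

definition has_degree :: "'a::field set \<Rightarrow> 'a set \<Rightarrow> 'a set \<Rightarrow> nat \<Rightarrow> bool" where
  "has_degree K F P d \<longleftrightarrow>
     (let V = ring_on (place_ring F P)
      in ring.dimension (V Quot P) d ((\<lambda>c. P +>\<^bsub>V\<^esub> c) ` K) (carrier (V Quot P)))"

definition rational_places :: "'a::field set \<Rightarrow> 'a set \<Rightarrow> 'a set set" where
  "rational_places K F = {P \<in> places K F. has_degree K F P 1}"

definition prime_element :: "'a::field set \<Rightarrow> 'a set \<Rightarrow> 'a \<Rightarrow> bool" where
  "prime_element F P t \<longleftrightarrow> t \<in> P \<and> P = (\<lambda>w. t * w) ` place_ring F P"

text \<open>The graph of the normalized discrete valuation at \<open>P\<close>: \<open>z = t\<^sup>n u\<close> with \<open>t\<close> a prime element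
  and \<open>u\<close> a unit of the valuation ring. For \<open>z \<noteq> 0\<close> the integer \<open>n\<close> is unique and does not depend
  on \<open>t\<close>.\<close>

definition has_order :: "'a::field set \<Rightarrow> 'a set \<Rightarrow> 'a \<Rightarrow> int \<Rightarrow> bool" where
  "has_order F P z n \<longleftrightarrow>
     (\<exists>t u. prime_element F P t \<and> u \<in> place_ring F P - P \<and> z = t powi n * u)"

text \<open>A divisor is an element of the free abelian group on the places; \<open>frag_of P\<close> is the place \<open>P\<close>
  as a divisor. Two divisors are equivalent if their difference is the divisor of some \<open>z \<noteq> 0\<close>.\<close>

definition lin_equiv ::
  "'a::field set \<Rightarrow> 'a set \<Rightarrow> ('a set \<Rightarrow>\<^sub>0 int) \<Rightarrow> ('a set \<Rightarrow>\<^sub>0 int) \<Rightarrow> bool" where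
  "lin_equiv K F D D' \<longleftrightarrow>
     (\<exists>z \<in> F - {0}. \<forall>P \<in> places K F. has_order F P z (Poly_Mapping.lookup (D - D') P))"


section \<open>Automorphisms\<close>

text \<open>Only the values on \<open>F\<close> matter; for \<open>F = UNIV\<close> the elements are determined as functions.\<close>

definition field_auts :: "'a::field set \<Rightarrow> 'a set \<Rightarrow> ('a \<Rightarrow> 'a) set" where
  "field_auts K F = {\<sigma> \<in> ring_iso (ring_on F) (ring_on F). \<forall>c\<in>K. \<sigma> c = c}"

definition aut_group :: "'a::field set \<Rightarrow> ('a \<Rightarrow> 'a) monoid" where
  "aut_group K = \<lparr>carrier = field_auts K UNIV, monoid.mult = (\<circ>), one = id\<rparr>"

definition aut_fixing :: "'a::field set \<Rightarrow> 'a set \<Rightarrow> ('a \<Rightarrow> 'a) set" where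
  "aut_fixing K P = {\<sigma> \<in> carrier (aut_group K). \<sigma> ` P = P}"


section \<open>Constant field extension\<close>

text \<open>
  For a function field \<open>E/K\<close> that is a whole type \<open>'e\<close>, the algebraic closure of \<open>K\<close> and the
  compositum of \<open>E\<close> with it are formed inside the algebraically closed field \<open>'e alg_closure\<close>,
  in which \<open>E\<close> is embedded by \<open>to_ac\<close>.
\<close>

definition const_closure :: "'e::field set \<Rightarrow> 'e alg_closure set" where
  "const_closure K = {z. (ring.algebraic type_ring over (to_ac ` K)) z}"

definition const_ext :: "'e::field set \<Rightarrow> 'e alg_closure set" where
  "const_ext K = generate_field type_ring (const_closure K \<union> range to_ac)"


section \<open>Elliptic function fields\<close>

text \<open>The Weierstrass polynomial \<open>Y\<^sup>2 + a1 XY + a3 Y - (X\<^sup>3 + a2 X\<^sup>2 + a4 X + a6)\<close> and its two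
  partial derivatives.\<close>

definition weierstrass :: "'a::field \<Rightarrow> 'a \<Rightarrow> 'a \<Rightarrow> 'a \<Rightarrow> 'a \<Rightarrow> 'a \<Rightarrow> 'a \<Rightarrow> 'a" where
  "weierstrass a1 a2 a3 a4 a6 u v =
     v^2 + a1 * u * v + a3 * v - (u^3 + a2 * u^2 + a4 * u + a6)"

definition weierstrass_dX :: "'a::field \<Rightarrow> 'a \<Rightarrow> 'a \<Rightarrow> 'a \<Rightarrow> 'a \<Rightarrow> 'a \<Rightarrow> 'a \<Rightarrow> 'a" where
  "weierstrass_dX a1 a2 a3 a4 a6 u v = a1 * v - (3 * u^2 + 2 * a2 * u + a4)"

definition weierstrass_dY :: "'a::field \<Rightarrow> 'a \<Rightarrow> 'a \<Rightarrow> 'a \<Rightarrow> 'a \<Rightarrow> 'a \<Rightarrow> 'a \<Rightarrow> 'a" where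
  "weierstrass_dY a1 a2 a3 a4 a6 u v = 2 * v + a1 * u + a3"

text \<open>No singular point over the algebraic closure of \<open>K\<close>. The point at infinity of a Weierstrass
  curve is always nonsingular, so the affine points suffice.\<close>

definition weierstrass_nonsingular ::
  "'e::field set \<Rightarrow> 'e \<Rightarrow> 'e \<Rightarrow> 'e \<Rightarrow> 'e \<Rightarrow> 'e \<Rightarrow> bool" where
  "weierstrass_nonsingular K a1 a2 a3 a4 a6 \<longleftrightarrow>
     (\<nexists>u v. u \<in> const_closure K \<and> v \<in> const_closure K \<and>
        weierstrass (to_ac a1) (to_ac a2) (to_ac a3) (to_ac a4) (to_ac a6) u v = 0 \<and>
        weierstrass_dX (to_ac a1) (to_ac a2) (to_ac a3) (to_ac a4) (to_ac a6) u v = 0 \<and>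
        weierstrass_dY (to_ac a1) (to_ac a2) (to_ac a3) (to_ac a4) (to_ac a6) u v = 0)"

text \<open>
  The type \<open>'e\<close> is the function field \<open>K(x,y)\<close> of a nonsingular Weierstrass curve. Since
  Weierstrass polynomials are irreducible over \<open>K(X)\<close>, the transcendence of \<open>x\<close> makes \<open>'e\<close> the
  field of fractions of the coordinate ring of the curve.
\<close>

definition elliptic_function_field :: "'e::field set \<Rightarrow> 'e \<Rightarrow> 'e \<Rightarrow> bool" where
  "elliptic_function_field K x y \<longleftrightarrow>
     subfield K type_ring \<and>
     (ring.transcendental type_ring over K) x \<and>
     generate_field type_ring (K \<union> {x, y}) = UNIV \<and>
     (\<exists>a1\<in>K. \<exists>a2\<in>K. \<exists>a3\<in>K. \<exists>a4\<in>K. \<exists>a6\<in>K.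
        weierstrass_nonsingular K a1 a2 a3 a4 a6 \<and> weierstrass a1 a2 a3 a4 a6 x y = 0)"

text \<open>The common pole of \<open>x\<close> and \<open>y\<close>; there is exactly one.\<close>

definition infinite_place :: "'a::field set \<Rightarrow> 'a set \<Rightarrow> 'a \<Rightarrow> 'a \<Rightarrow> 'a set \<Rightarrow> bool" where
  "infinite_place K F x y P \<longleftrightarrow>
     P \<in> places K F \<and> x \<notin> place_ring F P \<and> y \<notin> place_ring F P"

text \<open>\<open>P \<oplus> Q = R\<close> in the group of rational places with zero element \<open>Z\<close>.\<close>

definition place_sum ::
  "'a::field set \<Rightarrow> 'a set \<Rightarrow> 'a set \<Rightarrow> 'a set \<Rightarrow> 'a set \<Rightarrow> 'a set \<Rightarrow> bool" where
  "place_sum K F Z P Q R \<longleftrightarrow>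
     P \<in> rational_places K F \<and> Q \<in> rational_places K F \<and> R \<in> rational_places K F \<and>
     lin_equiv K F (frag_of P + frag_of Q) (frag_of R + frag_of Z)"

text \<open>
  \<open>\<tau>\<close> is the translation by the rational place \<open>Q\<close>. Here \<open>\<tau>'\<close> is the extension of \<open>\<tau>\<close> to the
  constant field extension that is the identity on constants, \<open>Q'\<close> is the place lying over \<open>Q\<close>
  (exactly one, as \<open>Q\<close> has degree one) and \<open>Z'\<close> is the infinite place of the extension.
\<close>

definition is_translation :: "'e::field set \<Rightarrow> 'e \<Rightarrow> 'e \<Rightarrow> 'e set \<Rightarrow> ('e \<Rightarrow> 'e) \<Rightarrow> bool" where
  "is_translation K x y Q \<tau> \<longleftrightarrow>
     \<tau> \<in> carrier (aut_group K) \<and>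
     (\<exists>\<tau>' Q' Z'.
        \<tau>' \<in> field_auts (const_closure K) (const_ext K) \<and>
        (\<forall>z. \<tau>' (to_ac z) = to_ac (\<tau> z)) \<and>
        Q' \<in> rational_places (const_closure K) (const_ext K) \<and> to_ac -` Q' = Q \<and>
        infinite_place (const_closure K) (const_ext K) (to_ac x) (to_ac y) Z' \<and>
        (\<forall>P \<in> rational_places (const_closure K) (const_ext K).
           place_sum (const_closure K) (const_ext K) Z' P Q' (\<tau>' ` P)))"

end

theory Submission
  imports Defs
begin

text \<open>
  Let \<open>E'\<close> be the extension of \<open>E\<close> by the algebraic closure of the constant field. If \<open>\<tau>\<close> and
  \<open>\<sigma>\<close> commute, then \<open>\<sigma> Q = \<sigma> (\<tau> O) = \<tau> (\<sigma> O) = Q\<close>. Conversely \<open>\<sigma>\<close> extends to an automorphism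
  \<open>\<sigma>'\<close> of \<open>E'\<close> that fixes the places over \<open>O\<close> and \<open>Q\<close> and preserves linear equivalence, so
  \<open>\<sigma>' (\<tau>' P)\<close> and \<open>\<tau>' (\<sigma>' P)\<close> are equivalent for every rational place \<open>P\<close> of \<open>E'\<close>. As \<open>E'\<close> has
  positive genus, equivalent rational places are equal. Hence the difference of the images of \<open>x\<close>
  (or \<open>y\<close>) under \<open>\<sigma>' \<circ> \<tau>'\<close> and \<open>\<tau>' \<circ> \<sigma>'\<close> vanishes at almost all places, so it is zero.

  No Riemann-Roch theory is needed: the local rings at the points of a Weierstrass curve are shown
  to be discrete valuation rings directly, and a function with a single simple pole is excluded
  by computing its order at infinity.
\<close>

section \<open>Places\<close>

text \<open>A finite \<open>K\<close> gives \<open>E\<close> only finitely many rational places, in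
  general too few to determine an automorphism. Over the algebraic closure every affine point of the
  curve is a rational place, and a function is determined by its values at these points: the norm of
  a function that vanishes at all of them is a polynomial in \<open>x\<close> with value 0 at every
  constant.

  The comparison of \<open>\<sigma>' \<circ> \<tau>'\<close> with
  \<open>\<tau>' \<circ> \<sigma>'\<close> yields vanishing at the images of the points only, so the
  difference is pulled back along both automorphisms before it is tested.

  That \<open>\<sigma>'\<close> fixes the place over \<open>Q\<close> rests on the degree of
  \<open>Q\<close>: the residues of \<open>x\<close> and \<open>y\<close> at \<open>Q\<close> are
  constants from \<open>K\<close>, and these determine the point above.

  All functions are handled in the form \<open>(A(x) + B(x) y) / C(x)\<close> with unique
  coordinates up to a common factor. Evaluation at points, orders at infinity and the extension
  \<open>\<sigma>'\<close> are all read off from the coordinate polynomials.\<close>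

lemma type_ring_sel [simp]:
  "carrier type_ring = UNIV" "x \<otimes>\<^bsub>type_ring\<^esub> y = x * y" "x \<oplus>\<^bsub>type_ring\<^esub> y = x + y"
  "\<one>\<^bsub>type_ring\<^esub> = 1" "\<zero>\<^bsub>type_ring\<^esub> = (0::'a::field)"
  by (simp_all add: ring_of_type_algebra_def)

lemma type_ring_a_inv [simp]: "\<ominus>\<^bsub>type_ring\<^esub> x = - (x::'a::field)"
proof -
  interpret field "type_ring :: 'a ring" by (rule field_from_type_algebra)
  show ?thesis using minus_equality[of "-x" x] by simp
qed

lemma type_ring_m_inv [simp]: "(x::'a::field) \<noteq> 0 \<Longrightarrow> inv\<^bsub>type_ring\<^esub> x = inverse x"
proof -
  interpret field "type_ring :: 'a ring" by (rule field_from_type_algebra)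
  assume "x \<noteq> 0"
  then show ?thesis using comm_inv_char[of x "inverse x"] by simp
qed

lemma subring_type_ring_iff:
  fixes V :: "'a::field set"
  shows "subring V type_ring \<longleftrightarrow>
    1 \<in> V \<and> (\<forall>u\<in>V. - u \<in> V) \<and> (\<forall>u\<in>V. \<forall>v\<in>V. u + v \<in> V) \<and> (\<forall>u\<in>V. \<forall>v\<in>V. u * v \<in> V)"
proof -
  interpret field "type_ring :: 'a ring" by (rule field_from_type_algebra)
  show ?thesis
    using subringI[of V] subringE[of V type_ring] by (auto simp del: subset_UNIV)
qed

lemma subfield_type_ring_iff:
  fixes V :: "'a::field set"
  shows "subfield V type_ring \<longleftrightarrow> subring V type_ring \<and> (\<forall>u\<in>V. inverse u \<in> V)"
proof -
  interpret field "type_ring :: 'a ring" by (rule field_from_type_algebra)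
  show ?thesis
  proof
    assume s: "subfield V type_ring"
    then have z: "0 \<in> V" using subringE(2)[OF subfieldE(1)[OF s]] by simp
    have "inverse u \<in> V" if "u \<in> V" for u
      using subfield_m_inv(1)[OF s, of u] that z by (cases "u = 0") auto
    then show "subring V type_ring \<and> (\<forall>u\<in>V. inverse u \<in> V)"
      using subfieldE(1)[OF s] by auto
  next
    assume a: "subring V type_ring \<and> (\<forall>u\<in>V. inverse u \<in> V)"
    then show "subfield V type_ring"
      by (intro subfieldI') auto
  qed
qed

lemma subfield_type_ringD:
  fixes V :: "'a::field set"
  assumes "subfield V type_ring"
  shows "0 \<in> V" "1 \<in> V" "\<And>u. u \<in> V \<Longrightarrow> - u \<in> V" "\<And>u v. u \<in> V \<Longrightarrow> v \<in> V \<Longrightarrow> u + v \<in> V"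
    "\<And>u v. u \<in> V \<Longrightarrow> v \<in> V \<Longrightarrow> u * v \<in> V" "\<And>u v. u \<in> V \<Longrightarrow> v \<in> V \<Longrightarrow> u - v \<in> V"
    "\<And>u. u \<in> V \<Longrightarrow> inverse u \<in> V" "\<And>u v. u \<in> V \<Longrightarrow> v \<in> V \<Longrightarrow> u / v \<in> V"
    "\<And>u n. u \<in> V \<Longrightarrow> u ^ n \<in> V" "\<And>u n. u \<in> V \<Longrightarrow> u powi n \<in> V"
proof -
  show *: "1 \<in> V" "\<And>u. u \<in> V \<Longrightarrow> - u \<in> V" "\<And>u v. u \<in> V \<Longrightarrow> v \<in> V \<Longrightarrow> u + v \<in> V"
    "\<And>u v. u \<in> V \<Longrightarrow> v \<in> V \<Longrightarrow> u * v \<in> V" "\<And>u. u \<in> V \<Longrightarrow> inverse u \<in> V"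
    using assms by (auto simp: subfield_type_ring_iff subring_type_ring_iff)
  show "u - v \<in> V" if "u \<in> V" "v \<in> V" for u v
    using *(3)[OF that(1) *(2)[OF that(2)]] by simp
  show "u / v \<in> V" if "u \<in> V" "v \<in> V" for u v
    using *(4)[OF that(1) *(5)[OF that(2)]] by (simp add: divide_inverse)
  show "0 \<in> V" using *(3)[OF *(1) *(2)[OF *(1)]] by simp
  show p: "u ^ n \<in> V" if "u \<in> V" for u n
    using that by (induction n) (auto intro: *)
  show "u powi n \<in> V" if "u \<in> V" for u n
    using that by (auto simp: power_int_def intro: p *)
qed

text \<open>\<open>V\<close> is a parameter next to \<open>P\<close> so that rings given explicitly
  can be plugged in; \<open>place_ring_eq\<close> and \<open>placesD\<close> show that it is always
  \<open>place_ring F P\<close>. Describing \<open>P\<close> as the nonunits of \<open>V\<close>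
  replaces maximality by membership tests.\<close>

locale field_place =
  fixes k F :: "'a::field set" and P V :: "'a set"
  assumes k: "subfield k type_ring" and F: "subfield F type_ring"
    and ring: "subring V type_ring"
    and strict: "k \<subset> V" "V \<subset> F"
    and val: "\<And>z. z \<in> F \<Longrightarrow> z \<in> V \<or> inverse z \<in> V"
    and P_eq: "P = {z \<in> V. z = 0 \<or> inverse z \<notin> V}"
begin

lemmas k_closed = subfield_type_ringD[OF k]
lemmas F_closed = subfield_type_ringD[OF F]

lemma V_closed:
  "0 \<in> V" "1 \<in> V" "\<And>u. u \<in> V \<Longrightarrow> - u \<in> V" "\<And>u v. u \<in> V \<Longrightarrow> v \<in> V \<Longrightarrow> u + v \<in> V"
  "\<And>u v. u \<in> V \<Longrightarrow> v \<in> V \<Longrightarrow> u * v \<in> V" "\<And>u v. u \<in> V \<Longrightarrow> v \<in> V \<Longrightarrow> u - v \<in> V"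
  "\<And>u n. u \<in> V \<Longrightarrow> u ^ n \<in> V"
proof -
  show *: "1 \<in> V" "\<And>u. u \<in> V \<Longrightarrow> - u \<in> V" "\<And>u v. u \<in> V \<Longrightarrow> v \<in> V \<Longrightarrow> u + v \<in> V"
    "\<And>u v. u \<in> V \<Longrightarrow> v \<in> V \<Longrightarrow> u * v \<in> V"
    using ring by (auto simp: subring_type_ring_iff)
  show "u - v \<in> V" if "u \<in> V" "v \<in> V" for u v
    using *(3)[OF that(1) *(2)[OF that(2)]] by simp
  show "0 \<in> V" using *(3)[OF *(1) *(2)[OF *(1)]] by simp
  show "u ^ n \<in> V" if "u \<in> V" for u n
    using that by (induction n) (auto intro: *)
qed

lemma k_sub: "c \<in> k \<Longrightarrow> c \<in> V"
  using strict by auto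

lemma V_sub: "z \<in> V \<Longrightarrow> z \<in> F"
  using strict by auto

lemma P_sub: "z \<in> P \<Longrightarrow> z \<in> V"
  by (simp add: P_eq)

lemma P_zero: "0 \<in> P"
  by (simp add: P_eq V_closed)

lemma P_one: "1 \<notin> P"
  by (simp add: P_eq V_closed)

lemma inverse_in_P: "z \<in> F \<Longrightarrow> z \<notin> V \<Longrightarrow> inverse z \<in> P"
  using val[of z] by (auto simp: P_eq)

lemma not_P_inverse: "z \<in> V \<Longrightarrow> z \<notin> P \<Longrightarrow> inverse z \<in> V"
  by (auto simp: P_eq)

lemma P_mult: assumes "v \<in> V" "p \<in> P" shows "v * p \<in> P"
proof (cases "v * p = 0")
  case False
  have "inverse (v * p) \<notin> V"
  proof
    assume "inverse (v * p) \<in> V"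
    then have "v * inverse (v * p) \<in> V" using V_closed assms by blast
    moreover have "v * inverse (v * p) = inverse p" using False by (simp add: field_simps)
    ultimately have "inverse p \<in> V" by (simp only:)
    then show False using assms False by (auto simp: P_eq)
  qed
  then show ?thesis using assms V_closed by (auto simp: P_eq)
qed (use P_zero in auto)

lemma P_mult': "p \<in> P \<Longrightarrow> v \<in> V \<Longrightarrow> p * v \<in> P"
  using P_mult[of v p] by (simp add: mult.commute[of p v])

lemma P_minus: "p \<in> P \<Longrightarrow> - p \<in> P"
  using P_mult[of "-1" p] V_closed by simp

text \<open>One of \<open>p / q\<close> and \<open>q / p\<close> lies in \<open>V\<close>, so the
  sum is a \<open>V\<close>-multiple of one summand.\<close>

lemma P_add: assumes "p \<in> P" "q \<in> P" shows "p + q \<in> P"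
proof -
  have *: "p + q \<in> P" if "p \<in> P" "q \<in> P" "q \<noteq> 0" "p / q \<in> V" for p q
  proof -
    have "p + q = (p / q + 1) * q" using that by (simp add: field_simps)
    then show ?thesis using P_mult[of "p / q + 1" q] that V_closed by simp
  qed
  show ?thesis
  proof (cases "p = 0 \<or> q = 0")
    case False
    have "p / q \<in> F" using F_closed assms P_sub V_sub by auto
    then have "p / q \<in> V \<or> q / p \<in> V" using val[of "p / q"] by simp
    then show ?thesis using *[of p q] *[of q p] False assms by (auto simp: add.commute)
  qed (use assms in auto)
qed

lemma P_diff: "p \<in> P \<Longrightarrow> q \<in> P \<Longrightarrow> p - q \<in> P"
  using P_add[of p "-q"] P_minus by simp

lemma k_P: "c \<in> k \<Longrightarrow> c \<in> P \<Longrightarrow> c = 0"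
  using k_sub[of "inverse c"] k_closed by (auto simp: P_eq)

lemma P_power: "p \<in> P \<Longrightarrow> n > 0 \<Longrightarrow> p ^ n \<in> P"
  by (cases n) (auto intro: P_mult' V_closed P_sub)

lemma unit_mult: assumes "u \<in> V - P" "v \<in> V - P" shows "u * v \<in> V - P"
proof -
  have "u \<noteq> 0" "v \<noteq> 0" using assms P_zero by auto
  then show ?thesis
    using assms V_closed(5)[OF V_closed(5)[of "u * v" "inverse u"], of "inverse v"] V_closed
    by (auto simp: P_eq)
qed

lemma unit_inverse: assumes "u \<in> V - P" shows "inverse u \<in> V - P"
  using assms V_closed by (auto simp: P_eq)

lemma unit_power: "u \<in> V - P \<Longrightarrow> u ^ n \<in> V - P"
  by (induction n) (use P_one V_closed unit_mult in auto)

lemma unit_power_int: "u \<in> V - P \<Longrightarrow> u powi n \<in> V - P"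
  using unit_power unit_inverse by (auto simp: power_int_def)

lemma unit_add_P: assumes "u \<in> V - P" "p \<in> P" shows "u + p \<in> V - P"
  using assms P_diff[of "u + p" p] P_sub V_closed by auto

lemma unit_k: "c \<in> k \<Longrightarrow> c \<noteq> 0 \<Longrightarrow> c \<in> V - P"
  using k_P k_sub by auto

lemma place_ring_eq: "place_ring F P = V"
proof
  show "place_ring F P \<subseteq> V"
    using V_closed(1) inverse_in_P by (auto simp: place_ring_def)
  show "V \<subseteq> place_ring F P"
    using V_sub by (auto simp: place_ring_def P_eq)
qed

lemma P_nontrivial: "\<exists>p\<in>P. p \<noteq> 0"
proof -
  obtain z where "z \<in> F" "z \<notin> V" using strict by auto
  then show ?thesis using inverse_in_P[of z] V_closed by (intro bexI[of _ "inverse z"]) auto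
qed

text \<open>Outside \<open>P\<close> every element of \<open>V\<close> is a unit, so an ideal that
  exceeds \<open>P\<close> contains 1.\<close>

lemma maximal: "maximalideal P (ring_on V)"
proof -
  interpret K: field "type_ring :: 'a ring" by (rule field_from_type_algebra)
  interpret R: ring "ring_on V" using K.subring_is_ring[OF ring] .
  have ai: "\<ominus>\<^bsub>ring_on V\<^esub> p = - p" if "p \<in> V" for p
    using R.minus_equality[of "-p" p] that V_closed by simp
  show ?thesis
  proof (rule maximalidealI)
    show "ideal P (ring_on V)"
    proof (rule idealI)
      show "ring (ring_on V)" by (rule R.ring_axioms)
      show "subgroup P (add_monoid (ring_on V))"
      proof (rule group.subgroupI)
        show "group (add_monoid (ring_on V))" by (rule R.add.group_axioms)
        show "inv\<^bsub>add_monoid (ring_on V)\<^esub> a \<in> P" if "a \<in> P" for a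
          using ai[of a] that P_sub P_minus by (simp add: a_inv_def)
      qed (use P_sub P_zero P_add in auto)
    qed (use P_mult P_mult' in auto)
    show "carrier (ring_on V) \<noteq> P" using P_one V_closed by auto
    show "J = P \<or> J = carrier (ring_on V)" if J: "ideal J (ring_on V)" "P \<subseteq> J"
        "J \<subseteq> carrier (ring_on V)" for J
    proof (rule disjCI)
      interpret J: ideal J "ring_on V" by (rule J)
      assume "J \<noteq> carrier (ring_on V)"
      then have "1 \<notin> J" using J.one_imp_carrier by auto
      have "j \<in> P" if j: "j \<in> J" for j
      proof (rule ccontr)
        assume "j \<notin> P"
        then have "inverse j \<in> V" "j \<noteq> 0" using j J(3) not_P_inverse P_zero by auto
        then show False using J.I_r_closed[of j "inverse j"] j \<open>1 \<notin> J\<close> by simp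
      qed
      then show "J = P" using J by auto
    qed
  qed
qed

lemma place: "P \<in> places k F"
proof -
  have "valuation_ring k F V"
    unfolding valuation_ring_def using ring strict val by blast
  then show ?thesis unfolding places_def using maximal by blast
qed

end

text \<open>A maximal ideal of \<open>V\<close> contains no unit, so it lies in the set
  \<open>N\<close> of nonunits; \<open>N\<close> is itself a proper ideal, and maximality gives
  equality.\<close>

lemma placesD:
  assumes "P \<in> places k F" and k: "subfield k type_ring" and F: "subfield F type_ring"
  shows "field_place k F P (place_ring F P)"
proof -
  obtain V where V: "valuation_ring k F V" "maximalideal P (ring_on V)"
    using assms by (auto simp: places_def)
  define N where "N = {z \<in> V. z = 0 \<or> inverse z \<notin> V}"
  interpret N: field_place k F N V
    by (rule field_place.intro) (use V k F in \<open>auto simp: valuation_ring_def N_def\<close>)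
  interpret P: maximalideal P "ring_on V" by (rule V)
  interpret M: maximalideal N "ring_on V" by (rule N.maximal)
  have sub: "P \<subseteq> V" using P.a_subset by simp
  have "P \<subseteq> N"
  proof
    fix p assume p: "p \<in> P"
    show "p \<in> N"
    proof (rule ccontr)
      assume "p \<notin> N"
      then have "inverse p \<in> V" "p \<noteq> 0" using p sub N.not_P_inverse N.P_zero by auto
      then have "1 \<in> P" using P.I_r_closed[of p "inverse p"] p by simp
      then show False using P.one_imp_carrier maximalideal.I_notcarr[OF V(2)] by simp
    qed
  qed
  then have "N = P"
    using P.I_maximal[OF M.is_ideal] N.P_sub N.P_one N.V_closed(2) by fastforce
  then show ?thesis using N.place_ring_eq N.field_place_axioms by simp
qed

section \<open>Degree one, prime elements and orders\<close>

context field_place begin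

text \<open>Rationality is used only in this form: every regular function has a value in
  \<open>k\<close>. The forward direction starts from an arbitrary basis vector of the residue field
  and has to replace it by 1.\<close>

lemma has_degree_one_iff: "has_degree k F P 1 \<longleftrightarrow> (\<forall>v\<in>V. \<exists>c\<in>k. v - c \<in> P)"
proof -
  interpret K: field "type_ring :: 'a ring" by (rule field_from_type_algebra)
  interpret R: ring "ring_on V" using K.subring_is_ring[OF ring] .
  interpret I: ideal P "ring_on V" using maximal by (simp add: maximalideal_def)
  interpret Q: ring "ring_on V Quot P" by (rule I.quotient_is_ring)
  define \<phi> where "\<phi> = (\<lambda>c. P +>\<^bsub>ring_on V\<^esub> c)"
  have hom: "\<phi> \<in> ring_hom (ring_on V) (ring_on V Quot P)"
    using I.rcos_ring_hom by (simp add: \<phi>_def)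
  have carr: "carrier (ring_on V Quot P) = \<phi> ` V"
    by (auto simp: FactRing_def A_RCOSETS_def' \<phi>_def)
  have minus: "a \<ominus>\<^bsub>ring_on V\<^esub> b = a - b" if "a \<in> V" "b \<in> V" for a b
    using R.minus_equality[of "-b" b] that V_closed by (simp add: a_minus_def)
  have eq: "\<phi> a = \<phi> b \<longleftrightarrow> a - b \<in> P" if "a \<in> V" "b \<in> V" for a b
    using R.quotient_eq_iff_same_a_r_cos[OF I.ideal_axioms, of a b] that minus by (simp add: \<phi>_def)
  have mult: "\<phi> a \<otimes>\<^bsub>ring_on V Quot P\<^esub> \<phi> b = \<phi> (a * b)" if "a \<in> V" "b \<in> V" for a b
    using ring_hom_mult[OF hom, of a b] that by simp
  have zero: "\<zero>\<^bsub>ring_on V Quot P\<^esub> = \<phi> 0"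
    using ring_hom_zero[OF hom R.ring_axioms Q.ring_axioms] by simp
  \<comment> \<open>Dimension one is built by adding one line to the zero space; here such a line is
    computed.\<close>
  have line: "Q.line_extension (\<phi> ` k) (\<phi> v) {\<zero>\<^bsub>ring_on V Quot P\<^esub>} =
      (\<lambda>c. \<phi> (c * v)) ` k" if "v \<in> V" for v
  proof -
    have "\<phi> c \<otimes>\<^bsub>ring_on V Quot P\<^esub> \<phi> v \<oplus>\<^bsub>ring_on V Quot P\<^esub> \<zero>\<^bsub>ring_on V Quot P\<^esub> = \<phi> (c * v)"
      if "c \<in> k" for c
      using mult[of c v] k_sub[OF that] \<open>v \<in> V\<close> V_closed carr Q.r_zero[of "\<phi> (c * v)"] by auto
    then show ?thesis
      unfolding Q.line_extension_def set_add_def' r_coset_def by force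
  qed
  have deg: "has_degree k F P 1 \<longleftrightarrow> Q.dimension 1 (\<phi> ` k) (\<phi> ` V)"
    unfolding has_degree_def place_ring_eq Let_def \<phi>_def[symmetric] carr ..
  show ?thesis
  proof
    assume "has_degree k F P 1"
    then have "Q.dimension 1 (\<phi> ` k) (\<phi> ` V)" using deg by simp
    then obtain w E where w: "w \<in> \<phi> ` V" "Q.dimension 0 (\<phi> ` k) E"
      "\<phi> ` V = Q.line_extension (\<phi> ` k) w E"
      by (cases rule: Q.dimension.cases) (use carr in auto)
    from w(2) have "E = {\<zero>\<^bsub>ring_on V Quot P\<^esub>}"
      by (cases rule: Q.dimension.cases) auto
    moreover obtain v where v: "v \<in> V" "w = \<phi> v" using w(1) by blast
    ultimately have v: "v \<in> V" "\<phi> ` V = (\<lambda>c. \<phi> (c * v)) ` k"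
      using line[OF v(1)] w(3) by simp_all
    have ex: "\<exists>c\<in>k. u - c * v \<in> P" if "u \<in> V" for u
    proof -
      have "\<phi> u \<in> (\<lambda>c. \<phi> (c * v)) ` k" using imageI[OF that, of \<phi>] v(2) by simp
      then obtain c where c: "c \<in> k" "\<phi> u = \<phi> (c * v)" by auto
      then have "u - c * v \<in> P"
        using eq[OF that V_closed(5)[OF k_sub[OF c(1)] v(1)]] by simp
      then show ?thesis using c(1) by blast
    qed
    \<comment> \<open>The case \<open>u = 1\<close> shows that the basis vector \<open>v\<close> is
      congruent to \<open>1 / b\<close>; hence \<open>u\<close>, which is congruent to
      \<open>c * v\<close>, is congruent to \<open>c / b\<close>.\<close>
    obtain b where b: "b \<in> k" "1 - b * v \<in> P" using ex[OF V_closed(2)] by blast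
    then have "b \<noteq> 0" using P_one by auto
    show "\<forall>u\<in>V. \<exists>c\<in>k. u - c \<in> P"
    proof
      fix u assume u: "u \<in> V"
      obtain c where c: "c \<in> k" "u - c * v \<in> P" using ex u by blast
      have "u - c / b = (u - c * v) - (c / b) * (1 - b * v)"
        using \<open>b \<noteq> 0\<close> by (simp add: field_simps)
      moreover have "c / b \<in> k" using k_closed b c by auto
      ultimately show "\<exists>c\<in>k. u - c \<in> P"
        using P_diff[OF c(2) P_mult[OF k_sub b(2), of "c / b"]] by metis
    qed
  next
    assume a: "\<forall>v\<in>V. \<exists>c\<in>k. v - c \<in> P"
    have "\<phi> ` V = \<phi> ` k"
    proof
      show "\<phi> ` V \<subseteq> \<phi> ` k"
      proof
        fix q assume "q \<in> \<phi> ` V"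
        then obtain v where v: "v \<in> V" "q = \<phi> v" by auto
        then obtain c where "c \<in> k" "v - c \<in> P" using a by auto
        then show "q \<in> \<phi> ` k" using eq[of v c] v k_sub by auto
      qed
    qed (use k_sub in auto)
    moreover have "Q.line_extension (\<phi> ` k) (\<phi> 1) {\<zero>\<^bsub>ring_on V Quot P\<^esub>} = \<phi> ` k"
      using line[of 1] V_closed by simp
    moreover have "\<phi> 1 \<noteq> \<phi> 0"
      using eq[of 1 0] V_closed P_one by simp
    ultimately show "has_degree k F P 1"
      using Q.Suc_dim[OF _ _ Q.zero_dim, of "\<phi> 1" "\<phi> ` k"] V_closed(2) carr zero deg
        imageI[OF k_closed(2), of \<phi>]
      by simp
  qed
qed

lemma prime_elementD:
  assumes "prime_element F P t"
  shows "t \<in> P" "t \<noteq> 0" "p \<in> P \<Longrightarrow> \<exists>w\<in>V. p = t * w"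
proof -
  have t: "t \<in> P" "P = (\<lambda>w. t * w) ` V"
    using assms unfolding prime_element_def place_ring_eq by blast+
  then show "t \<in> P" "p \<in> P \<Longrightarrow> \<exists>w\<in>V. p = t * w" by blast+
  obtain p where "p \<in> P" "p \<noteq> 0" using P_nontrivial by blast
  then show "t \<noteq> 0" using t by force
qed

lemma prime_elements_associated:
  assumes "prime_element F P t" "prime_element F P s"
  shows "\<exists>u\<in>V - P. s = t * u"
proof -
  obtain w where w: "w \<in> V" "s = t * w"
    using prime_elementD(3)[OF assms(1) prime_elementD(1)[OF assms(2)]] by blast
  obtain w' where w': "w' \<in> V" "t = s * w'"
    using prime_elementD(3)[OF assms(2) prime_elementD(1)[OF assms(1)]] by blast
  have "t * (w * w') = t * 1" using w'(2) unfolding w(2) by (simp add: mult.assoc)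
  then have "w * w' = 1" using prime_elementD(2)[OF assms(1)] mult_left_cancel by blast
  then have "w \<noteq> 0" "inverse w = w'" by (auto simp: inverse_unique)
  then have "w \<notin> P" using w' by (auto simp: P_eq)
  then show ?thesis using w by blast
qed

text \<open>\<open>has_order\<close> allows a different prime element in every representation; two
  of them differ by a unit \<open>v\<close>, and \<open>v powi n\<close> is absorbed into
  \<open>u\<close>. With one fixed \<open>t\<close>, the orders of several functions can be
  combined.\<close>

lemma has_order_iff:
  assumes "prime_element F P t"
  shows "has_order F P z n \<longleftrightarrow> (\<exists>u\<in>V - P. z = t powi n * u)"
proof
  assume "has_order F P z n"
  then obtain s u where s: "prime_element F P s" "u \<in> V - P" "z = s powi n * u"
    by (auto simp: has_order_def place_ring_eq)
  obtain v where v: "v \<in> V - P" "s = t * v" using prime_elements_associated[OF assms s(1)] by blast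
  have "z = t powi n * (v powi n * u)"
    using v s by (simp add: power_int_mult_distrib)
  then show "\<exists>u\<in>V - P. z = t powi n * u"
    using unit_mult[OF unit_power_int[OF v(1)] s(2)] by blast
next
  show "\<exists>u\<in>V - P. z = t powi n * u \<Longrightarrow> has_order F P z n"
    using assms by (auto simp: has_order_def place_ring_eq)
qed

lemma has_order_prime: "has_order F P z n \<Longrightarrow> \<exists>t. prime_element F P t"
  by (auto simp: has_order_def)

lemma has_order_mult:
  assumes "has_order F P z n" "has_order F P w m"
  shows "has_order F P (z * w) (n + m)"
proof -
  obtain t where t: "prime_element F P t" using assms has_order_prime by blast
  obtain u v where "u \<in> V - P" "v \<in> V - P" "z = t powi n * u" "w = t powi m * v"
    using assms has_order_iff[OF t] by blast
  moreover from this have "z * w = t powi (n + m) * (u * v)"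
    using prime_elementD(2)[OF t] by (simp add: power_int_add)
  ultimately show ?thesis
    using has_order_iff[OF t] unit_mult by blast
qed

lemma has_order_inverse:
  assumes "has_order F P z n"
  shows "has_order F P (inverse z) (- n)"
proof -
  obtain t where t: "prime_element F P t" using assms has_order_prime by blast
  obtain u where "u \<in> V - P" "z = t powi n * u"
    using assms has_order_iff[OF t] by blast
  moreover from this have "inverse z = t powi (- n) * inverse u"
    by (simp add: power_int_minus)
  ultimately show ?thesis
    using has_order_iff[OF t] unit_inverse by blast
qed

lemma has_order_nonzero: "has_order F P z n \<Longrightarrow> z \<noteq> 0"
  unfolding has_order_def place_ring_eq using P_zero prime_elementD(2) by fastforce

lemma has_order_pos: assumes "has_order F P z n" "n > 0" shows "z \<in> P"
proof -
  obtain t where t: "prime_element F P t" using assms has_order_prime by blast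
  obtain u where "u \<in> V - P" "z = t powi n * u"
    using assms has_order_iff[OF t] by blast
  then show ?thesis
    using assms(2) P_mult'[OF P_power[OF prime_elementD(1)[OF t], of "nat n"], of u]
    by (auto simp: power_int_def)
qed

lemma has_order_0: "has_order F P z 0 \<Longrightarrow> z \<in> V - P"
  unfolding has_order_def place_ring_eq by auto

lemma has_order_nonneg: "has_order F P z n \<Longrightarrow> n \<ge> 0 \<Longrightarrow> z \<in> V"
  using has_order_0 has_order_pos P_sub by (cases "n = 0") auto

lemma has_order_nonneg_iff: assumes "has_order F P z n" shows "z \<in> V \<longleftrightarrow> n \<ge> 0"
proof (rule iffI)
  assume z: "z \<in> V"
  show "n \<ge> 0"
  proof (rule ccontr)
    assume "\<not> n \<ge> 0"
    then have "inverse z \<in> P" using has_order_pos[OF has_order_inverse[OF assms]] by simp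
    then show False using z has_order_nonzero[OF assms] by (auto simp: P_eq)
  qed
qed (use assms has_order_nonneg in auto)

text \<open>\<open>z / z = 1\<close> has the orders \<open>n - m\<close> and \<open>m - n\<close>,
  and a positive one would put 1 into \<open>P\<close>.\<close>

lemma has_order_unique: assumes "has_order F P z n" "has_order F P z m" shows "n = m"
proof -
  have "has_order F P 1 (n - m)"
    using has_order_mult[OF assms(1) has_order_inverse[OF assms(2)]] has_order_nonzero[OF assms(1)]
    by simp
  moreover from this have "has_order F P 1 (m - n)" using has_order_inverse[of 1 "n - m"] by simp
  ultimately have "\<not> n - m > 0" "\<not> m - n > 0" using has_order_pos[of 1] P_one by blast+
  then show ?thesis by simp
qed

text \<open>Discreteness is obtained by factoring every function into a power of \<open>t\<close>
  and a unit; for an element of \<open>P\<close> the exponent must be positive, since otherwise its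
  inverse would be regular.\<close>

lemma prime_elementI:
  assumes t: "t \<in> P" and ex: "\<And>z. z \<in> F \<Longrightarrow> z \<noteq> 0 \<Longrightarrow> \<exists>n::int. \<exists>u\<in>V - P. z = t powi n * u"
  shows "prime_element F P t"
proof -
  have "\<exists>w\<in>V. p = t * w" if p: "p \<in> P" for p
  proof (cases "p = 0")
    case False
    obtain n u where u: "u \<in> V - P" "p = t powi n * u" using ex p P_sub V_sub False by metis
    have "n > 0"
    proof (rule ccontr)
      assume "\<not> n > 0"
      then have "inverse p = t ^ nat (- n) * inverse u"
        using u by (cases "n = 0") (auto simp: power_int_def power_inverse)
      then have "inverse p \<in> V" using V_closed t P_sub unit_inverse[OF u(1)] by auto
      then show False using p False by (auto simp: P_eq)
    qed
    then have "p = t * (t ^ (nat n - 1) * u)"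
      using u by (cases "nat n") (auto simp: power_int_def)
    moreover have "t ^ (nat n - 1) * u \<in> V"
      using V_closed(5)[OF V_closed(7)[OF P_sub[OF t]]] u(1) by simp
    ultimately show ?thesis by blast
  qed (use V_closed in auto)
  then have "P = (\<lambda>w. t * w) ` V" using P_mult'[OF t] by blast
  then show ?thesis using t unfolding prime_element_def place_ring_eq by blast
qed

end

section \<open>Transport of places along automorphisms\<close>

text \<open>Stated for an abstract operation \<open>f\<close> because it is applied to both addition
  and multiplication.\<close>

lemma inv_into_closed_hom:
  assumes b: "bij_betw \<phi> F F" and cl: "\<And>u v. u \<in> F \<Longrightarrow> v \<in> F \<Longrightarrow> f u v \<in> F"
    and h: "\<And>u v. u \<in> F \<Longrightarrow> v \<in> F \<Longrightarrow> \<phi> (f u v) = f (\<phi> u) (\<phi> v)"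
    and uv: "u \<in> F" "v \<in> F"
  shows "inv_into F \<phi> (f u v) = f (inv_into F \<phi> u) (inv_into F \<phi> v)"
proof -
  have i: "inv_into F \<phi> w \<in> F" "\<phi> (inv_into F \<phi> w) = w" if "w \<in> F" for w
    using b that by (auto simp: bij_betw_def f_inv_into_f inv_into_into)
  have "\<phi> (f (inv_into F \<phi> u) (inv_into F \<phi> v)) = f u v"
    using h i uv by metis
  then show ?thesis
    using inv_into_f_f[of \<phi> F "f (inv_into F \<phi> u) (inv_into F \<phi> v)"] cl i uv b
    by (simp add: bij_betw_def)
qed

text \<open>\<open>\<phi>\<close> is a function on the whole type but is controlled only on
  \<open>F\<close>, hence the membership premises throughout.\<close>

locale field_aut =
  fixes k F :: "'a::field set" and \<phi> :: "'a \<Rightarrow> 'a"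
  assumes k: "subfield k type_ring" and F: "subfield F type_ring" and sub: "k \<subseteq> F"
    and aut: "\<phi> \<in> field_auts k F"
begin

lemmas F_closed = subfield_type_ringD[OF F]

lemma bij: "bij_betw \<phi> F F" and add: "u \<in> F \<Longrightarrow> v \<in> F \<Longrightarrow> \<phi> (u + v) = \<phi> u + \<phi> v"
  and mult: "u \<in> F \<Longrightarrow> v \<in> F \<Longrightarrow> \<phi> (u * v) = \<phi> u * \<phi> v" and one: "\<phi> 1 = 1"
  and const: "c \<in> k \<Longrightarrow> \<phi> c = c"
  using aut by (auto simp: field_auts_def ring_iso_def ring_hom_def)

lemma closed: "u \<in> F \<Longrightarrow> \<phi> u \<in> F"
  using bij by (auto simp: bij_betw_def)

lemma zero: "\<phi> 0 = 0"
  using add[OF F_closed(1) F_closed(1)] by (metis add.right_neutral add_left_cancel)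

lemma eq_0: "u \<in> F \<Longrightarrow> \<phi> u = 0 \<longleftrightarrow> u = 0"
  using bij zero F_closed(1) by (metis bij_betw_def inj_on_contraD)

lemma minus: "u \<in> F \<Longrightarrow> \<phi> (- u) = - \<phi> u"
  using add[of u "-u"] F_closed(3)[of u] zero by (simp add: eq_neg_iff_add_eq_0 add.commute)

lemma diff: "u \<in> F \<Longrightarrow> v \<in> F \<Longrightarrow> \<phi> (u - v) = \<phi> u - \<phi> v"
  using add[of u "-v"] F_closed(3)[of v] minus[of v] by simp

lemma inverse: "u \<in> F \<Longrightarrow> \<phi> (inverse u) = inverse (\<phi> u)"
  using mult[of u "inverse u"] F_closed(7)[of u] one zero
  by (cases "u = 0") (simp_all add: inverse_unique)

lemma power: "u \<in> F \<Longrightarrow> \<phi> (u ^ n) = \<phi> u ^ n"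
  by (induction n) (simp_all add: one mult F_closed(9))

lemma power_int: "u \<in> F \<Longrightarrow> \<phi> (u powi n) = \<phi> u powi n"
  using power[of "inverse u" "nat (-n)"] F_closed(7)[of u]
  by (simp add: power_int_def power inverse)

lemma inj_iff: "u \<in> F \<Longrightarrow> v \<in> F \<Longrightarrow> \<phi> u = \<phi> v \<longleftrightarrow> u = v"
  using bij by (auto simp: bij_betw_def inj_on_def)

lemma image_mem_iff: "A \<subseteq> F \<Longrightarrow> u \<in> F \<Longrightarrow> \<phi> u \<in> \<phi> ` A \<longleftrightarrow> u \<in> A"
  using inj_iff by blast

lemma image_eq_iff: "A \<subseteq> F \<Longrightarrow> B \<subseteq> F \<Longrightarrow> \<phi> ` A = \<phi> ` B \<longleftrightarrow> A = B"
  using bij by (auto simp: bij_betw_def inj_on_image_eq_iff)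

lemma surj: "u \<in> F \<Longrightarrow> \<exists>v\<in>F. u = \<phi> v"
  using bij by (auto simp: bij_betw_def)

lemma inv_aut: "field_aut k F (inv_into F \<phi>)"
proof (rule field_aut.intro)
  have b: "bij_betw (inv_into F \<phi>) F F" using bij bij_betw_inv_into by blast
  have "inv_into F \<phi> c = c" if "c \<in> k" for c
    using that sub const[OF that] inv_into_f_f[of \<phi> F c] bij by (auto simp: bij_betw_def)
  moreover have "inv_into F \<phi> 1 = 1"
    using one inv_into_f_f[of \<phi> F 1] bij F_closed(2) by (auto simp: bij_betw_def)
  ultimately show "inv_into F \<phi> \<in> field_auts k F"
    using b inv_into_closed_hom[where f = "(+)", OF bij F_closed(4) add]
      inv_into_closed_hom[where f = "(*)", OF bij F_closed(5) mult]
    by (auto simp: field_auts_def ring_iso_def ring_hom_def bij_betw_def)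
qed (rule k F sub)+

lemma place_image:
  assumes "field_place k F P V"
  shows "field_place k F (\<phi> ` P) (\<phi> ` V)"
proof -
  interpret p: field_place k F P V by (rule assms)
  have VF: "V \<subseteq> F" using p.strict by blast
  show ?thesis
  proof (rule field_place.intro)
    show "subring (\<phi> ` V) type_ring"
      unfolding subring_type_ring_iff
    proof (intro conjI ballI)
      show "1 \<in> \<phi> ` V" using one p.V_closed(2) by force
      show "- u \<in> \<phi> ` V" if u: "u \<in> \<phi> ` V" for u
      proof -
        obtain w where "w \<in> V" "u = \<phi> w" using u by blast
        then show ?thesis using minus[of w] p.V_closed(3) p.V_sub
            by (intro image_eqI[of _ _ "- w"]) auto
      qed
      show "u + v \<in> \<phi> ` V" "u * v \<in> \<phi> ` V" if uv: "u \<in> \<phi> ` V" "v \<in> \<phi> ` V" for u v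
      proof -
        obtain u' v' where w: "u' \<in> V" "u = \<phi> u'" "v' \<in> V" "v = \<phi> v'" using uv by blast
        then show "u + v \<in> \<phi> ` V"
          using add[of u' v'] p.V_closed(4) p.V_sub by (intro image_eqI[of _ _ "u' + v'"]) auto
        show "u * v \<in> \<phi> ` V"
          using w mult[of u' v'] p.V_closed(5) p.V_sub by (intro image_eqI[of _ _ "u' * v'"]) auto
      qed
    qed
    show "k \<subset> \<phi> ` V"
    proof
      show "k \<subseteq> \<phi> ` V" using const p.k_sub by force
      obtain v where "v \<in> V" "v \<notin> k" using p.strict by blast
      then show "k \<noteq> \<phi> ` V"
        using const sub inj_iff p.V_sub by (metis image_eqI subsetD)
    qed
    show "\<phi> ` V \<subset> F"
    proof
      show "\<phi> ` V \<subseteq> F" using closed p.V_sub by blast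
      obtain v where "v \<in> F" "v \<notin> V" using p.strict by blast
      then show "\<phi> ` V \<noteq> F"
        using image_mem_iff[OF VF] closed by metis
    qed
    show "z \<in> \<phi> ` V \<or> inverse z \<in> \<phi> ` V" if "z \<in> F" for z
      using surj[OF that] p.val inverse by (metis image_eqI)
    show "\<phi> ` P = {z \<in> \<phi> ` V. z = 0 \<or> inverse z \<notin> \<phi> ` V}"
    proof -
      have *: "\<phi> v \<in> \<phi> ` P \<longleftrightarrow> \<phi> v = 0 \<or> inverse (\<phi> v) \<notin> \<phi> ` V" if v: "v \<in> V" for v
      proof -
        have "v \<in> F" using v p.V_sub by blast
        have "P \<subseteq> F" using p.P_sub p.V_sub by blast
        show ?thesis
          using image_mem_iff[OF \<open>P \<subseteq> F\<close> \<open>v \<in> F\<close>] image_mem_iff[OF VF F_closed(7)[OF \<open>v \<in> F\<close>]]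
            inverse[OF \<open>v \<in> F\<close>] eq_0[OF \<open>v \<in> F\<close>] v by (simp add: p.P_eq)
      qed
      show ?thesis
      proof (intro equalityI subsetI)
        fix w assume w: "w \<in> \<phi> ` P"
        then obtain v where "v \<in> V" "w = \<phi> v" using p.P_sub by blast
        then show "w \<in> {z \<in> \<phi> ` V. z = 0 \<or> inverse z \<notin> \<phi> ` V}" using * w by simp
      next
        fix w assume w: "w \<in> {z \<in> \<phi> ` V. z = 0 \<or> inverse z \<notin> \<phi> ` V}"
        then obtain v where "v \<in> V" "w = \<phi> v" by blast
        then show "w \<in> \<phi> ` P" using * w by simp
      qed
    qed
  qed (rule k F)+
qed

lemma places_image: "P \<in> places k F \<Longrightarrow> \<phi> ` P \<in> places k F"
  using place_image placesD[OF _ k F] field_place.place by blast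

lemma places_sub: "P \<in> places k F \<Longrightarrow> P \<subseteq> F"
  using placesD[OF _ k F, of P] field_place.P_sub field_place.V_sub by blast

lemma places_surj: assumes "P \<in> places k F" shows "\<exists>P'\<in>places k F. P = \<phi> ` P'"
proof
  interpret i: field_aut k F "inv_into F \<phi>" by (rule inv_aut)
  show "inv_into F \<phi> ` P \<in> places k F" by (rule i.places_image[OF assms])
  show "P = \<phi> ` inv_into F \<phi> ` P"
    using image_inv_into_cancel[of \<phi> F F P] places_sub[OF assms] bij by (simp add: bij_betw_def)
qed

lemma place_ring_image: "P \<in> places k F \<Longrightarrow> place_ring F (\<phi> ` P) = \<phi> ` place_ring F P"
  using field_place.place_ring_eq[OF place_image] placesD[OF _ k F] by blast

lemma rational_places_image:
  assumes "P \<in> rational_places k F" shows "\<phi> ` P \<in> rational_places k F"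
proof -
  have P: "P \<in> places k F" "has_degree k F P 1" using assms by (auto simp: rational_places_def)
  interpret p: field_place k F P "place_ring F P" by (rule placesD[OF P(1) k F])
  interpret q: field_place k F "\<phi> ` P" "\<phi> ` place_ring F P" by (rule place_image) unfold_locales
  have "\<exists>c\<in>k. v - c \<in> \<phi> ` P" if v: "v \<in> \<phi> ` place_ring F P" for v
  proof -
    obtain w where w: "w \<in> place_ring F P" "v = \<phi> w" using v by blast
    obtain c where c: "c \<in> k" "w - c \<in> P" using P(2) p.has_degree_one_iff w by blast
    have "v - c = \<phi> (w - c)" using diff[of w c] c const w p.V_sub p.k_sub by simp
    then show ?thesis using c by blast
  qed
  then show ?thesis
    using q.has_degree_one_iff q.place by (simp add: rational_places_def)
qed

lemma prime_element_image:
  assumes P: "P \<in> places k F" and t: "prime_element F P t"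
  shows "prime_element F (\<phi> ` P) (\<phi> t)"
proof -
  interpret p: field_place k F P "place_ring F P" by (rule placesD[OF P(1) k F])
  have t: "t \<in> P" "P = (\<lambda>w. t * w) ` place_ring F P"
    using t unfolding prime_element_def by blast+
  have "\<phi> ` P = (\<lambda>w. \<phi> (t * w)) ` place_ring F P" using t(2) by (metis image_image)
  also have "\<dots> = (\<lambda>w. \<phi> t * w) ` \<phi> ` place_ring F P"
    unfolding image_image using mult p.P_sub[OF t(1)] p.V_sub by (intro image_cong) auto
  finally show ?thesis
    unfolding prime_element_def place_ring_image[OF P] using t(1) by blast
qed

lemma has_order_image:
  assumes P: "P \<in> places k F" and z: "has_order F P z n"
  shows "has_order F (\<phi> ` P) (\<phi> z) n"
proof -
  interpret p: field_place k F P "place_ring F P" by (rule placesD[OF P(1) k F])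
  obtain t u where t: "prime_element F P t" "u \<in> place_ring F P - P" "z = t powi n * u"
    using z unfolding has_order_def by blast
  have tF: "t \<in> F" "u \<in> F" using p.prime_elementD(1)[OF t(1)] p.P_sub p.V_sub t(2) by auto
  have "\<phi> z = \<phi> t powi n * \<phi> u"
    using t tF mult power_int F_closed(10) by simp
  moreover have "\<phi> u \<in> place_ring F (\<phi> ` P) - \<phi> ` P"
    unfolding place_ring_image[OF P] using image_mem_iff[OF places_sub[OF P] tF(2)] t(2) by blast
  ultimately show ?thesis
    unfolding has_order_def using prime_element_image[OF P t(1)] by blast
qed

text \<open>If \<open>z\<close> realizes the equivalence, \<open>\<phi> z\<close> realizes its
  image: every place is the image of some place \<open>B\<close>, and the coefficients match because
  \<open>\<phi>\<close> is injective on places.\<close>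

lemma lin_equiv_image:
  assumes pl: "P \<in> places k F" "Q \<in> places k F" "R \<in> places k F" "S \<in> places k F"
    and eq: "lin_equiv k F (frag_of P + frag_of Q) (frag_of R + frag_of S)"
  shows "lin_equiv k F (frag_of (\<phi> ` P) + frag_of (\<phi> ` Q)) (frag_of (\<phi> ` R) + frag_of (\<phi> ` S))"
proof -
  obtain z where z: "z \<in> F" "z \<noteq> 0" "\<And>B. B \<in> places k F \<Longrightarrow>
      has_order F B z (Poly_Mapping.lookup (frag_of P + frag_of Q - (frag_of R + frag_of S)) B)"
    using eq unfolding lin_equiv_def by blast
  have "has_order F Y (\<phi> z) (Poly_Mapping.lookup (frag_of (\<phi> ` P) + frag_of (\<phi> ` Q) -
      (frag_of (\<phi> ` R) + frag_of (\<phi> ` S))) Y)" if Y: "Y \<in> places k F" for Y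
  proof -
    obtain B where B: "B \<in> places k F" "Y = \<phi> ` B" using places_surj[OF Y] by blast
    have "Poly_Mapping.lookup (frag_of (\<phi> ` A)) (\<phi> ` B) = Poly_Mapping.lookup (frag_of A) B"
      if A: "A \<in> places k F" for A
      using image_eq_iff[OF places_sub[OF A] places_sub[OF B(1)]]
      by (cases "A = B") (simp_all add: lookup_single)
    then show ?thesis
      using has_order_image[OF B(1) z(3)[OF B(1)]] pl
      unfolding B(2) by (simp only: lookup_add lookup_minus)
  qed
  then show ?thesis
    unfolding lin_equiv_def using z(1,2) closed eq_0 by blast
qed

end

section \<open>Calculus of linear equivalence\<close>

lemma lin_equiv_cancel: "lin_equiv k F (D + E) (D' + E) \<longleftrightarrow> lin_equiv k F D D'"
  by (simp add: lin_equiv_def)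

text \<open>The quotient of \<open>z2\<close> by \<open>z1\<close> realizes the equivalence. The
  Euclidean form fits the application, where two place sums with the same left side are
  compared.\<close>

lemma lin_equiv_trans:
  assumes k: "subfield k type_ring" and F: "subfield F type_ring"
    and "lin_equiv k F D D1" "lin_equiv k F D D2"
  shows "lin_equiv k F D1 D2"
proof -
  obtain z1 where z1: "z1 \<in> F - {0}" "\<forall>P\<in>places k F. has_order F P z1 (Poly_Mapping.lookup (D -
      D1) P)"
    using assms(3) unfolding lin_equiv_def by blast
  obtain z2 where z2: "z2 \<in> F - {0}" "\<forall>P\<in>places k F. has_order F P z2 (Poly_Mapping.lookup (D -
      D2) P)"
    using assms(4) unfolding lin_equiv_def by blast
  have "has_order F P (z2 * inverse z1) (Poly_Mapping.lookup (D1 - D2) P)" if P: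
      "P \<in> places k F" for P
  proof -
    interpret p: field_place k F P "place_ring F P" by (rule placesD[OF P k F])
    show ?thesis
      using p.has_order_mult[OF z2(2)[rule_format, OF P] p.has_order_inverse[OF z1(2)[rule_format,
          OF P]]]
      by (simp add: lookup_minus)
  qed
  moreover have "z2 * inverse z1 \<in> F - {0}"
    using z1 z2 subfield_type_ringD(5,7)[OF F] by simp
  ultimately show ?thesis unfolding lin_equiv_def by blast
qed

section \<open>Weierstrass function fields\<close>

text \<open>Coefficients stay in the ambient type, so that a polynomial can be evaluated at
  \<open>x\<close> and at constants alike; \<open>k\<close> enters only as a restriction on
  them.\<close>

definition polys_over :: "'a::field set \<Rightarrow> 'a poly set" where
  "polys_over k = {p. \<forall>i. Polynomial.coeff p i \<in> k}"

context
  fixes k :: "'a::field set"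
  assumes k: "subfield k type_ring"
begin

lemma polys_over_pCons: "pCons a p \<in> polys_over k \<longleftrightarrow> a \<in> k \<and> p \<in> polys_over k"
  by (auto simp: polys_over_def coeff_pCons split: nat.splits)

lemma polys_over_0: "0 \<in> polys_over k"
  using subfield_type_ringD(1)[OF k] by (simp add: polys_over_def)

lemma polys_over_1: "1 \<in> polys_over k"
  using polys_over_pCons[of 1 0] polys_over_0 subfield_type_ringD(2)[OF k] by (simp add: one_pCons)

lemma polys_over_add: "p \<in> polys_over k \<Longrightarrow> q \<in> polys_over k \<Longrightarrow> p + q \<in> polys_over k"
  using subfield_type_ringD(4)[OF k] by (simp add: polys_over_def)

lemma polys_over_minus: "p \<in> polys_over k \<Longrightarrow> - p \<in> polys_over k"
  using subfield_type_ringD(3)[OF k] by (simp add: polys_over_def)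

lemma polys_over_diff: "p \<in> polys_over k \<Longrightarrow> q \<in> polys_over k \<Longrightarrow> p - q \<in> polys_over k"
  using subfield_type_ringD(6)[OF k] by (simp add: polys_over_def)

lemma polys_over_smult: "c \<in> k \<Longrightarrow> p \<in> polys_over k \<Longrightarrow> Polynomial.smult c p \<in> polys_over k"
  using subfield_type_ringD(5)[OF k] by (simp add: polys_over_def)

lemma polys_over_mult: "p \<in> polys_over k \<Longrightarrow> q \<in> polys_over k \<Longrightarrow> p * q \<in> polys_over k"
proof (induction p)
  case (pCons a p)
  then show ?case
    using polys_over_add[OF polys_over_smult] subfield_type_ringD(1)[OF k]
    by (simp add: polys_over_pCons)
qed (simp add: polys_over_0)

lemma poly_in_subfield: "p \<in> polys_over k \<Longrightarrow> c \<in> k \<Longrightarrow> poly p c \<in> k"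
proof (induction p)
  case (pCons a p)
  then show ?case
    using subfield_type_ringD(4,5)[OF k] by (simp add: polys_over_pCons)
qed (simp add: subfield_type_ringD(1)[OF k])

lemma polys_over_synthetic_div:
  "p \<in> polys_over k \<Longrightarrow> c \<in> k \<Longrightarrow> synthetic_div p c \<in> polys_over k"
  by (induction p) (simp_all add: polys_over_pCons polys_over_0 poly_in_subfield)

lemma polys_over_split_root:
  assumes "p \<in> polys_over k" "c \<in> k"
  obtains q where "q \<in> polys_over k" "p = [:- c, 1:] * q + [:poly p c:]"
  using synthetic_div_correct'[of c p] polys_over_synthetic_div[OF assms] by metis

lemma polys_over_root_multiplicity:
  assumes "p \<in> polys_over k" "c \<in> k" "p \<noteq> 0"
  obtains m q where "q \<in> polys_over k" "p = [:- c, 1:] ^ m * q" "poly q c \<noteq> 0"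
proof -
  have "\<exists>m q. q \<in> polys_over k \<and> p = [:- c, 1:] ^ m * q \<and> poly q c \<noteq> 0"
    using assms(1,3)
  proof (induction "Polynomial.degree p" arbitrary: p rule: less_induct)
    case less
    show ?case
    proof (cases "poly p c = 0")
      case True
      obtain q where q: "q \<in> polys_over k" "p = [:- c, 1:] * q"
        using polys_over_split_root[OF less(2) assms(2)] True by auto
      have "q \<noteq> 0" using q less by auto
      then have "Polynomial.degree p = Suc (Polynomial.degree q)"
        unfolding q(2) by (subst degree_mult_eq) auto
      then obtain m r where "r \<in> polys_over k" "q = [:- c, 1:] ^ m * r" "poly r c \<noteq> 0"
        using less(1)[of q] q \<open>q \<noteq> 0\<close> by auto
      then show ?thesis using q(2) by (intro exI[of _ "Suc m"] exI[of _ r]) (simp add: mult.assoc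
          del: mult_pCons_left)
    next
      case False
      then show ?thesis using less by (intro exI[of _ 0] exI[of _ p]) auto
    qed
  qed
  then show ?thesis using that by blast
qed

end

lemmas polys_over_simps = polys_over_pCons polys_over_0 polys_over_1 polys_over_add
  polys_over_minus polys_over_diff polys_over_smult polys_over_mult

text \<open>The ambient type may exceed the function field, which is the set \<open>F\<close> below.
  The locale is instantiated over \<open>K\<close>, over the algebraic closure of \<open>K\<close>,
  and over that closure with the images of \<open>\<sigma> x\<close> and \<open>\<sigma> y\<close>
  as generators.\<close>

locale weierstrass_field =
  fixes k :: "'a::field set" and a1 a2 a3 a4 a6 x y :: 'a
  assumes k: "subfield k type_ring"
    and coeffs: "a1 \<in> k" "a2 \<in> k" "a3 \<in> k" "a4 \<in> k" "a6 \<in> k"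
    and transc: "\<And>p. p \<in> polys_over k \<Longrightarrow> poly p x = 0 \<Longrightarrow> p = 0"
    and curve: "weierstrass a1 a2 a3 a4 a6 x y = 0"
begin

lemmas k_closed = subfield_type_ringD[OF k]
lemmas pk = polys_over_simps[OF k]

definition h :: "'a poly" where "h = [:a3, a1:]"

definition f :: "'a poly" where "f = [:a6, a4, a2, 1:]"

lemma h_over: "h \<in> polys_over k" and f_over: "f \<in> polys_over k"
  using coeffs k_closed(1,2) by (simp_all add: h_def f_def pk)

lemma y_square: "y * y = poly f x - poly h x * y"
  using curve by (simp add: weierstrass_def h_def f_def algebra_simps power2_eq_square
      power3_eq_cube)

definition el :: "'a poly \<Rightarrow> 'a poly \<Rightarrow> 'a" where "el A B = poly A x + poly B x * y"

text \<open>The norm of \<open>el A B\<close> over the rational function field in \<open>x\<close>.\<close>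

definition nrm :: "'a poly \<Rightarrow> 'a poly \<Rightarrow> 'a poly" where "nrm A B = A * A - A * B * h - B * B * f"

lemma nrm_over: "A \<in> polys_over k \<Longrightarrow> B \<in> polys_over k \<Longrightarrow> nrm A B \<in> polys_over k"
  by (simp add: nrm_def pk h_over f_over)

lemma el_mult: "el A B * el C D = el (A * C + B * D * f) (A * D + B * C - B * D * h)"
proof -
  have "el A B * el C D = poly (A * C) x + poly (A * D + B * C) x * y + poly (B * D) x * (y * y)"
    by (simp add: el_def algebra_simps)
  then show ?thesis by (simp only: y_square) (simp add: el_def algebra_simps)
qed

lemma el_add: "el A B + el C D = el (A + C) (B + D)"
  by (simp add: el_def algebra_simps)

lemma el_minus: "- el A B = el (- A) (- B)"
  by (simp add: el_def)

lemma el_poly: "el A 0 = poly A x"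
  by (simp add: el_def)

text \<open>The second factor is the image of \<open>el A B\<close> under
  \<open>y \<mapsto> - y - h(x)\<close>, the exchange of the two roots of the quadratic equation of
  \<open>y\<close>.\<close>

lemma el_conjugate: "el A B * el (A - B * h) (- B) = poly (nrm A B) x"
proof -
  have "A * (A - B * h) + B * - B * f = nrm A B" "A * - B + B * (A - B * h) - B * - B * h = 0"
    by (simp_all add: nrm_def algebra_simps)
  then show ?thesis by (simp only: el_mult el_poly)
qed

text \<open>This carries the irreducibility of the Weierstrass equation over the rational functions
  in \<open>x\<close>. For \<open>B \<noteq> 0\<close> the right side of
  \<open>A * (A - B * h) = B * B * f\<close> has degree \<open>2 * deg B + 3\<close>; the left side
  has degree at most \<open>2 * deg B + 2\<close> if \<open>deg A \<le> deg B + 1\<close>, and the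
  even degree \<open>2 * deg A\<close> otherwise.\<close>

lemma nrm_eq_0:
  assumes "nrm A B = 0"
  shows "A = 0 \<and> B = 0"
proof -
  have eq: "A * (A - B * h) = B * B * f"
    using assms by (simp add: nrm_def algebra_simps)
  have "B = 0"
  proof (rule ccontr)
    assume B: "B \<noteq> 0"
    have f: "f \<noteq> 0" "Polynomial.degree f = 3" by (simp_all add: f_def)
    have deg: "Polynomial.degree (B * B * f) = 2 * Polynomial.degree B + 3"
      using B f by (simp add: degree_mult_eq)
    have "B * B * f \<noteq> 0" using B f by simp
    then have nz: "A \<noteq> 0" "A - B * h \<noteq> 0" using eq by auto
    have deg': "Polynomial.degree A + Polynomial.degree (A - B * h) = 2 * Polynomial.degree B + 3"
      using degree_mult_eq[OF nz] deg eq by simp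
    have "Polynomial.degree h \<le> 1" by (simp add: h_def)
    then have Bh: "Polynomial.degree (B * h) \<le> Polynomial.degree B + 1"
      using degree_mult_le[of B h] by linarith
    show False
    proof (cases "Polynomial.degree A \<le> Polynomial.degree B + 1")
      case True
      then have "Polynomial.degree (A - B * h) \<le> Polynomial.degree B + 1"
        using Bh by (intro degree_diff_le)
      then show False using True deg' by linarith
    next
      case False
      then have "Polynomial.degree (A + - (B * h)) = Polynomial.degree A"
        using Bh by (intro degree_add_eq_left) simp
      then have "2 * Polynomial.degree A = 2 * Polynomial.degree B + 3"
        using deg' by simp
      then show False by presburger
    qed
  qed
  then show ?thesis using eq by simp
qed

lemma el_eq_0:
  assumes "A \<in> polys_over k" "B \<in> polys_over k" "el A B = 0"
  shows "A = 0 \<and> B = 0"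
proof -
  have "poly (nrm A B) x = 0" using el_conjugate[of A B] assms(3) by simp
  then show ?thesis using transc nrm_over nrm_eq_0 assms(1,2) by blast
qed

text \<open>Uniqueness of the coordinates makes evaluation at a point and the exchange of generators
  well defined.\<close>

lemma el_inj:
  assumes "A \<in> polys_over k" "B \<in> polys_over k" "C \<in> polys_over k" "D \<in> polys_over k"
    and "el A B = el C D"
  shows "A = C" "B = D"
proof -
  have "el (A - C) (B - D) = 0" using assms(5) by (simp add: el_def algebra_simps)
  then have "A - C = 0 \<and> B - D = 0" using assms(1-4) by (intro el_eq_0) (simp_all add: pk)
  then show "A = C" "B = D" by simp_all
qed

section \<open>Coordinate ring and function field\<close>

definition R :: "'a set" where
  "R = {el A B | A B. A \<in> polys_over k \<and> B \<in> polys_over k}"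

lemma R_el: "A \<in> polys_over k \<Longrightarrow> B \<in> polys_over k \<Longrightarrow> el A B \<in> R"
  by (auto simp: R_def)

lemma R_E:
  assumes "z \<in> R"
  obtains A B where "A \<in> polys_over k" "B \<in> polys_over k" "z = el A B"
  using assms by (auto simp: R_def)

lemma R_poly: "A \<in> polys_over k \<Longrightarrow> poly A x \<in> R"
  using R_el[of A 0] pk(2) by (simp add: el_poly)

lemma R_k: "c \<in> k \<Longrightarrow> c \<in> R"
  using R_poly[of "[:c:]"] by (simp add: pk)

lemma R_x: "x \<in> R"
  using R_poly[of "[:0, 1:]"] k_closed(1,2) by (simp add: pk)

lemma R_y: "y \<in> R"
  using R_el[of 0 1] by (simp add: el_def pk)

lemma R_add: "u \<in> R \<Longrightarrow> v \<in> R \<Longrightarrow> u + v \<in> R"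
  by (elim R_E) (simp add: el_add R_el pk)

lemma R_minus: "u \<in> R \<Longrightarrow> - u \<in> R"
  by (elim R_E) (simp add: el_minus R_el pk)

lemma R_diff: "u \<in> R \<Longrightarrow> v \<in> R \<Longrightarrow> u - v \<in> R"
  using R_add[of u "-v"] R_minus by simp

lemma R_mult: "u \<in> R \<Longrightarrow> v \<in> R \<Longrightarrow> u * v \<in> R"
  by (elim R_E) (simp add: el_mult R_el pk f_over h_over)

text \<open>Denominators in \<open>x\<close> alone suffice, because multiplication by the conjugate
  turns any denominator into its norm; they keep fractions accessible to polynomial
  arguments.\<close>

definition F :: "'a set" where
  "F = {u / poly C x | u C. u \<in> R \<and> C \<in> polys_over k \<and> C \<noteq> 0}"

lemma F_I: "u \<in> R \<Longrightarrow> C \<in> polys_over k \<Longrightarrow> C \<noteq> 0 \<Longrightarrow> u / poly C x \<in> F"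
  by (auto simp: F_def)

lemma F_E:
  assumes "z \<in> F"
  obtains u C where "u \<in> R" "C \<in> polys_over k" "C \<noteq> 0" "poly C x \<noteq> 0" "z = u / poly C x"
  using assms transc by (auto simp: F_def)

lemma R_sub_F: "u \<in> R \<Longrightarrow> u \<in> F"
  using F_I[of u 1] by (simp add: pk)

lemma F_add: "u \<in> F \<Longrightarrow> v \<in> F \<Longrightarrow> u + v \<in> F"
proof (elim F_E)
  fix a b C D
  assume *: "a \<in> R" "b \<in> R" "C \<in> polys_over k" "D \<in> polys_over k" "C \<noteq> 0" "D \<noteq> 0"
    "poly C x \<noteq> 0" "poly D x \<noteq> 0" "u = a / poly C x" "v = b / poly D x"
  have "u + v = (a * poly D x + b * poly C x) / poly (C * D) x"
    unfolding *(9,10) poly_mult using *(7,8) by (simp add: add_frac_eq)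
  then show "u + v \<in> F"
    using F_I[of "a * poly D x + b * poly C x" "C * D"] * R_add R_mult R_poly by (simp add: pk)
qed

lemma F_mult: "u \<in> F \<Longrightarrow> v \<in> F \<Longrightarrow> u * v \<in> F"
proof (elim F_E)
  fix a b C D
  assume *: "a \<in> R" "b \<in> R" "C \<in> polys_over k" "D \<in> polys_over k" "C \<noteq> 0" "D \<noteq> 0"
    "u = a / poly C x" "v = b / poly D x"
  then show "u * v \<in> F"
    using F_I[of "a * b" "C * D"] R_mult by (simp add: pk)
qed

lemma F_inverse: "u \<in> F \<Longrightarrow> inverse u \<in> F"
proof (cases "u = 0")
  case False
  assume "u \<in> F"
  then obtain v C where v: "v \<in> R" "C \<in> polys_over k" "C \<noteq> 0" "poly C x \<noteq> 0" "u = v / poly C x"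
    by (elim F_E)
  then obtain A B where A: "A \<in> polys_over k" "B \<in> polys_over k" "v = el A B" by (elim R_E)
  have "v \<noteq> 0" using False v by auto
  then have n: "nrm A B \<noteq> 0" using nrm_eq_0[of A B] A by (auto simp: el_def)
  then have nx: "poly (nrm A B) x \<noteq> 0" using transc nrm_over A by blast
  have "inverse u = poly C x * el (A - B * h) (- B) / poly (nrm A B) x"
    using nx unfolding v(5) el_conjugate[symmetric] A(3) by simp
  then show ?thesis
    using F_I[of "poly C x * el (A - B * h) (- B)" "nrm A B"] n nrm_over[OF A(1,2)] A(1,2) v(2)
    by (simp add: R_mult R_poly R_el pk h_over)
qed simp

lemma F_subfield: "subfield F type_ring"
proof -
  have "- u \<in> F" if "u \<in> F" for u
    using F_mult[of "-1" u] that R_sub_F[OF R_k, of "-1"] k_closed(2,3) by simp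
  then show ?thesis
    unfolding subfield_type_ring_iff subring_type_ring_iff
    by (intro conjI ballI F_add F_mult F_inverse R_sub_F[OF R_k[OF k_closed(2)]])
qed

lemmas F_closed = subfield_type_ringD[OF F_subfield]

lemma F_x: "x \<in> F" and F_y: "y \<in> F" and F_k: "c \<in> k \<Longrightarrow> c \<in> F"
  using R_sub_F R_x R_y R_k by blast+

lemma subfield_contains_R:
  assumes L: "subfield L type_ring" and sub: "k \<subseteq> L" "x \<in> L" "y \<in> L"
  shows "R \<subseteq> L"
proof -
  have p: "poly A x \<in> L" if "A \<in> polys_over k" for A
    using that sub subfield_type_ringD(1,4,5)[OF L]
    by (induction A) (auto simp: pk)
  then show ?thesis
    using sub subfield_type_ringD(4,5)[OF L] by (auto simp: R_def el_def)
qed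

lemma F_minimal:
  assumes L: "subfield L type_ring" and sub: "k \<subseteq> L" "x \<in> L" "y \<in> L"
  shows "F \<subseteq> L"
proof
  fix z assume "z \<in> F"
  then obtain u C where "u \<in> R" "C \<in> polys_over k" "z = u / poly C x" by (elim F_E)
  then show "z \<in> L"
    using subfield_contains_R[OF assms] R_poly[of C] subfield_type_ringD(8)[OF L, of u "poly C x"]
        by auto
qed

lemma F_eq_generate_field: "generate_field type_ring (k \<union> {x, y}) = F"
proof
  interpret K: field "type_ring :: 'a ring" by (rule field_from_type_algebra)
  show "generate_field type_ring (k \<union> {x, y}) \<subseteq> F"
    by (rule K.generate_field_min_subfield1) (use F_subfield F_x F_y F_k in auto)
  have "k \<union> {x, y} \<subseteq> generate_field type_ring (k \<union> {x, y})"
    by (auto intro: generate_field.incl)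
  then show "F \<subseteq> generate_field type_ring (k \<union> {x, y})"
    by (intro F_minimal K.generate_field_is_subfield) auto
qed

end

section \<open>The place at infinity\<close>

context field_place
begin

text \<open>At a rational place these are all the units, but rationality is still to be shown.
  Factorizations with units of this kind yield discreteness and degree one at once, see
  \<open>prime_element_kunits\<close>.\<close>

definition kunits :: "'a set" where
  "kunits = {u. \<exists>c\<in>k. c \<noteq> 0 \<and> u - c \<in> P}"

lemma kunitsE:
  assumes "u \<in> kunits"
  obtains c p where "c \<in> k" "c \<noteq> 0" "p \<in> P" "u = c + p"
proof -
  obtain c where c: "c \<in> k" "c \<noteq> 0" "u - c \<in> P" using assms by (auto simp: kunits_def)
  show ?thesis using that[OF c] by simp
qed

lemma kunits_unit: "u \<in> kunits \<Longrightarrow> u \<in> V - P"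
  using unit_add_P[OF unit_k] by (elim kunitsE) blast

lemma kunits_k: "c \<in> k \<Longrightarrow> c \<noteq> 0 \<Longrightarrow> c \<in> kunits"
  using P_zero by (auto simp: kunits_def)

lemma kunits_nonzero: "u \<in> kunits \<Longrightarrow> u \<noteq> 0"
  using kunits_unit P_zero by blast

lemma kunits_add_P: assumes "u \<in> kunits" "p \<in> P" shows "u + p \<in> kunits"
proof -
  obtain c where c: "c \<in> k" "c \<noteq> 0" "u - c \<in> P" using assms by (auto simp: kunits_def)
  have "u + p - c = (u - c) + p" by simp
  then have "u + p - c \<in> P" using P_add[OF c(3) assms(2)] by (simp only:)
  then show ?thesis using c by (auto simp: kunits_def)
qed

lemma kunits_mult: assumes "u \<in> kunits" "v \<in> kunits" shows "u * v \<in> kunits"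
proof -
  obtain c where c: "c \<in> k" "c \<noteq> 0" "u - c \<in> P" using assms by (auto simp: kunits_def)
  obtain d where d: "d \<in> k" "d \<noteq> 0" "v - d \<in> P" using assms by (auto simp: kunits_def)
  have "u \<in> V" using kunits_unit[OF assms(1)] by blast
  have "u * v - c * d = u * (v - d) + d * (u - c)" by (simp add: algebra_simps)
  then have "u * v - c * d \<in> P"
    using P_add[OF P_mult[OF \<open>u \<in> V\<close> d(3)] P_mult[OF k_sub[OF d(1)] c(3)]] by (simp only:)
  then show ?thesis
    using c(1,2) d(1,2) k_closed(5) unfolding kunits_def by (intro CollectI bexI[of _ "c * d"]) auto
qed

lemma kunits_inverse: assumes "u \<in> kunits" shows "inverse u \<in> kunits"
proof -
  obtain c where c: "c \<in> k" "c \<noteq> 0" "u - c \<in> P" using assms by (auto simp: kunits_def)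
  have u: "u \<noteq> 0" "inverse u \<in> V" using kunits_nonzero[OF assms] unit_inverse[OF kunits_unit[OF
      assms]] by auto
  have ic: "inverse c \<in> k" using k_closed(7) c by blast
  have "inverse u - inverse c = - (inverse u * (inverse c * (u - c)))"
    using u(1) c(2) by (simp add: field_simps)
  then have "inverse u - inverse c \<in> P"
    using P_minus[OF P_mult[OF u(2) P_mult[OF k_sub[OF ic] c(3)]]] by (simp only:)
  then show ?thesis using ic c(2) unfolding kunits_def by (intro CollectI bexI[of _
      "inverse c"]) auto
qed

lemma kunits_divide: "u \<in> kunits \<Longrightarrow> v \<in> kunits \<Longrightarrow> u / v \<in> kunits"
  using kunits_mult[OF _ kunits_inverse] by (simp add: divide_inverse)

lemma kunits_power: "u \<in> kunits \<Longrightarrow> u ^ n \<in> kunits"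
  by (induction n) (auto intro: kunits_mult kunits_k[of 1] k_closed)

text \<open>After \<open>t powi n\<close> is factored out, the second term keeps a positive power of
  \<open>t\<close> and lies in \<open>P\<close>: the strict triangle inequality for different
  orders.\<close>

lemma kunits_sum:
  assumes u: "u \<in> kunits" and v: "v \<in> kunits" and t: "t \<in> P" "t \<noteq> 0" and nm: "(n::int) < m"
  shows "\<exists>w\<in>kunits. t powi n * u + t powi m * v = t powi n * w"
proof
  have "t powi m = t powi n * t ^ nat (m - n)"
    using nm t(2) power_int_add[of t n "m - n"] by (simp add: power_int_def[of t "m - n"])
  then show "t powi n * u + t powi m * v = t powi n * (u + t ^ nat (m - n) * v)"
    by (simp add: algebra_simps)
  show "u + t ^ nat (m - n) * v \<in> kunits"
    using nm kunits_unit[OF v] by (intro kunits_add_P[OF u] P_mult' P_power t) auto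
qed

text \<open>A nonzero element of \<open>V\<close> has order 0, where its unit factor supplies the
  constant residue, or positive order, where the residue is 0.\<close>

lemma prime_element_kunits:
  assumes t: "t \<in> P"
    and ex: "\<And>z. z \<in> F \<Longrightarrow> z \<noteq> 0 \<Longrightarrow> \<exists>n::int. \<exists>u\<in>kunits. z = t powi n * u"
  shows "prime_element F P t" "has_degree k F P 1"
proof -
  show p: "prime_element F P t"
    using ex kunits_unit by (intro prime_elementI t) blast
  have "\<exists>c\<in>k. v - c \<in> P" if v: "v \<in> V" for v
  proof (cases "v = 0")
    case True
    then show ?thesis using k_closed(1) P_zero by (intro bexI[of _ 0]) auto
  next
    case False
    then obtain n u where u: "u \<in> kunits" "v = t powi n * u" using ex[OF V_sub[OF v]] by blast
    then have o: "has_order F P v n" using has_order_iff[OF p] kunits_unit by blast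
    then have "n \<ge> 0" using has_order_nonneg_iff v by blast
    show ?thesis
    proof (cases "n = 0")
      case True
      then show ?thesis using u by (auto simp: kunits_def)
    next
      case False
      then have "v \<in> P" using has_order_pos[OF o] \<open>n \<ge> 0\<close> by simp
      then show ?thesis using k_closed(1) by (intro bexI[of _ 0]) auto
    qed
  qed
  then show "has_degree k F P 1" using has_degree_one_iff by blast
qed

end

section \<open>Orders at a common pole of \<open>x\<close> and \<open>y\<close>\<close>

context weierstrass_field
begin

text \<open>As \<open>x\<close> and \<open>y\<close> have poles of order 2 and 3, the two terms of \<open>el A B\<close> have orders of different
  parity, so the smaller one is the order of the sum.\<close>

definition inf_order :: "'a poly \<Rightarrow> 'a poly \<Rightarrow> int" where
  "inf_order A B =
    (if B = 0 then - 2 * int (Polynomial.degree A)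
     else if A = 0 then - 2 * int (Polynomial.degree B) - 3
     else min (- 2 * int (Polynomial.degree A)) (- 2 * int (Polynomial.degree B) - 3))"

text \<open>Dividing the equation by \<open>y^2\<close> writes 1 as
  \<open>f(x) / y^2 - h(x) / y\<close>, which lies in \<open>P\<close> if \<open>y\<close> has a
  pole and \<open>x\<close> does not.\<close>

lemma place_y_integral:
  assumes "field_place k F P V" "x \<in> V"
  shows "y \<in> V"
proof (rule ccontr)
  interpret p: field_place k F P V by (rule assms)
  assume y: "y \<notin> V"
  then have i: "inverse y \<in> P" "y \<noteq> 0" using p.inverse_in_P[OF F_y] p.V_closed(1) by auto
  have pV: "poly q x \<in> V" if "q \<in> polys_over k" for q
    using that
  proof (induction q)
    case (pCons a q)
    then show ?case using p.V_closed(4,5) p.k_sub assms(2) by (simp add: pk)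
  qed (simp add: p.V_closed(1))
  have "1 = (y * y) * (inverse y * inverse y)" using i(2) by (simp add: field_simps)
  also have "\<dots> = poly f x * inverse y * inverse y - poly h x * inverse y"
    unfolding y_square using i(2) by (simp add: algebra_simps)
  also have "\<dots> \<in> P"
    using pV[OF f_over] pV[OF h_over] i p.P_sub[OF i(1)]
    by (intro p.P_diff p.P_mult p.V_closed(5)) auto
  finally show False using p.P_one by simp
qed

text \<open>Divided by \<open>x^3\<close>, the equation equates 0 with 1 plus an element of
  \<open>P\<close> if \<open>x\<close> has a pole and \<open>y\<close> does not. Together with
  \<open>place_y_integral\<close>, \<open>x\<close> and \<open>y\<close> have the same
  poles.\<close>

lemma place_x_integral:
  assumes "field_place k F P V" "y \<in> V"
  shows "x \<in> V"
proof (rule ccontr)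
  interpret p: field_place k F P V by (rule assms)
  assume x: "x \<notin> V"
  then have i: "inverse x \<in> P" "x \<noteq> 0" using p.inverse_in_P[OF F_x] p.V_closed(1) by auto
  note iV = p.P_sub[OF i(1)]
  have "poly f x * inverse x ^ 3 - (y * y + poly h x * y) * inverse x ^ 3 = 0"
    by (simp add: y_square)
  moreover have "poly f x * inverse x ^ 3 - (y * y + poly h x * y) * inverse x ^ 3 =
      1 + (a2 + a4 * inverse x + a6 * inverse x ^ 2 - y * y * inverse x ^ 2
        - (a1 + a3 * inverse x) * y * inverse x) * inverse x"
    using i(2) by (simp add: f_def h_def power2_eq_square power3_eq_cube field_simps)
  ultimately have "1 + (a2 + a4 * inverse x + a6 * inverse x ^ 2 - y * y * inverse x ^ 2
        - (a1 + a3 * inverse x) * y * inverse x) * inverse x = 0" by simp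
  moreover have "(a2 + a4 * inverse x + a6 * inverse x ^ 2 - y * y * inverse x ^ 2
        - (a1 + a3 * inverse x) * y * inverse x) * inverse x \<in> P"
    using iV assms(2) coeffs p.k_sub
    by (intro p.P_mult i(1) p.V_closed(4,5,6,7)) auto
  ultimately have "- 1 \<in> P" by (metis add_eq_0_iff)
  then show False using p.P_minus p.P_one by fastforce
qed

context
  fixes P V :: "'a set"
  assumes place: "field_place k F P V" and x: "x \<notin> V" and y: "y \<notin> V"
begin

interpretation p: field_place k F P V by (rule place)

lemma inverse_xy_P: "inverse x \<in> P" "inverse y \<in> P" and xy_nonzero: "x \<noteq> 0" "y \<noteq> 0"
  using p.inverse_in_P F_x F_y x y p.V_closed(1) by auto

text \<open>If \<open>y / x\<close> were regular, the equation divided by \<open>x^2\<close> would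
  express \<open>x\<close> through regular functions. The quotient \<open>x / y\<close> will be the
  uniformizer at infinity.\<close>

lemma inf_t_P: "x / y \<in> P"
proof (rule ccontr)
  assume n: "x / y \<notin> P"
  have "y / x \<in> V"
  proof (rule ccontr)
    assume "y / x \<notin> V"
    then show False using n p.inverse_in_P[of "y / x"] F_closed(8)[OF F_y F_x] by simp
  qed
  note yx = this p.P_sub[OF inverse_xy_P(1)]
  have "x = (y / x) * (y / x) + a1 * (y / x) + a3 * (y / x) * inverse x
      - a2 - a4 * inverse x - a6 * inverse x * inverse x"
  proof -
    have "((y / x) * (y / x) + a1 * (y / x) + a3 * (y / x) * inverse x
      - a2 - a4 * inverse x - a6 * inverse x * inverse x) * (x * x) =
      y * y + (poly h x * y) - (poly f x - x * x * x)"
      using xy_nonzero by (simp add: h_def f_def field_simps)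
    also have "\<dots> = x * (x * x)" by (simp add: y_square)
    finally show ?thesis using xy_nonzero(1) by (metis mult_right_cancel mult_eq_0_iff)
  qed
  also have "\<dots> \<in> V"
    using yx coeffs p.k_sub by (intro p.V_closed(4,5,6)) auto
  finally show False using x by simp
qed

text \<open>\<open>n\<close> and \<open>d\<close> collect the lower terms of the equation, so that
  \<open>y^2 * n = x^3 * d\<close> with both congruent to 1; solving for \<open>x\<close> gives
  \<open>x = (y / x)^2 * (n / d)\<close>.\<close>

lemma inf_x_form: "\<exists>u\<in>p.kunits. x = (x / y) powi (- 2) * u"
proof -
  define i where "i = inverse x"
  define t where "t = x / y"
  define n where "n = 1 + (a1 * t + a3 * inverse y)"
  define d where "d = 1 + (a2 * i + a4 * i * i + a6 * i * i * i)"
  have iP: "i \<in> P" "t \<in> P" "i \<in> V"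
    using inverse_xy_P(1) inf_t_P p.P_sub by (simp_all add: i_def t_def)
  have "n \<in> p.kunits" unfolding n_def
    using coeffs iP inverse_xy_P p.k_sub
    by (intro p.kunits_add_P p.kunits_k p.P_add p.P_mult k_closed) auto
  moreover have d: "d \<in> p.kunits" unfolding d_def
    using coeffs iP p.k_sub
    by (intro p.kunits_add_P p.kunits_k p.P_add p.P_mult k_closed p.V_closed(5)) auto
  ultimately have u: "n / d \<in> p.kunits" by (rule p.kunits_divide)
  have "y * y * n = y * y + poly h x * y"
    using xy_nonzero by (simp add: n_def t_def h_def field_simps)
  also have "\<dots> = poly f x" by (simp add: y_square)
  also have "\<dots> = x * x * x * d"
    using xy_nonzero by (simp add: d_def i_def f_def field_simps)
  finally have "x = (x / y) powi (- 2) * (n / d)"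
    using xy_nonzero p.kunits_nonzero[OF d] by (simp add: power_int_minus power2_eq_square
        field_simps)
  then show ?thesis using u by blast
qed

text \<open>The leading term dominates at a pole of \<open>x\<close>: once the highest power of
  \<open>x\<close> is pulled out, every lower coefficient carries a positive power of
  \<open>inverse x\<close>.\<close>

lemma inf_poly_form:
  assumes "C \<in> polys_over k" "C \<noteq> 0"
  shows "\<exists>u\<in>p.kunits. poly C x = (x / y) powi (- 2 * int (Polynomial.degree C)) * u"
proof -
  obtain v where v: "v \<in> p.kunits" "x = (x / y) powi (- 2) * v" using inf_x_form by blast
  have "\<exists>u\<in>p.kunits. poly C x = x ^ Polynomial.degree C * u"
    using assms
  proof (induction C)
    case (pCons a C)
    show ?case
    proof (cases "C = 0")
      case True
      then show ?thesis using pCons p.kunits_k by (auto simp: pk)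
    next
      case False
      then obtain u where u: "u \<in> p.kunits" "poly C x = x ^ Polynomial.degree C * u"
        using pCons by (auto simp: pk)
      have "poly (pCons a C) x = x ^ Polynomial.degree (pCons a C) *
          (u + a * inverse x ^ Suc (Polynomial.degree C))"
        using False u(2) xy_nonzero by (simp add: field_simps)
      moreover have "a * inverse x ^ Suc (Polynomial.degree C) \<in> P"
        using pCons(3) p.k_sub by (intro p.P_mult p.P_power inverse_xy_P) (auto simp: pk)
      ultimately show ?thesis using p.kunits_add_P[OF u(1)] by blast
    qed
  qed simp
  then obtain u where u: "u \<in> p.kunits" "poly C x = x ^ Polynomial.degree C * u" by blast
  have "x ^ Polynomial.degree C = ((x / y) powi (- 2) * v) ^ Polynomial.degree C"
    using v(2) by simp
  also have "\<dots> = (x / y) powi (- 2 * int (Polynomial.degree C)) * v ^ Polynomial.degree C"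
    unfolding power_mult_distrib power_int_mult power_int_of_nat by (rule refl)
  finally show ?thesis
    using u p.kunits_mult[OF p.kunits_power[OF v(1)] u(1)] by (metis mult.assoc)
qed

lemma inf_el_form:
  assumes A: "A \<in> polys_over k" and B: "B \<in> polys_over k" and nz: "A \<noteq> 0 \<or> B \<noteq> 0"
  shows "\<exists>u\<in>p.kunits. el A B = (x / y) powi inf_order A B * u"
proof -
  define t where "t = x / y"
  have t: "t \<in> P" "t \<noteq> 0" using inf_t_P xy_nonzero by (simp_all add: t_def)
  have By: "\<exists>u\<in>p.kunits. poly B x * y = t powi (- 2 * int (Polynomial.degree B) - 3) * u" if B0:
      "B \<noteq> 0"
  proof -
    obtain u where u: "u \<in> p.kunits" "poly B x = t powi (- 2 * int (Polynomial.degree B)) * u"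
      using inf_poly_form[OF B B0] by (auto simp: t_def)
    obtain v where v: "v \<in> p.kunits" "x = t powi (- 2) * v"
      using inf_x_form by (auto simp: t_def)
    \<comment> \<open>Dividing by \<open>t\<close> raises the pole order 2 of \<open>x\<close> to 3,
      the source of the \<open>- 3\<close> in \<open>inf_order\<close>.\<close>
    have "y = x * t powi (- 1)" using xy_nonzero by (simp add: t_def)
    also have "\<dots> = t powi (- 2) * v * t powi (- 1)" using v(2) by (simp only:)
    also have "\<dots> = t powi (- 3) * v"
      using power_int_add[of t "-2" "-1"] t by (simp add: mult_ac)
    finally have "y = t powi (- 3) * v" .
    then have "poly B x * y = t powi (- 2 * int (Polynomial.degree B) - 3) * (u * v)"
      using u(2) power_int_add[of t "- 2 * int (Polynomial.degree B)" "- 3"] t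
          by (simp add: mult_ac)
    then show ?thesis using p.kunits_mult[OF u(1) v(1)] by blast
  qed
  have Ax: "\<exists>u\<in>p.kunits. poly A x = t powi (- 2 * int (Polynomial.degree A)) * u" if "A \<noteq> 0"
    using inf_poly_form[OF A that] by (simp add: t_def)
  show ?thesis unfolding t_def[symmetric]
  proof (cases "A = 0 \<or> B = 0")
    case True
    then show "\<exists>u\<in>p.kunits. el A B = t powi inf_order A B * u"
      using Ax By nz by (auto simp: inf_order_def el_def)
  next
    case False
    then obtain u v where u: "u \<in> p.kunits" "poly A x =
        t powi (- 2 * int (Polynomial.degree A)) * u"
      and v: "v \<in> p.kunits" "poly B x * y = t powi (- 2 * int (Polynomial.degree B) - 3) * v"
      using Ax By by blast
    have ne: "- 2 * int (Polynomial.degree A) \<noteq> - 2 * int (Polynomial.degree B) - 3" by presburger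
    show "\<exists>u\<in>p.kunits. el A B = t powi inf_order A B * u"
    proof (cases "- 2 * int (Polynomial.degree A) < - 2 * int (Polynomial.degree B) - 3")
      case True
      then show ?thesis
        using p.kunits_sum[OF u(1) v(1) t True] False u v
            by (simp add: el_def inf_order_def min_def)
    next
      case f: False
      then have lt: "- 2 * int (Polynomial.degree B) - 3 < - 2 * int (Polynomial.degree A)"
          using ne by linarith
      then show ?thesis
        using p.kunits_sum[OF v(1) u(1) t lt] False u v
        by (simp add: el_def inf_order_def min_def add.commute)
    qed
  qed
qed

lemma inf_form:
  assumes A: "A \<in> polys_over k" and B: "B \<in> polys_over k" and nz: "A \<noteq> 0 \<or> B \<noteq> 0"
    and C: "C \<in> polys_over k" "C \<noteq> 0"
  shows "\<exists>u\<in>p.kunits. el A B / poly C x = (x / y) powi (inf_order A B + 2 * int (Polynomial.degree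
      C)) * u"
proof -
  obtain u where u: "u \<in> p.kunits" "el A B = (x / y) powi inf_order A B * u"
    using inf_el_form[OF A B nz] by blast
  obtain v where v: "v \<in> p.kunits" "poly C x = (x / y) powi (- 2 * int (Polynomial.degree C)) * v"
    using inf_poly_form[OF C] by blast
  have "el A B / poly C x =
      (x / y) powi (inf_order A B - (- 2 * int (Polynomial.degree C))) * (u / v)"
    unfolding u(2) v(2) using xy_nonzero by (subst power_int_diff) auto
  then have "el A B / poly C x = (x / y) powi (inf_order A B + 2 * int (Polynomial.degree C)) * (u
      / v)"
    by (simp only: diff_minus_eq_add mult_minus_left)
  then show ?thesis using p.kunits_divide[OF u(1) v(1)] by blast
qed

lemma inf_prime: "prime_element F P (x / y)" and inf_degree: "has_degree k F P 1"
proof -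
  have "\<exists>n::int. \<exists>u\<in>p.kunits. z = (x / y) powi n * u" if z: "z \<in> F" "z \<noteq> 0" for z
  proof -
    obtain w C where w: "w \<in> R" "C \<in> polys_over k" "C \<noteq> 0" "z = w / poly C x"
      using z(1) by (elim F_E)
    moreover obtain A B where A: "A \<in> polys_over k" "B \<in> polys_over k" "w = el A B"
      using w(1) by (elim R_E)
    moreover have "A \<noteq> 0 \<or> B \<noteq> 0" using z w A by (auto simp: el_def)
    ultimately show ?thesis using inf_form[of A B C] by blast
  qed
  then show "prime_element F P (x / y)" "has_degree k F P 1"
    using p.prime_element_kunits[OF inf_t_P] by blast+
qed

lemma inf_has_order:
  assumes "A \<in> polys_over k" "B \<in> polys_over k" "A \<noteq> 0 \<or> B \<noteq> 0" "C \<in> polys_over k" "C \<noteq> 0"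
  shows "has_order F P (el A B / poly C x) (inf_order A B + 2 * int (Polynomial.degree C))"
  using inf_form[OF assms] p.has_order_iff[OF inf_prime] p.kunits_unit by blast

end

text \<open>At every common pole of \<open>x\<close> and \<open>y\<close> the order of a function is
  computed from its coordinates by the same formula, so the same functions are regular
  there.\<close>

lemma infinite_place_unique:
  assumes "field_place k F P V" "x \<notin> V" "y \<notin> V" and "field_place k F P' V'" "x \<notin> V'" "y \<notin> V'"
  shows "P = P'"
proof -
  interpret p: field_place k F P V by (rule assms)
  interpret p': field_place k F P' V' by (rule assms)
  have "z \<in> V \<longleftrightarrow> z \<in> V'" if z: "z \<in> F" "z \<noteq> 0" for z
  proof -
    obtain w C where w: "w \<in> R" "C \<in> polys_over k" "C \<noteq> 0" "z = w / poly C x"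
      using z(1) by (elim F_E)
    obtain A B where A: "A \<in> polys_over k" "B \<in> polys_over k" "w = el A B"
      using w(1) by (elim R_E)
    have nz: "A \<noteq> 0 \<or> B \<noteq> 0" using z w A by (auto simp: el_def)
    show ?thesis
      using p.has_order_nonneg_iff[OF inf_has_order[OF assms(1-3) A(1,2) nz w(2,3)]]
        p'.has_order_nonneg_iff[OF inf_has_order[OF assms(4-6) A(1,2) nz w(2,3)]] A w by simp
  qed
  then have "V = V'" using p.V_sub p'.V_sub p.V_closed(1) p'.V_closed(1) by blast
  then show ?thesis using p.P_eq p'.P_eq by simp
qed

end

section \<open>Finite points over an algebraically closed field\<close>

text \<open>Arranged for \<open>u = x\<close> and \<open>v = y\<close>: the cofactors of
  \<open>y - b\<close> and \<open>x - a\<close> take the values of the two partial derivatives at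
  \<open>(a, b)\<close>, up to sign, so at a nonsingular point one of them is a unit.\<close>

lemma weierstrass_taylor:
  fixes u v a b :: "'a::field"
  shows "weierstrass a1 a2 a3 a4 a6 u v - weierstrass a1 a2 a3 a4 a6 a b =
    (v - b) * (weierstrass_dY a1 a2 a3 a4 a6 a b + (v - b) + a1 * (u - a)) -
    (u - a) * (- weierstrass_dX a1 a2 a3 a4 a6 a b + (u - a) * (3 * a + (u - a) + a2))"
  by (simp add: weierstrass_def weierstrass_dX_def weierstrass_dY_def algebra_simps
      power2_eq_square power3_eq_cube)

locale weierstrass_closed = weierstrass_field +
  assumes root: "\<And>p. p \<in> polys_over k \<Longrightarrow> Polynomial.degree p > 0 \<Longrightarrow> \<exists>c\<in>k. poly p c = 0"
    and nonsing: "\<And>u v. u \<in> k \<Longrightarrow> v \<in> k \<Longrightarrow> weierstrass a1 a2 a3 a4 a6 u v = 0 \<Longrightarrow>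
      weierstrass_dX a1 a2 a3 a4 a6 u v \<noteq> 0 \<or> weierstrass_dY a1 a2 a3 a4 a6 u v \<noteq> 0"
begin

definition on_curve :: "'a \<Rightarrow> 'a \<Rightarrow> bool" where
  "on_curve a b \<longleftrightarrow> a \<in> k \<and> b \<in> k \<and> weierstrass a1 a2 a3 a4 a6 a b = 0"

text \<open>The value at \<open>(a, b)\<close> of an element of the coordinate ring \<open>R\<close>; meaningless outside \<open>R\<close>.\<close>

definition ev :: "'a \<Rightarrow> 'a \<Rightarrow> 'a \<Rightarrow> 'a" where
  "ev a b z = (THE c. \<exists>A B. A \<in> polys_over k \<and> B \<in> polys_over k \<and> z = el A B \<and> c =
      poly A a + poly B a * b)"

text \<open>With the next two definitions: the local ring of the curve at \<open>(a, b)\<close>, its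
  maximal ideal and its units. Membership asks for some representation as a fraction; as fractions
  have no canonical form, disjointness of the last two is a lemma,
  \<open>pt_disjoint\<close>.\<close>

definition pt_ring :: "'a \<Rightarrow> 'a \<Rightarrow> 'a set" where
  "pt_ring a b = {u / v | u v. u \<in> R \<and> v \<in> R \<and> ev a b v \<noteq> 0}"

definition pt_place :: "'a \<Rightarrow> 'a \<Rightarrow> 'a set" where
  "pt_place a b = {u / v | u v. u \<in> R \<and> v \<in> R \<and> ev a b u = 0 \<and> ev a b v \<noteq> 0}"

definition pt_units :: "'a \<Rightarrow> 'a \<Rightarrow> 'a set" where
  "pt_units a b = {u / v | u v. u \<in> R \<and> v \<in> R \<and> ev a b u \<noteq> 0 \<and> ev a b v \<noteq> 0}"

section \<open>The local ring at an affine point is a discrete valuation ring\<close>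

context
  fixes a b :: 'a
  assumes ab: "on_curve a b"
begin

lemma ak: "a \<in> k" and bk: "b \<in> k" and ab_curve: "weierstrass a1 a2 a3 a4 a6 a b = 0"
  using ab by (auto simp: on_curve_def)

lemma b_square: "b * b = poly f a - poly h a * b"
  using ab_curve by (simp add: weierstrass_def h_def f_def algebra_simps power2_eq_square
      power3_eq_cube)

lemma ev_el:
  assumes "A \<in> polys_over k" "B \<in> polys_over k"
  shows "ev a b (el A B) = poly A a + poly B a * b"
  unfolding ev_def using assms el_inj by (intro the_equality) blast+

lemma ev_k: "c \<in> k \<Longrightarrow> ev a b c = c"
  using ev_el[of "[:c:]" 0] by (simp add: el_def pk)

lemma ev_poly: "A \<in> polys_over k \<Longrightarrow> ev a b (poly A x) = poly A a"
  using ev_el[of A 0] by (simp add: el_def pk)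

lemma ev_x: "ev a b x = a"
  using ev_poly[of "[:0, 1:]"] k_closed(1,2) by (simp add: pk)

lemma ev_y: "ev a b y = b"
  using ev_el[of 0 1] by (simp add: el_def pk)

lemma ev_add: "u \<in> R \<Longrightarrow> v \<in> R \<Longrightarrow> ev a b (u + v) = ev a b u + ev a b v"
  by (elim R_E) (simp add: el_add ev_el pk algebra_simps)

lemma ev_minus: "u \<in> R \<Longrightarrow> ev a b (- u) = - ev a b u"
  by (elim R_E) (simp add: el_minus ev_el pk algebra_simps)

lemma ev_diff: "u \<in> R \<Longrightarrow> v \<in> R \<Longrightarrow> ev a b (u - v) = ev a b u - ev a b v"
  using ev_add[of u "-v"] ev_minus R_minus by simp

text \<open>Products are respected because \<open>b\<close> satisfies over \<open>a\<close> the
  quadratic equation that \<open>y\<close> satisfies over \<open>x\<close>.\<close>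

lemma ev_mult: assumes "u \<in> R" "v \<in> R" shows "ev a b (u * v) = ev a b u * ev a b v"
proof -
  obtain A B where A: "A \<in> polys_over k" "B \<in> polys_over k" "u = el A B" using assms(1)
      by (elim R_E)
  obtain C D where C: "C \<in> polys_over k" "D \<in> polys_over k" "v = el C D" using assms(2)
      by (elim R_E)
  have "ev a b (u * v) = poly A a * poly C a + (poly A a * poly D a + poly B a * poly C a) * b
      + poly B a * poly D a * (poly f a - poly h a * b)"
    using A C by (simp add: el_mult ev_el pk f_over h_over algebra_simps)
  also have "\<dots> = poly A a * poly C a + (poly A a * poly D a + poly B a * poly C a) * b
      + poly B a * poly D a * (b * b)" by (simp only: b_square)
  finally show ?thesis using A C by (simp add: ev_el algebra_simps)
qed

lemma pt_ringI: "u \<in> R \<Longrightarrow> v \<in> R \<Longrightarrow> ev a b v \<noteq> 0 \<Longrightarrow> u / v \<in> pt_ring a b"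
  and pt_placeI: "u \<in> R \<Longrightarrow> v \<in> R \<Longrightarrow> ev a b u = 0 \<Longrightarrow> ev a b v \<noteq> 0 \<Longrightarrow> u / v \<in> pt_place a b"
  and pt_unitsI: "u \<in> R \<Longrightarrow> v \<in> R \<Longrightarrow> ev a b u \<noteq> 0 \<Longrightarrow> ev a b v \<noteq> 0 \<Longrightarrow> u / v \<in> pt_units a b"
  by (auto simp: pt_ring_def pt_place_def pt_units_def)

lemma ev_0: "ev a b 0 = 0" and ev_1: "ev a b 1 = 1"
  using ev_k k_closed by auto

lemma pt_ringE:
  assumes "z \<in> pt_ring a b"
  obtains u v where "u \<in> R" "v \<in> R" "ev a b v \<noteq> 0" "v \<noteq> 0" "z = u / v"
  using assms ev_0 by (auto simp: pt_ring_def)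

lemma pt_placeE:
  assumes "z \<in> pt_place a b"
  obtains u v where "u \<in> R" "v \<in> R" "ev a b u = 0" "ev a b v \<noteq> 0" "v \<noteq> 0" "z = u / v"
  using assms ev_0 by (auto simp: pt_place_def)

lemma pt_unitsE:
  assumes "z \<in> pt_units a b"
  obtains u v where "u \<in> R" "v \<in> R" "ev a b u \<noteq> 0" "ev a b v \<noteq> 0" "u \<noteq> 0" "v \<noteq> 0" "z = u / v"
  using assms ev_0 by (auto simp: pt_units_def)

lemma R_pt_ring: "u \<in> R \<Longrightarrow> u \<in> pt_ring a b"
  using pt_ringI[of u 1] R_k k_closed(2) ev_1 by simp

lemma R_pt_place: "u \<in> R \<Longrightarrow> ev a b u = 0 \<Longrightarrow> u \<in> pt_place a b"
  using pt_placeI[of u 1] R_k k_closed(2) ev_1 by simp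

lemma R_pt_units: "u \<in> R \<Longrightarrow> ev a b u \<noteq> 0 \<Longrightarrow> u \<in> pt_units a b"
  using pt_unitsI[of u 1] R_k k_closed(2) ev_1 by simp

lemma pt_ring_cases: "z \<in> pt_ring a b \<longleftrightarrow> z \<in> pt_place a b \<or> z \<in> pt_units a b"
  by (auto simp: pt_ring_def pt_place_def pt_units_def)

lemma pt_ring_add: assumes "z \<in> pt_ring a b" "w \<in> pt_ring a b" shows "z + w \<in> pt_ring a b"
proof -
  obtain u v where u: "u \<in> R" "v \<in> R" "ev a b v \<noteq> 0" "v \<noteq> 0" "z = u / v" using assms(1)
      by (elim pt_ringE)
  obtain u' v' where u': "u' \<in> R" "v' \<in> R" "ev a b v' \<noteq> 0" "v' \<noteq> 0" "w = u' / v'" using assms(2)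
      by (elim pt_ringE)
  have "z + w = (u * v' + u' * v) / (v * v')" using u u' by (simp add: add_frac_eq)
  then show ?thesis using u u' by (simp add: pt_ringI R_add R_mult ev_mult)
qed

lemma pt_ring_mult: assumes "z \<in> pt_ring a b" "w \<in> pt_ring a b" shows "z * w \<in> pt_ring a b"
proof -
  obtain u v where u: "u \<in> R" "v \<in> R" "ev a b v \<noteq> 0" "v \<noteq> 0" "z = u / v" using assms(1)
      by (elim pt_ringE)
  obtain u' v' where u': "u' \<in> R" "v' \<in> R" "ev a b v' \<noteq> 0" "v' \<noteq> 0" "w = u' / v'" using assms(2)
      by (elim pt_ringE)
  show ?thesis using u u' by (simp add: pt_ringI R_add R_mult ev_mult)
qed

lemma pt_place_mult: assumes "z \<in> pt_place a b" "w \<in> pt_ring a b" shows "z * w \<in> pt_place a b"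
proof -
  obtain u v where u: "u \<in> R" "v \<in> R" "ev a b u = 0" "ev a b v \<noteq> 0" "v \<noteq> 0" "z = u / v"
      using assms(1) by (elim pt_placeE)
  obtain u' v' where u': "u' \<in> R" "v' \<in> R" "ev a b v' \<noteq> 0" "v' \<noteq> 0" "w = u' / v'" using assms(2)
      by (elim pt_ringE)
  show ?thesis using u u' by (simp add: pt_placeI R_add R_mult ev_mult)
qed

lemma pt_units_mult: assumes "z \<in> pt_units a b" "w \<in> pt_units a b" shows "z * w \<in> pt_units a b"
proof -
  obtain u v where u: "u \<in> R" "v \<in> R" "ev a b u \<noteq> 0" "ev a b v \<noteq> 0" "z = u / v" using assms(1)
      by (elim pt_unitsE)
  obtain u' v' where u': "u' \<in> R" "v' \<in> R" "ev a b u' \<noteq> 0" "ev a b v' \<noteq> 0" "w = u' / v'"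
      using assms(2) by (elim pt_unitsE)
  show ?thesis using u u' by (simp add: pt_unitsI R_add R_mult ev_mult)
qed

lemma pt_units_inverse: assumes "z \<in> pt_units a b" shows "inverse z \<in> pt_units a b"
  using assms by (elim pt_unitsE) (simp add: pt_unitsI)

lemma pt_units_power: "z \<in> pt_units a b \<Longrightarrow> z ^ n \<in> pt_units a b"
  using R_pt_units[OF R_k[OF k_closed(2)]] ev_1 by (induction n) (auto intro: pt_units_mult)

lemma pt_ring_power: "z \<in> pt_ring a b \<Longrightarrow> z ^ n \<in> pt_ring a b"
  using R_pt_ring[OF R_k[OF k_closed(2)]] by (induction n) (auto intro: pt_ring_mult)

text \<open>Two equal fractions are cross-multiplied and evaluated: one side vanishes at the point,
  the other does not.\<close>

lemma pt_disjoint: "z \<in> pt_place a b \<Longrightarrow> z \<notin> pt_units a b"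
proof
  assume "z \<in> pt_place a b" "z \<in> pt_units a b"
  then obtain u v u' v' where u: "u \<in> R" "v \<in> R" "ev a b u = 0" "ev a b v \<noteq> 0" "v \<noteq> 0" "z = u / v"
    and u': "u' \<in> R" "v' \<in> R" "ev a b u' \<noteq> 0" "ev a b v' \<noteq> 0" "u' \<noteq> 0" "v' \<noteq> 0" "z = u' / v'"
    by (elim pt_placeE pt_unitsE)
  then have "u * v' = u' * v" by (simp add: frac_eq_eq)
  then have "ev a b u * ev a b v' = ev a b u' * ev a b v" using u u' ev_mult by metis
  then show False using u u' by simp
qed

text \<open>The functions of \<open>R\<close> vanishing at the point form the ideal of
  \<open>x - a\<close> and \<open>y - b\<close>. Splitting the root \<open>a\<close> off both
  coordinates leaves \<open>A(a) + B(a) * y\<close>, which is \<open>B(a) * (y - b)\<close> because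
  \<open>A(a) = - B(a) * b\<close>; thus \<open>c\<close> can be a constant.\<close>

lemma ev_eq_0_decompose:
  assumes "u \<in> R" "ev a b u = 0"
  obtains u1 c where "u1 \<in> R" "c \<in> k" "u = (x - a) * u1 + c * (y - b)"
proof -
  obtain A B where A: "A \<in> polys_over k" "B \<in> polys_over k" "u = el A B" using assms(1)
      by (elim R_E)
  obtain A1 where A1: "A1 \<in> polys_over k" "A = [:- a, 1:] * A1 + [:poly A a:]"
    using polys_over_split_root[OF k A(1) ak] by blast
  obtain B1 where B1: "B1 \<in> polys_over k" "B = [:- a, 1:] * B1 + [:poly B a:]"
    using polys_over_split_root[OF k A(2) ak] by blast
  have Ax: "poly A x = (x - a) * poly A1 x + poly A a"
    by (subst A1(2)) (simp add: algebra_simps)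
  have Bx: "poly B x = (x - a) * poly B1 x + poly B a"
    by (subst B1(2)) (simp add: algebra_simps)
  have Aa: "poly A a = - (poly B a * b)"
    using assms(2) A by (simp add: ev_el add_eq_0_iff2)
  have "u = ((x - a) * poly A1 x + - (poly B a * b)) + ((x - a) * poly B1 x + poly B a) * y"
    unfolding A(3) el_def by (simp only: Ax Bx Aa)
  also have "\<dots> = (x - a) * el A1 B1 + poly B a * (y - b)"
    by (simp add: el_def algebra_simps)
  finally have "u = (x - a) * el A1 B1 + poly B a * (y - b)" .
  then show ?thesis using that[OF R_el[OF A1(1) B1(1)] poly_in_subfield[OF k A(2) ak]] by blast
qed

lemma x_minus_a: "x - a \<noteq> 0" "x - a \<in> R" "ev a b (x - a) = 0"
  and y_minus_b: "y - b \<in> R" "ev a b (y - b) = 0"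
proof -
  show "x - a \<noteq> 0"
    using transc[of "[:- a, 1:]"] ak k_closed(2,3) by (auto simp: pk)
qed (simp_all add: R_diff R_x R_y R_k ev_diff ev_x ev_y ev_k ak bk)

lemma curve_at_point:
  "(y - b) * (weierstrass_dY a1 a2 a3 a4 a6 a b + (y - b) + a1 * (x - a)) =
   (x - a) * (- weierstrass_dX a1 a2 a3 a4 a6 a b + (x - a) * (3 * a + (x - a) + a2))"
  using weierstrass_taylor[of a1 a2 a3 a4 a6 x y a b] curve ab_curve by simp

lemma numeral_k: "3 \<in> k" "2 \<in> k"
proof -
  show "2 \<in> k" using k_closed(4)[OF k_closed(2) k_closed(2)] by simp
  then show "3 \<in> k" using k_closed(4)[OF k_closed(2), of 2] by simp
qed

lemma dX_k: "weierstrass_dX a1 a2 a3 a4 a6 a b \<in> k" and dY_k: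
    "weierstrass_dY a1 a2 a3 a4 a6 a b \<in> k"
  unfolding weierstrass_dX_def weierstrass_dY_def
  using coeffs ak bk numeral_k by (intro k_closed(4,5,6,9); simp)+

text \<open>Here nonsingularity enters. A nonzero \<open>Y\<close>-derivative makes
  \<open>y - b\<close> a regular multiple of \<open>x - a\<close>, so \<open>x - a\<close> is a
  uniformizer; otherwise \<open>x - a\<close> is a unit times \<open>(y - b)^2\<close>. The number
  \<open>e\<close> is the ramification index of \<open>x\<close> at the point.\<close>

lemma uniformizer:
  obtains t e w p where "t \<in> R" "ev a b t = 0" "e > (0::nat)" "w \<in> pt_units a b"
    "x - a = t ^ e * w" "p \<in> pt_ring a b" "y - b = t * p"
    "weierstrass_dY a1 a2 a3 a4 a6 a b = 0 \<Longrightarrow> e = 2 \<and> t = y - b"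
proof (cases "weierstrass_dY a1 a2 a3 a4 a6 a b = 0")
  case False
  define s where "s = weierstrass_dY a1 a2 a3 a4 a6 a b + (y - b) + a1 * (x - a)"
  define r where "r = - weierstrass_dX a1 a2 a3 a4 a6 a b + (x - a) * (3 * a + (x - a) + a2)"
  have R: "s \<in> R" "r \<in> R" unfolding s_def r_def
    using R_k[OF ak] R_k[OF dX_k] R_k[OF dY_k] coeffs R_k numeral_k
    by (intro R_add R_mult R_minus x_minus_a y_minus_b; simp)+
  have "ev a b s = weierstrass_dY a1 a2 a3 a4 a6 a b"
    unfolding s_def using R_k[OF dY_k] coeffs R_k
    by (simp add: ev_add R_add R_mult x_minus_a y_minus_b ev_mult ev_k dY_k)
  then have s0: "ev a b s \<noteq> 0" using False by simp
  then have "s \<noteq> 0" using ev_0 by auto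
  then have "y - b = (x - a) * (r / s)"
    using curve_at_point unfolding s_def[symmetric] r_def[symmetric] by (simp add: field_simps)
  then show ?thesis
    using that[of "x - a" 1 1 "r / s"] x_minus_a R_pt_units[OF R_k[OF k_closed(2)]] ev_1
      pt_ringI[OF R(2,1) s0] False by auto
next
  case True
  then have dX: "weierstrass_dX a1 a2 a3 a4 a6 a b \<noteq> 0" using nonsing[OF ak bk ab_curve] by auto
  define s where "s = 3 * a + (x - a) + a2"
  \<comment> \<open>The cross term \<open>a1 * (x - a) * (y - b)\<close> is moved into the cofactor
    of \<open>x - a\<close>, so that exactly \<open>(y - b)^2\<close> remains on the other side; at
    the point it contributes 0 to \<open>r\<close>.\<close>
  define r where "r = - weierstrass_dX a1 a2 a3 a4 a6 a b + (x - a) * s - a1 * (y - b)"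
  have s: "s \<in> R" unfolding s_def
    using R_k[OF ak] coeffs R_k numeral_k by (intro R_add R_mult x_minus_a; simp)
  have R: "r \<in> R" unfolding r_def
    using R_k[OF dX_k] coeffs R_k s
    by (intro R_add R_diff R_mult R_minus x_minus_a y_minus_b; simp)
  have "ev a b r = - weierstrass_dX a1 a2 a3 a4 a6 a b"
    unfolding r_def using R_k[OF dX_k] coeffs R_k s
    by (simp add: ev_add ev_diff ev_minus R_add R_diff R_minus R_mult x_minus_a y_minus_b ev_mult
        ev_k dX_k)
  then have r0: "ev a b r \<noteq> 0" using dX by simp
  then have "r \<noteq> 0" using ev_0 by auto
  have "(x - a) * r = (y - b) ^ 2"
    using curve_at_point True unfolding s_def[symmetric]
        by (simp add: r_def algebra_simps power2_eq_square)
  then have "x - a = (y - b) ^ 2 * (1 / r)"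
    using \<open>r \<noteq> 0\<close> by (simp add: field_simps)
  then show ?thesis
    using that[of "y - b" 2 "1 / r" 1] y_minus_b R_k[OF k_closed(2)] R_pt_ring ev_1
      pt_unitsI[OF R_k[OF k_closed(2)] R _ r0] by auto
qed

context
  fixes t w p :: 'a and e :: nat
  assumes t: "t \<in> R" "ev a b t = 0" and e: "e > 0" and w: "w \<in> pt_units a b" "x - a = t ^ e * w"
    and p: "p \<in> pt_ring a b" "y - b = t * p"
begin

lemma t_nonzero: "t \<noteq> 0"
  using w(2) x_minus_a(1) e by auto

text \<open>\<open>x - a\<close> and \<open>y - b\<close> are both multiples of \<open>t\<close>,
  and by \<open>ev_eq_0_decompose\<close> every numerator vanishing at the point is a combination of
  them.\<close>

lemma pt_place_descent:
  assumes "z \<in> pt_place a b"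
  shows "\<exists>z'\<in>pt_ring a b. z = t * z'"
proof -
  obtain u v where u: "u \<in> R" "v \<in> R" "ev a b u = 0" "ev a b v \<noteq> 0" "v \<noteq> 0" "z = u / v"
    using assms by (elim pt_placeE)
  obtain u1 c where c: "u1 \<in> R" "c \<in> k" "u = (x - a) * u1 + c * (y - b)"
    using ev_eq_0_decompose[OF u(1,3)] by blast
  have "t ^ e = t * t ^ (e - 1)" using e by (cases e) auto
  then have "z = t * ((t ^ (e - 1) * w * u1 + c * p) * (1 / v))"
    unfolding u(6) c(3) w(2) p(2) by (simp add: algebra_simps add_divide_distrib)
  moreover have "(t ^ (e - 1) * w * u1 + c * p) * (1 / v) \<in> pt_ring a b"
    using w(1) pt_ring_cases
    by (intro pt_ring_mult pt_ring_add pt_ring_power pt_ringI p(1) u R_pt_ring[OF t(1)]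
        R_pt_ring[OF c(1)]
        R_pt_ring[OF R_k[OF c(2)]] R_k[OF k_closed(2)]) auto
  ultimately show ?thesis by blast
qed

lemma t_power_pt_place: "n > 0 \<Longrightarrow> t ^ n \<in> pt_place a b"
  using pt_place_mult[OF R_pt_place[OF t] pt_ring_power[OF R_pt_ring[OF t(1)]]] by (cases n) auto

text \<open>The norm bounds the order: \<open>nrm A B\<close> is \<open>(x - a)^m\<close> times a
  polynomial not vanishing at \<open>a\<close>, that is \<open>t^(e * m)\<close> times a unit, and
  \<open>u\<close> divides it in \<open>R\<close>.\<close>

lemma pt_order_bounded:
  assumes u: "u \<in> R" "u \<noteq> 0"
  shows "\<exists>N. \<forall>n>N. \<forall>z\<in>pt_ring a b. u \<noteq> t ^ n * z"
proof -
  obtain A B where A: "A \<in> polys_over k" "B \<in> polys_over k" "u = el A B" using u(1) by (elim R_E)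
  have "nrm A B \<noteq> 0" using nrm_eq_0[of A B] A u(2) by (auto simp: el_def)
  then obtain m q where q: "q \<in> polys_over k" "nrm A B = [:- a, 1:] ^ m * q" "poly q a \<noteq> 0"
    using polys_over_root_multiplicity[OF k nrm_over[OF A(1,2)] ak] by blast
  define u' where "u' = el (A - B * h) (- B)"
  have u': "u' \<in> R" using A by (simp add: u'_def R_el pk h_over)
  have "u * u' = (x - a) ^ m * poly q x"
    unfolding A(3) u'_def el_conjugate q(2) by (simp add: poly_power)
  also have "\<dots> = t ^ (e * m) * (w ^ m * poly q x)"
    unfolding w(2) by (simp add: power_mult_distrib power_mult)
  finally have eq: "u * u' = t ^ (e * m) * (w ^ m * poly q x)" .
  have unit: "w ^ m * poly q x \<in> pt_units a b"
    using q R_poly by (intro pt_units_mult pt_units_power w(1) R_pt_units) (auto simp: ev_poly)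
  have "u \<noteq> t ^ n * z" if n: "n > e * m" and z: "z \<in> pt_ring a b" for n z
  proof
    assume "u = t ^ n * z"
    then have "t ^ (e * m) * (t ^ (n - e * m) * (z * u')) = t ^ (e * m) * (w ^ m * poly q x)"
      using eq n power_add[of t "e * m" "n - e * m"] by (simp add: mult_ac)
    then have "t ^ (n - e * m) * (z * u') = w ^ m * poly q x"
      using t_nonzero by simp
    moreover have "t ^ (n - e * m) * (z * u') \<in> pt_place a b"
      using n by (intro pt_place_mult t_power_pt_place pt_ring_mult z R_pt_ring[OF u']) auto
    ultimately show False using unit pt_disjoint by metis
  qed
  then show ?thesis by blast
qed

text \<open>As long as no unit is left, \<open>pt_place_descent\<close> splits off another factor
  \<open>t\<close>; \<open>pt_order_bounded\<close> stops this.\<close>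

lemma pt_form_R:
  assumes u: "u \<in> R" "u \<noteq> 0"
  shows "\<exists>n. \<exists>z\<in>pt_units a b. u = t ^ n * z"
proof (rule ccontr)
  assume c: "\<not> ?thesis"
  have "\<exists>z\<in>pt_ring a b. u = t ^ n * z" for n
  proof (induction n)
    case 0
    then show ?case using R_pt_ring[OF u(1)] by auto
  next
    case (Suc n)
    then obtain z where z: "z \<in> pt_ring a b" "u = t ^ n * z" by blast
    then have "z \<in> pt_place a b" using c pt_ring_cases by blast
    then obtain z' where "z' \<in> pt_ring a b" "z = t * z'" using pt_place_descent by blast
    then show ?case using z(2) by (intro bexI[of _ z']) (simp_all add: mult_ac)
  qed
  then show False using pt_order_bounded[OF u] by blast
qed

lemma pt_form:
  assumes z: "z \<in> F" "z \<noteq> 0"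
  shows "\<exists>n::int. \<exists>u\<in>pt_units a b. z = t powi n * u"
proof -
  obtain u C where u: "u \<in> R" "C \<in> polys_over k" "C \<noteq> 0" "poly C x \<noteq> 0" "z = u / poly C x"
    using z(1) by (elim F_E)
  obtain n u1 where n: "u1 \<in> pt_units a b" "u = t ^ n * u1" using pt_form_R[OF u(1)] z u by auto
  obtain m u2 where m: "u2 \<in> pt_units a b" "poly C x = t ^ m * u2"
    using pt_form_R[OF R_poly[OF u(2)] u(4)] by blast
  have "z = t powi (int n - int m) * (u1 * inverse u2)"
    unfolding u(5) n(2) m(2) using t_nonzero
    by (simp add: power_int_diff divide_inverse mult_ac)
  then show ?thesis using pt_units_mult[OF n(1) pt_units_inverse[OF m(1)]] by blast
qed

lemma pt_field_place: "field_place k F (pt_place a b) (pt_ring a b)"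
proof (rule field_place.intro)
  have one: "1 \<in> pt_units a b" using R_pt_units[OF R_k[OF k_closed(2)]] ev_1 by simp
  have minus: "- z \<in> pt_ring a b" if "z \<in> pt_ring a b" for z
    using pt_ring_mult[OF R_pt_ring[OF R_k[of "- 1"]] that] k_closed(2,3) by simp
  show "subring (pt_ring a b) type_ring"
    unfolding subring_type_ring_iff
    using one by (intro conjI ballI pt_ring_add pt_ring_mult minus) (auto simp: pt_ring_cases)
  have ni: "inverse z \<notin> pt_ring a b" if "z \<in> pt_place a b" "z \<noteq> 0" for z
    using pt_place_mult[OF that(1), of "inverse z"] that(2) one pt_disjoint[of 1] by auto
  show "k \<subset> pt_ring a b"
  proof
    show "k \<subseteq> pt_ring a b" using R_pt_ring R_k by blast
    have "x \<in> pt_ring a b" using R_pt_ring R_x by blast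
    moreover have "x \<notin> k"
      using transc[of "[:- x, 1:]"] k_closed(2,3) by (auto simp: pk)
    ultimately show "k \<noteq> pt_ring a b" by blast
  qed
  show "pt_ring a b \<subset> F"
  proof
    show "pt_ring a b \<subseteq> F" using R_sub_F F_closed(8) by (auto simp: pt_ring_def)
    have "inverse (x - a) \<in> F" using x_minus_a(2) R_sub_F F_closed(7) by blast
    moreover have "inverse (x - a) \<notin> pt_ring a b"
      using ni[OF R_pt_place[OF x_minus_a(2,3)] x_minus_a(1)] .
    ultimately show "pt_ring a b \<noteq> F" by blast
  qed
  show "z \<in> pt_ring a b \<or> inverse z \<in> pt_ring a b" if z: "z \<in> F" for z
  proof (cases "z = 0")
    case True
    then show ?thesis using R_pt_ring[OF R_k[OF k_closed(1)]] by simp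
  next
    case False
    then obtain n :: int and u where u: "u \<in> pt_units a b" "z = t powi n * u" using pt_form z
        by blast
    have tp: "t ^ m * v \<in> pt_ring a b" if "v \<in> pt_units a b" for m v
      using that pt_ring_mult[OF pt_ring_power[OF R_pt_ring[OF t(1)]]] pt_ring_cases by blast
    show ?thesis
    proof (cases "n \<ge> 0")
      case True
      then show ?thesis using u tp by (simp add: power_int_def)
    next
      case False
      then have "inverse z = t ^ nat (- n) * inverse u"
        using u by (simp add: power_int_def power_inverse)
      then show ?thesis using tp pt_units_inverse[OF u(1)] by simp
    qed
  qed
  have "z \<in> pt_place a b \<longleftrightarrow> z \<in> pt_ring a b \<and> (z = 0 \<or> inverse z \<notin> pt_ring a b)" for z
    using ni[of z] pt_ring_cases[of z] pt_ring_cases[of "inverse z"] pt_units_inverse[of z]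
      R_pt_place[OF R_k[OF k_closed(1)] ev_0] by blast
  then show "pt_place a b = {z \<in> pt_ring a b. z = 0 \<or> inverse z \<notin> pt_ring a b}" by blast
qed (rule k F_subfield)+

lemma pt_prime: "prime_element F (pt_place a b) t" and pt_degree: "has_degree k F (pt_place a b) 1"
proof -
  interpret p: field_place k F "pt_place a b" "pt_ring a b" by (rule pt_field_place)
  have ku: "z \<in> p.kunits" if "z \<in> pt_units a b" for z
  proof -
    obtain u v where u: "u \<in> R" "v \<in> R" "ev a b u \<noteq> 0" "ev a b v \<noteq> 0" "u \<noteq> 0" "v \<noteq> 0" "z = u / v"
      using \<open>z \<in> pt_units a b\<close> by (elim pt_unitsE)
    have evk: "ev a b u' \<in> k" if "u' \<in> R" for u'
      using that by (elim R_E) (simp add: ev_el k_closed(4,5) poly_in_subfield[OF k] ak bk)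
    define c where "c = ev a b u"
    define d where "d = ev a b v"
    have cd: "c \<in> k" "d \<in> k" "c \<noteq> 0" "d \<noteq> 0" using u evk by (simp_all add: c_def d_def)
    \<comment> \<open>The value of \<open>z\<close> is the quotient of the values of numerator and
      denominator, so the new numerator vanishes at the point.\<close>
    have "z - c / d = (u * d - c * v) / (v * d)"
      using u(6,7) cd(4) by (simp add: diff_frac_eq)
    also have "\<dots> \<in> pt_place a b"
      using u cd by (intro pt_placeI) (auto simp: R_diff R_mult R_k ev_diff ev_mult ev_k c_def
          d_def)
    finally show ?thesis
      unfolding p.kunits_def using cd k_closed(8)[of c d]
          by (intro CollectI bexI[of _ "c / d"]) auto
  qed
  show "prime_element F (pt_place a b) t" "has_degree k F (pt_place a b) 1"
    using p.prime_element_kunits[OF R_pt_place[OF t]] pt_form ku by blast+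
qed

end

lemma pt_place_in: "field_place k F (pt_place a b) (pt_ring a b)"
    and pt_place_degree: "has_degree k F (pt_place a b) 1"
  by (rule uniformizer; metis pt_field_place pt_degree)+

lemma pt_place_rational: "pt_place a b \<in> rational_places k F"
  using field_place.place[OF pt_place_in] pt_place_degree by (simp add: rational_places_def)

lemma pt_x_order:
  assumes "weierstrass_dY a1 a2 a3 a4 a6 a b = 0"
  shows "has_order F (pt_place a b) (x - a) 2" "prime_element F (pt_place a b) (y - b)"
proof -
  obtain t e w p where u: "t \<in> R" "ev a b t = 0" "e > (0::nat)" "w \<in> pt_units a b"
    "x - a = t ^ e * w" "p \<in> pt_ring a b" "y - b = t * p" "e = 2 \<and> t = y - b"
    using uniformizer assms by metis
  note i = u(1-7)
  interpret p: field_place k F "pt_place a b" "pt_ring a b" by (rule pt_place_in)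
  show y: "prime_element F (pt_place a b) (y - b)" using pt_prime[OF i] u(8) by simp
  have "w \<in> pt_ring a b - pt_place a b" using u(4) pt_disjoint pt_ring_cases by blast
  moreover have "x - a = (y - b) powi 2 * w" using u(5,8) by simp
  ultimately show "has_order F (pt_place a b) (x - a) 2"
    using p.has_order_iff[OF y] by blast
qed

text \<open>By evaluation \<open>R\<close> lies in \<open>V\<close>, and a function of
  \<open>R\<close> lies in \<open>P\<close> when it vanishes at the point; so \<open>V\<close>
  contains \<open>pt_ring a b\<close> and \<open>P\<close> contains \<open>pt_place a b\<close>. A
  valuation ring is not properly dominated: for \<open>z\<close> outside \<open>pt_ring a b\<close>
  the inverse lies in \<open>pt_place a b\<close>, so \<open>z\<close> has a pole at
  \<open>P\<close>.\<close>

lemma pt_place_unique: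
  assumes P: "field_place k F P V" and xa: "x - a \<in> P" and yb: "y - b \<in> P"
  shows "P = pt_place a b"
proof -
  interpret p: field_place k F P V by (rule P)
  interpret q: field_place k F "pt_place a b" "pt_ring a b" by (rule pt_place_in)
  have xyV: "x \<in> V" "y \<in> V"
    using p.V_closed(4)[OF p.P_sub[OF xa] p.k_sub[OF ak]] p.V_closed(4)[OF p.P_sub[OF yb]
        p.k_sub[OF bk]]
    by simp_all
  have pV: "poly q x \<in> V" if "q \<in> polys_over k" for q
    using that
  proof (induction q)
    case (pCons a q)
    then show ?case using p.V_closed(4,5) p.k_sub xyV(1) by (simp add: pk)
  qed (simp add: p.V_closed(1))
  have RV: "u \<in> V" if "u \<in> R" for u
    using that xyV(2) pV by (elim R_E) (simp add: el_def p.V_closed(4,5))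
  have evP: "u \<in> P" if u: "u \<in> R" "ev a b u = 0" for u
  proof -
    obtain u1 c where c: "u1 \<in> R" "c \<in> k" "u = (x - a) * u1 + c * (y - b)"
      using ev_eq_0_decompose[OF u] by blast
    then show ?thesis using p.P_add[OF p.P_mult'[OF xa RV[OF c(1)]] p.P_mult[OF p.k_sub[OF c(2)]
        yb]] by simp
  qed
  have evU: "u \<in> V - P" if u: "u \<in> R" "ev a b u \<noteq> 0" for u
  proof -
    have c: "ev a b u \<in> k"
      using u(1) by (elim R_E) (simp add: ev_el k_closed(4,5) poly_in_subfield[OF k] ak bk)
    have "u - ev a b u \<in> P"
      using u(1) c by (intro evP) (simp_all add: R_diff R_k ev_diff ev_k)
    then show ?thesis using p.unit_add_P[OF p.unit_k[OF c u(2)]] by fastforce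
  qed
  have mP: "z \<in> P" if z: "z \<in> pt_place a b" for z
  proof -
    obtain u v where "u \<in> R" "v \<in> R" "ev a b u = 0" "ev a b v \<noteq> 0" "z = u / v"
      using z by (elim pt_placeE)
    then show ?thesis using p.P_mult'[OF evP, of u "inverse v"] p.unit_inverse[OF evU, of v]
      by (simp add: divide_inverse)
  qed
  have OV: "z \<in> V" if z: "z \<in> pt_ring a b" for z
  proof -
    obtain u v where "u \<in> R" "v \<in> R" "ev a b v \<noteq> 0" "z = u / v"
      using z by (elim pt_ringE)
    then show ?thesis using p.V_closed(5)[OF RV, of u "inverse v"] p.unit_inverse[OF evU, of v]
      by (simp add: divide_inverse)
  qed
  have VO: "z \<in> pt_ring a b" if z: "z \<in> V" for z
  proof (rule ccontr)
    assume n: "z \<notin> pt_ring a b"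
    then have "inverse z \<in> P" using mP q.inverse_in_P p.V_sub z by blast
    moreover have "z \<noteq> 0" using n q.V_closed(1) by auto
    ultimately show False using z by (auto simp: p.P_eq)
  qed
  have "V = pt_ring a b" using OV VO by blast
  then show ?thesis using p.P_eq q.P_eq by simp
qed

end

end

section \<open>Functions on the whole affine curve\<close>

context weierstrass_closed
begin

lemma exists_point:
  assumes "c \<in> k" shows "\<exists>d. on_curve c d"
proof -
  have "\<exists>d\<in>k. poly [:- poly f c, poly h c, 1:] d = 0"
    using assms poly_in_subfield[OF k f_over assms] poly_in_subfield[OF k h_over assms]
        k_closed(2,3)
    by (intro root) (simp_all add: pk)
  then obtain d where "d \<in> k" "poly [:- poly f c, poly h c, 1:] d = 0" by blast
  then have "d \<in> k" "weierstrass a1 a2 a3 a4 a6 c d = 0"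
    by (simp_all add: weierstrass_def f_def h_def algebra_simps power2_eq_square power3_eq_cube)
  then show ?thesis using assms by (auto simp: on_curve_def)
qed

lemma conjugate_point:
  assumes "on_curve a b" shows "on_curve a (- b - poly h a)"
proof -
  have "weierstrass a1 a2 a3 a4 a6 a (- b - poly h a) = weierstrass a1 a2 a3 a4 a6 a b"
    by (simp add: weierstrass_def h_def algebra_simps power2_eq_square power3_eq_cube)
  then show ?thesis
    using assms poly_in_subfield[OF k h_over] k_closed(3,6) by (simp add: on_curve_def)
qed

text \<open>The \<open>Y\<close>-derivative is the difference of the two ordinates over
  \<open>a\<close>; it vanishes exactly where the point is its own conjugate.\<close>

lemma dY_eq: "weierstrass_dY a1 a2 a3 a4 a6 a b = b - (- b - poly h a)"
  by (simp add: weierstrass_dY_def h_def)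

text \<open>The Taylor identity puts the constant \<open>weierstrass a1 a2 a3 a4 a6 a b\<close> into
  \<open>P\<close>, which contains no nonzero constant.\<close>

lemma on_curve_if_in_place:
  assumes P: "field_place k F P V" and ab: "a \<in> k" "b \<in> k" "x - a \<in> P" "y - b \<in> P"
  shows "on_curve a b"
proof -
  interpret p: field_place k F P V by (rule P)
  define s where "s = weierstrass_dY a1 a2 a3 a4 a6 a b + (y - b) + a1 * (x - a)"
  define r where "r = - weierstrass_dX a1 a2 a3 a4 a6 a b + (x - a) * (3 * a + (x - a) + a2)"
  have n: "2 \<in> k" "3 \<in> k"
    using k_closed(4)[OF k_closed(2) k_closed(2)] k_closed(4)[OF k_closed(2), of 2] by simp_all
  have d: "weierstrass_dX a1 a2 a3 a4 a6 a b \<in> k" "weierstrass_dY a1 a2 a3 a4 a6 a b \<in> k"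
    unfolding weierstrass_dX_def weierstrass_dY_def
    using coeffs ab n by (intro k_closed(4,5,6,9); simp)+
  have w: "weierstrass a1 a2 a3 a4 a6 a b \<in> k"
    unfolding weierstrass_def using coeffs ab by (intro k_closed(4,5,6,9); simp)
  have "s \<in> V" "r \<in> V" unfolding s_def r_def
    using d coeffs ab n p.k_sub p.P_sub by (intro p.V_closed(3,4,5); simp)+
  then have "(x - a) * r - (y - b) * s \<in> P"
    using ab p.P_mult' p.P_diff by blast
  moreover have "weierstrass a1 a2 a3 a4 a6 a b = (x - a) * r - (y - b) * s"
    using weierstrass_taylor[of a1 a2 a3 a4 a6 x y a b] curve
        unfolding s_def[symmetric] r_def[symmetric]
    by (simp add: algebra_simps)
  ultimately show ?thesis using p.k_P[OF w] ab by (simp add: on_curve_def)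
qed

lemma pt_place_mem: assumes "on_curve a b" shows "x - a \<in> pt_place a b" "y - b \<in> pt_place a b"
  using R_pt_place[OF assms] x_minus_a[OF assms] y_minus_b[OF assms] by blast+

text \<open>Where \<open>x\<close>, and hence \<open>y\<close>, is regular, their residues in
  \<open>k\<close> are the coordinates of a point.\<close>

lemma rational_place_cases:
  assumes "P \<in> rational_places k F"
  obtains (infinite) "x \<notin> place_ring F P" "y \<notin> place_ring F P"
    | (point) a b where "on_curve a b" "P = pt_place a b"
proof (cases "x \<in> place_ring F P")
  case True
  have P: "P \<in> places k F" "has_degree k F P 1" using assms by (auto simp: rational_places_def)
  have fp: "field_place k F P (place_ring F P)" by (rule placesD[OF P(1) k F_subfield])
  interpret p: field_place k F P "place_ring F P" by (rule fp)
  have "y \<in> place_ring F P" using place_y_integral[OF fp True] .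
  then obtain a b where ab: "a \<in> k" "b \<in> k" "x - a \<in> P" "y - b \<in> P"
    using True P(2) p.has_degree_one_iff by blast
  then have "on_curve a b" by (rule on_curve_if_in_place[OF fp])
  then show ?thesis using point pt_place_unique[OF _ fp ab(3,4)] by blast
next
  case False
  have "P \<in> places k F" using assms by (auto simp: rational_places_def)
  then have fp: "field_place k F P (place_ring F P)" by (rule placesD[OF _ k F_subfield])
  then show ?thesis using infinite False place_x_integral[OF fp] by blast
qed

lemma ev_pt_place:
  assumes "on_curve a b" "u \<in> R" "u \<in> pt_place a b"
  shows "ev a b u = 0"
  using pt_disjoint[OF assms(1,3)] R_pt_units[OF assms(1,2)] by blast

text \<open>Serves to cancel a factor \<open>x - c\<close> from a denominator. The numerator
  vanishes at every point over \<open>c\<close>, that is \<open>A(c) + B(c) * d' = 0\<close>. Two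
  distinct points give two independent equations; over a branch point the second condition comes
  from \<open>x - c\<close> having order 2.\<close>

lemma regular_denominator_root:
  assumes z: "\<And>a b. on_curve a b \<Longrightarrow> z \<in> pt_ring a b"
    and A: "A \<in> polys_over k" and B: "B \<in> polys_over k" and C: "C \<in> polys_over k"
    and c: "c \<in> k" and eq: "el A B = z * ((x - c) * poly C x)"
  shows "poly A c = 0 \<and> poly B c = 0"
proof -
  obtain d where d: "on_curve c d" using exists_point[OF c] by blast
  have zero: "poly A c + poly B c * d' = 0" if d': "on_curve c d'" for d'
  proof -
    have "(x - c) * (z * poly C x) \<in> pt_place c d'"
      using pt_place_mult[OF d' pt_place_mem(1)[OF d'] pt_ring_mult[OF d' z[OF d'] R_pt_ring[OF d'
          R_poly[OF C]]]] .
    then have "el A B \<in> pt_place c d'" unfolding eq by (simp add: mult_ac)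
    then show ?thesis using ev_pt_place[OF d' R_el[OF A B]] ev_el[OF d' A B] by simp
  qed
  have "poly B c = 0"
  proof (cases "weierstrass_dY a1 a2 a3 a4 a6 c d = 0")
    case False
    have "poly B c * (d - (- d - poly h c)) = 0"
      using zero[OF d] zero[OF conjugate_point[OF d]] by (simp add: algebra_simps)
    then show ?thesis using False unfolding dY_eq by simp
  next
    case True
    interpret p: field_place k F "pt_place c d" "pt_ring c d" by (rule pt_place_in[OF d])
    note o = pt_x_order[OF d True]
    obtain w where w: "w \<in> pt_ring c d" "x - c = (y - d) powi 2 * w"
      using p.has_order_iff[OF o(2)] o(1) by blast
    obtain A1 where A1: "A1 \<in> polys_over k" "A = [:- c, 1:] * A1 + [:poly A c:]"
      using polys_over_split_root[OF k A c] by blast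
    obtain B1 where B1: "B1 \<in> polys_over k" "B = [:- c, 1:] * B1 + [:poly B c:]"
      using polys_over_split_root[OF k B c] by blast
    define g where "g = z * poly C x - el A1 B1"
    have g: "g \<in> pt_ring c d" unfolding g_def
      using p.V_closed(6) pt_ring_mult[OF d z[OF d] R_pt_ring[OF d R_poly[OF C]]]
        R_pt_ring[OF d R_el[OF A1(1) B1(1)]] by blast
    have Ax: "poly A x = (x - c) * poly A1 x + poly A c"
      by (subst A1(2)) (simp add: algebra_simps)
    have Bx: "poly B x = (x - c) * poly B1 x + poly B c"
      by (subst B1(2)) (simp add: algebra_simps)
    have Ac: "poly A c = - (poly B c * d)" using zero[OF d] by (simp add: add_eq_0_iff2)
    have "((x - c) * poly A1 x + - (poly B c * d)) + ((x - c) * poly B1 x + poly B c) * y =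
        z * ((x - c) * poly C x)"
      using eq unfolding el_def by (simp only: Ax Bx Ac)
    \<comment> \<open>Modulo multiples of \<open>x - c\<close> the numerator is
      \<open>B(c) * (y - d)\<close>. As \<open>x - c\<close> is \<open>(y - d)^2\<close> times a
      regular function, the constant \<open>B(c)\<close> is a multiple of \<open>y - d\<close> and
      hence 0.\<close>
    then have "(y - d) * poly B c = (x - c) * g"
      by (simp add: g_def el_def algebra_simps)
    also have "\<dots> = (y - d) * ((y - d) * (w * g))"
      unfolding w(2) by (simp add: power2_eq_square mult_ac)
    finally have "poly B c = (y - d) * (w * g)"
      using p.prime_elementD(2)[OF o(2)] by simp
    moreover have "(y - d) * (w * g) \<in> pt_place c d"
      using pt_place_mem(2)[OF d] w(1) g p.P_mult' p.V_closed(5) by blast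
    ultimately show ?thesis
      using p.k_P[OF poly_in_subfield[OF k B c]] by simp
  qed
  then show ?thesis using zero[OF d] by simp
qed

text \<open>The coordinate ring of a nonsingular curve is the intersection of its local rings. Roots
  of the denominator are cancelled one at a time, lowering the degree of \<open>C\<close>.\<close>

lemma regular_in_R:
  assumes z: "z \<in> F" and reg: "\<And>a b. on_curve a b \<Longrightarrow> z \<in> pt_ring a b"
  shows "z \<in> R"
proof -
  have "z \<in> R" if "A \<in> polys_over k" "B \<in> polys_over k" "C \<in> polys_over k" "C \<noteq> 0"
    "z = el A B / poly C x" for A B C
    using that
  proof (induction "Polynomial.degree C" arbitrary: A B C rule: less_induct)
    case less
    have Cx: "poly C x \<noteq> 0" using less.prems transc by blast
    show ?case
    proof (cases "Polynomial.degree C = 0")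
      case True
      then obtain c where c: "C = [:c:]" by (rule degree_eq_zeroE)
      then have "c \<in> k" using less.prems(3) by (simp add: pk)
      then have "el A B * inverse c \<in> R"
        using less.prems k_closed(7) by (intro R_mult R_el R_k) auto
      then show ?thesis using less.prems(5) c by (simp add: divide_inverse)
    next
      case False
      then obtain c where c: "c \<in> k" "poly C c = 0" using root less.prems(3) by blast
      obtain C1 where C1: "C1 \<in> polys_over k" "C = [:- c, 1:] * C1"
        using polys_over_split_root[OF k less.prems(3) c(1)] c(2) by auto
      have Cx1: "poly C x = (x - c) * poly C1 x"
        unfolding C1(2) by (simp add: algebra_simps)
      have "C1 \<noteq> 0" using C1 less.prems by auto
      then have deg: "Polynomial.degree C1 < Polynomial.degree C"
        unfolding C1(2) by (subst degree_mult_eq) auto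
      have "el A B = z * ((x - c) * poly C1 x)"
        using less.prems(5) Cx unfolding Cx1 by simp
      then have zero: "poly A c = 0" "poly B c = 0"
        using regular_denominator_root[OF reg less.prems(1,2) C1(1) c(1)] by blast+
      obtain A1 where A1: "A1 \<in> polys_over k" "A = [:- c, 1:] * A1"
        using polys_over_split_root[OF k less.prems(1) c(1)] zero(1) by auto
      obtain B1 where B1: "B1 \<in> polys_over k" "B = [:- c, 1:] * B1"
        using polys_over_split_root[OF k less.prems(2) c(1)] zero(2) by auto
      have "el A B = (x - c) * el A1 B1"
        unfolding A1(2) B1(2) el_def by (simp add: algebra_simps)
      then have "z = el A1 B1 / poly C1 x"
        using less.prems(5) Cx unfolding Cx1 by simp
      then show ?thesis
        by (rule less.hyps[OF deg A1(1) B1(1) C1(1) \<open>C1 \<noteq> 0\<close>])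
    qed
  qed
  moreover obtain u C where "u \<in> R" "C \<in> polys_over k" "C \<noteq> 0" "z = u / poly C x"
    using z by (elim F_E)
  ultimately show ?thesis by (metis R_E)
qed

text \<open>The norm of \<open>z\<close> vanishes at every constant, because \<open>z\<close>
  vanishes at a point over it, and over an algebraically closed field only the zero polynomial does
  this.\<close>

lemma zero_at_all_points:
  assumes z: "z \<in> F" and all: "\<And>a b. on_curve a b \<Longrightarrow> z \<in> pt_place a b"
  shows "z = 0"
proof -
  have "z \<in> R" using pt_ring_cases all by (intro regular_in_R z) blast
  then obtain A B where A: "A \<in> polys_over k" "B \<in> polys_over k" "z = el A B" by (elim R_E)
  define N where "N = nrm A B"
  have N: "N \<in> polys_over k" using A nrm_over by (simp add: N_def)
  have root0: "poly N c = 0" if c: "c \<in> k" for c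
  proof -
    obtain d where d: "on_curve c d" using exists_point[OF c] by blast
    have u: "el (A - B * h) (- B) \<in> R" using A by (simp add: R_el pk h_over)
    have "poly N c = ev c d (poly N x)" using ev_poly[OF d N] by simp
    also have "\<dots> = ev c d z * ev c d (el (A - B * h) (- B))"
      unfolding N_def el_conjugate[symmetric] A(3)[symmetric] by (rule ev_mult[OF d \<open>z \<in> R\<close> u])
    also have "ev c d z = 0" using ev_pt_place[OF d \<open>z \<in> R\<close> all[OF d]] .
    finally show ?thesis by simp
  qed
  have "Polynomial.degree N = 0"
  proof (rule ccontr)
    assume "Polynomial.degree N \<noteq> 0"
    \<comment> \<open>Adding 1 avoids counting roots: at a root of \<open>N + 1\<close> the value of
      \<open>N\<close> is -1 and not 0.\<close>
    then have "Polynomial.degree (N + 1) > 0" by (subst degree_add_eq_left) auto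
    then obtain c where "c \<in> k" "poly (N + 1) c = 0" using root[of "N + 1"] N by (auto simp: pk)
    then show False using root0[of c] by simp
  qed
  then have "N = 0" using root0[OF k_closed(1)] by (elim degree_eq_zeroE) simp
  then show ?thesis using nrm_eq_0[of A B] A(3) by (simp add: N_def el_def)
qed

text \<open>Positive genus enters here: no function regular at the finite places has order \<open>-1\<close> at infinity,
  and a simple pole at \<open>(a, b)\<close> becomes, after multiplication by \<open>x - a\<close>, an element of the span of
  \<open>1\<close> and \<open>x\<close>, hence invariant under \<open>y \<mapsto> - y - a1 x - a3\<close>.\<close>

lemma lin_equiv_rational_eq:
  assumes Z: "field_place k F Z VZ" "x \<notin> VZ" "y \<notin> VZ"
    and T: "T \<in> rational_places k F" and S: "S \<in> rational_places k F"
    and eq: "lin_equiv k F (frag_of T) (frag_of S)"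
  shows "T = S"
proof (rule ccontr)
  assume ne: "T \<noteq> S"
  interpret Z: field_place k F Z VZ by (rule Z)
  obtain z where z: "z \<in> F" "z \<noteq> 0" and
    "\<And>P. P \<in> places k F \<Longrightarrow> has_order F P z (Poly_Mapping.lookup (frag_of T - frag_of S) P)"
    using eq unfolding lin_equiv_def by blast
  then have ord: "has_order F P z ((if P = T then 1 else 0) - (if P = S then 1 else 0))"
    if "P \<in> places k F" for P
    using that by (auto simp: lookup_minus lookup_single when_def)
  have ptpl: "pt_place a b \<in> places k F" if "on_curve a b" for a b
    using field_place.place[OF pt_place_in[OF that]] .
  have reg: "z \<in> pt_ring a b" if ab: "on_curve a b" "pt_place a b \<noteq> S" for a b
    using field_place.has_order_nonneg[OF pt_place_in[OF ab(1)] ord[OF ptpl[OF ab(1)]]] ab(2)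
        by simp
  show False
    using S
  proof (cases rule: rational_place_cases)
    case infinite
    have "S \<in> places k F" using S by (simp add: rational_places_def)
    then have fS: "field_place k F S (place_ring F S)" using placesD k F_subfield by blast
    have "pt_place a b \<noteq> S" if "on_curve a b" for a b
      using infinite(1) field_place.place_ring_eq[OF pt_place_in[OF that]] R_pt_ring[OF that R_x]
          by auto
    then have "z \<in> R" using reg by (intro regular_in_R z(1)) blast
    then obtain A B where A: "A \<in> polys_over k" "B \<in> polys_over k" "z = el A B" by (elim R_E)
    have nz: "A \<noteq> 0 \<or> B \<noteq> 0" using A z by (auto simp: el_def)
    have "has_order F S z (inf_order A B)"
      using inf_has_order[OF fS infinite A(1,2) nz, of 1] A(3) pk(3) by simp
    moreover have "has_order F S z (- 1)" using ord[OF \<open>S \<in> places k F\<close>] ne by simp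
    ultimately have "inf_order A B = - 1" using field_place.has_order_unique[OF fS] by blast
    \<comment> \<open>The order is \<open>- 2 * deg A\<close>, \<open>- 2 * deg B - 3\<close> or the
      smaller of the two; none of these is -1.\<close>
    then show False unfolding inf_order_def min_def by (simp split: if_splits) presburger+
  next
    case (point a b)
    note ab = point(1)
    interpret s: field_place k F S "pt_ring a b" using pt_place_in[OF ab] point(2) by simp
    have aK: "a \<in> k" using ak[OF ab] .
    have oz: "has_order F S z (- 1)" using ord[OF s.place] ne by simp
    have xa: "x - a \<in> S" using pt_place_mem(1)[OF ab] point(2) by simp
    have zn: "z \<notin> pt_ring a b" using s.has_order_nonneg_iff[OF oz] by simp
    \<comment> \<open>The zero of \<open>x - a\<close> at \<open>S\<close> cancels the only finite
      pole of \<open>z\<close>.\<close>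
    have "(x - a) * z \<in> R"
    proof (rule regular_in_R)
      show "(x - a) * z \<in> F" using F_closed(5,6) F_x F_k[OF aK] z(1) by blast
      show "(x - a) * z \<in> pt_ring a' b'" if ab': "on_curve a' b'" for a' b'
      proof (cases "pt_place a' b' = S")
        case False
        then show ?thesis
          using pt_ring_mult[OF ab' R_pt_ring[OF ab' R_diff[OF R_x R_k[OF aK]]] reg[OF ab']]
              by blast
      next
        case True
        obtain t where t: "prime_element F S t" using s.has_order_prime[OF oz] by blast
        obtain w where w: "w \<in> pt_ring a b" "x - a = t * w" using s.prime_elementD(3)[OF t xa]
            by blast
        obtain u where u: "u \<in> pt_ring a b" "z = t powi (- 1) * u" using oz s.has_order_iff[OF t]
            by blast
        have "(x - a) * z = w * u" using w(2) u(2) s.prime_elementD(2)[OF t] by simp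
        moreover have "pt_ring a' b' = pt_ring a b"
          using field_place.place_ring_eq[OF pt_place_in[OF ab']] s.place_ring_eq True by simp
        ultimately show ?thesis using s.V_closed(5)[OF w(1) u(1)] by simp
      qed
    qed
    then obtain A B where A: "A \<in> polys_over k" "B \<in> polys_over k" "(x - a) * z = el A B"
        by (elim R_E)
    have "(x - a) * z \<noteq> 0" using z(2) x_minus_a(1)[OF ab] by simp
    then have nz: "A \<noteq> 0 \<or> B \<noteq> 0" using A by (auto simp: el_def)
    have "Z \<noteq> S" using Z(2) Z.place_ring_eq s.place_ring_eq R_pt_ring[OF ab R_x] by auto
    \<comment> \<open>\<open>m\<close> is 1 if \<open>T\<close> is the infinite place and 0
      otherwise.\<close>
    then obtain m :: int where m: "has_order F Z z m" "m \<ge> 0" using ord[OF Z.place]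
        by (metis diff_zero order_refl zero_le_one)
    have "has_order F Z (el [:- a, 1:] 0 / poly 1 x) (inf_order [:- a, 1:] 0 + 2 * int
        (Polynomial.degree (1 :: 'a poly)))"
      using aK k_closed by (intro inf_has_order[OF Z]) (simp_all add: pk)
    then have "has_order F Z (x - a) (- 2)" by (simp add: el_def inf_order_def)
    then have "has_order F Z ((x - a) * z) (- 2 + m)" using Z.has_order_mult m(1) by blast
    moreover have "has_order F Z ((x - a) * z) (inf_order A B)"
      using inf_has_order[OF Z A(1,2) nz, of 1] A(3) pk(3) by simp
    \<comment> \<open>Order at least -2 excludes a term in \<open>y\<close>, whose order is at most
      -3.\<close>
    ultimately have io: "inf_order A B \<ge> - 2" using Z.has_order_unique m(2) by fastforce
    then have "B = 0" by (simp add: inf_order_def min_def split: if_splits)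
    then have "Polynomial.degree A \<le> 1" using io by (simp add: inf_order_def)
    obtain A1 where A1: "A1 \<in> polys_over k" "A = [:- a, 1:] * A1 + [:poly A a:]"
      using polys_over_split_root[OF k A(1) aK] by blast
    have "Polynomial.degree A1 = 0"
    proof (rule ccontr)
      assume n: "Polynomial.degree A1 \<noteq> 0"
      then have "A1 \<noteq> 0" by auto
      then have "Polynomial.degree ([:- a, 1:] * A1) = Suc (Polynomial.degree A1)"
        by (subst degree_mult_eq) auto
      then have "Polynomial.degree ([:- a, 1:] * A1 + [:poly A a:]) = Suc (Polynomial.degree A1)"
        by (subst degree_add_eq_left) auto
      then show False using A1(2) \<open>Polynomial.degree A \<le> 1\<close> n by simp
    qed
    then obtain d where d: "A1 = [:d:]" by (rule degree_eq_zeroE)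
    then have dk: "d \<in> k" using A1(1) by (simp add: pk)
    define c where "c = poly A a"
    have ck: "c \<in> k" using poly_in_subfield[OF k A(1) aK] by (simp add: c_def)
    have "poly A x = (x - a) * d + c"
      unfolding c_def by (subst A1(2)) (simp add: d algebra_simps)
    \<comment> \<open>That is, \<open>z = d + c / (x - a)\<close>; the poles of such a function over
      \<open>a\<close> are now examined.\<close>
    then have eqz: "(x - a) * z = (x - a) * d + c" using A(3) \<open>B = 0\<close> by (simp add: el_def)
    have c0: "c \<noteq> 0"
    proof
      assume "c = 0"
      then have "z = d" using eqz x_minus_a(1)[OF ab] by simp
      then show False using zn s.k_sub[OF dk] by simp
    qed
    show False
    proof (cases "weierstrass_dY a1 a2 a3 a4 a6 a b = 0")
      case True
      \<comment> \<open>At a branch point \<open>x - a\<close> vanishes to order 2, so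
        \<open>(x - a) * z\<close> still vanishes there, and with it \<open>c\<close>.\<close>
      have "has_order F S ((x - a) * z) (2 + - 1)"
        using s.has_order_mult[OF _ oz] pt_x_order(1)[OF ab True] point(2) by blast
      then have "(x - a) * z \<in> S" using s.has_order_pos by simp
      then have "c \<in> S"
        using s.P_diff[OF _ s.P_mult'[OF xa s.k_sub[OF dk]], of "(x - a) * z"] eqz by simp
      then show False using s.k_P[OF ck] c0 by blast
    next
      case False
      \<comment> \<open>The conjugate point is a different zero of \<open>x - a\<close>, and
        \<open>z\<close> is regular there; hence \<open>c = (x - a) * (z - d)\<close> vanishes at
        it.\<close>
      define b' where "b' = - b - poly h a"
      have ab': "on_curve a b'" unfolding b'_def by (rule conjugate_point[OF ab])
      interpret s': field_place k F "pt_place a b'" "pt_ring a b'" by (rule pt_place_in[OF ab'])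
      have "pt_place a b' \<noteq> S"
      proof
        assume "pt_place a b' = S"
        then have "(y - b') - (y - b) \<in> S"
          using pt_place_mem(2)[OF ab'] pt_place_mem(2)[OF ab] point(2) s.P_diff by blast
        then have "b - b' \<in> S" by simp
        then show False
          using s.k_P[of "b - b'"] k_closed(6)[OF bk[OF ab] bk[OF ab']] False
          unfolding dY_eq b'_def by simp
      qed
      then have "z \<in> pt_ring a b'" by (rule reg[OF ab'])
      then have "(x - a) * (z - d) \<in> pt_place a b'"
        using s'.P_mult'[OF pt_place_mem(1)[OF ab']] s'.V_closed(6) s'.k_sub[OF dk] by blast
      moreover have "(x - a) * (z - d) = c" using eqz by (simp add: algebra_simps)
      ultimately show False using s'.k_P[OF ck] c0 by simp
    qed
  qed
qed

end

section \<open>Extension of automorphisms to the constant field extension\<close>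

text \<open>Two pairs of generators of one function field satisfy the same equation. The
  automorphism that takes one pair to the other is defined by keeping the coordinate
  polynomials.\<close>

locale weierstrass_pair =
  w: weierstrass_field k a1 a2 a3 a4 a6 x y + w': weierstrass_field k a1 a2 a3 a4 a6 x' y'
  for k :: "'a::field set" and a1 a2 a3 a4 a6 x y x' y' :: 'a +
  assumes same_field: "w'.F = w.F"
begin

definition frac_rep :: "'a \<Rightarrow> 'a poly \<Rightarrow> 'a poly \<Rightarrow> 'a poly \<Rightarrow> bool" where
  "frac_rep z A B C \<longleftrightarrow> A \<in> polys_over k \<and> B \<in> polys_over k \<and> C \<in> polys_over k \<and> C \<noteq> 0 \<and>
     z = w.el A B / poly C x"

definition transport :: "'a \<Rightarrow> 'a" where
  "transport z = (THE v. \<exists>A B C. frac_rep z A B C \<and> v = w'.el A B / poly C x')"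

lemma frac_rep_exists: assumes "z \<in> w.F" shows "\<exists>A B C. frac_rep z A B C"
proof -
  obtain u C where u: "u \<in> w.R" "C \<in> polys_over k" "C \<noteq> 0" "z = u / poly C x"
    using assms by (elim w.F_E)
  moreover obtain A B where "A \<in> polys_over k" "B \<in> polys_over k" "u = w.el A B"
    using u(1) by (elim w.R_E)
  ultimately show ?thesis unfolding frac_rep_def by blast
qed

text \<open>Equality of fractions depends on the coordinate polynomials and not on the generators;
  this gives both well-definedness and injectivity of \<open>transport\<close>.\<close>

lemma frac_eq_iff:
  assumes "A \<in> polys_over k" "B \<in> polys_over k" "C \<in> polys_over k" "C \<noteq> 0"
    and "A1 \<in> polys_over k" "B1 \<in> polys_over k" "C1 \<in> polys_over k" "C1 \<noteq> 0"
  shows "w.el A B / poly C x = w.el A1 B1 / poly C1 x \<longleftrightarrow> A * C1 = A1 * C \<and> B * C1 = B1 * C"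
    and "w'.el A B / poly C x' = w'.el A1 B1 / poly C1 x' \<longleftrightarrow> A * C1 = A1 * C \<and> B * C1 = B1 * C"
proof -
  have "poly C x \<noteq> 0" "poly C1 x \<noteq> 0" "poly C x' \<noteq> 0" "poly C1 x' \<noteq> 0"
    using assms w.transc w'.transc by blast+
  moreover have "w.el A B * poly C1 x = w.el (A * C1) (B * C1)" "w.el A1 B1 * poly C x =
      w.el (A1 * C) (B1 * C)"
    "w'.el A B * poly C1 x' = w'.el (A * C1) (B * C1)" "w'.el A1 B1 * poly C x' =
        w'.el (A1 * C) (B1 * C)"
    by (simp_all add: w.el_def w'.el_def algebra_simps)
  moreover have "w.el (A * C1) (B * C1) = w.el (A1 * C) (B1 * C) \<longleftrightarrow> A * C1 = A1 * C \<and> B * C1 =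
      B1 * C"
    "w'.el (A * C1) (B * C1) = w'.el (A1 * C) (B1 * C) \<longleftrightarrow> A * C1 = A1 * C \<and> B * C1 = B1 * C"
    using w.el_inj[of "A * C1" "B * C1" "A1 * C" "B1 * C"] w'.el_inj[of "A * C1" "B * C1" "A1 * C"
        "B1 * C"]
      assms by (auto simp: w.pk)
  ultimately show "w.el A B / poly C x = w.el A1 B1 / poly C1 x \<longleftrightarrow> A * C1 = A1 * C \<and> B * C1 = B1 * C"
    "w'.el A B / poly C x' = w'.el A1 B1 / poly C1 x' \<longleftrightarrow> A * C1 = A1 * C \<and> B * C1 = B1 * C"
    by (simp_all add: frac_eq_eq)
qed

lemma transport_eq:
  assumes "frac_rep z A B C" shows "transport z = w'.el A B / poly C x'"
  unfolding transport_def
proof (rule the_equality)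
  show "\<exists>A' B' C'. frac_rep z A' B' C' \<and> w'.el A B / poly C x' = w'.el A' B' / poly C' x'"
    using assms by blast
  fix v assume "\<exists>A' B' C'. frac_rep z A' B' C' \<and> v = w'.el A' B' / poly C' x'"
  then obtain A' B' C' where "frac_rep z A' B' C'" "v = w'.el A' B' / poly C' x'" by blast
  then show "v = w'.el A B / poly C x'"
    using assms frac_eq_iff[of A' B' C' A B C] by (simp add: frac_rep_def)
qed

lemma frac_rep_poly: "A \<in> polys_over k \<Longrightarrow> B \<in> polys_over k \<Longrightarrow> frac_rep (w.el A B) A B 1"
  by (simp add: frac_rep_def w.pk)

lemma transport_el: "A \<in> polys_over k \<Longrightarrow> B \<in> polys_over k \<Longrightarrow> transport (w.el A B) = w'.el A B"
  using transport_eq[OF frac_rep_poly] by simp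

lemma transport_const: "c \<in> k \<Longrightarrow> transport c = c"
  using transport_el[of "[:c:]" 0] by (simp add: w.el_def w'.el_def w.pk)

lemma transport_x: "transport x = x'" and transport_y: "transport y = y'"
  using transport_el[of "[:0, 1:]" 0] transport_el[of 0 1] w.k_closed(1,2)
  by (simp_all add: w.el_def w'.el_def w.pk)

lemma transport_add: assumes "u \<in> w.F" "v \<in> w.F" shows "transport (u + v) =
    transport u + transport v"
proof -
  obtain A B C where r: "frac_rep u A B C" using frac_rep_exists[OF assms(1)] by blast
  obtain A1 B1 C1 where s: "frac_rep v A1 B1 C1" using frac_rep_exists[OF assms(2)] by blast
  have nz: "poly C x \<noteq> 0" "poly C1 x \<noteq> 0" "poly C x' \<noteq> 0" "poly C1 x' \<noteq> 0"
    using r s w.transc w'.transc unfolding frac_rep_def by blast+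
  have "u + v = w.el (A * C1 + A1 * C) (B * C1 + B1 * C) / poly (C * C1) x"
    using r s nz by (simp add: frac_rep_def add_frac_eq w.el_def algebra_simps)
  then have "frac_rep (u + v) (A * C1 + A1 * C) (B * C1 + B1 * C) (C * C1)"
    using r s by (simp add: frac_rep_def w.pk)
  then have "transport (u + v) = w'.el (A * C1 + A1 * C) (B * C1 + B1 * C) / poly (C * C1) x'"
    by (rule transport_eq)
  also have "\<dots> = w'.el A B / poly C x' + w'.el A1 B1 / poly C1 x'"
    using nz by (simp add: add_frac_eq w'.el_def algebra_simps)
  finally show ?thesis using transport_eq[OF r] transport_eq[OF s] by simp
qed

lemma transport_mult: assumes "u \<in> w.F" "v \<in> w.F" shows "transport (u * v) =
    transport u * transport v"
proof -
  obtain A B C where r: "frac_rep u A B C" using frac_rep_exists[OF assms(1)] by blast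
  obtain A1 B1 C1 where s: "frac_rep v A1 B1 C1" using frac_rep_exists[OF assms(2)] by blast
  have "u * v = w.el A B * w.el A1 B1 / poly (C * C1) x"
    using r s by (simp add: frac_rep_def)
  then have "frac_rep (u * v) (A * A1 + B * B1 * w.f) (A * B1 + B * A1 - B * B1 * w.h) (C * C1)"
    using r s by (simp add: frac_rep_def w.pk w.el_mult w.f_over w.h_over)
  then have "transport (u * v) = w'.el (A * A1 + B * B1 * w.f) (A * B1 + B * A1 - B * B1 * w.h) /
      poly (C * C1) x'"
    by (rule transport_eq)
  also have "\<dots> = w'.el A B * w'.el A1 B1 / poly (C * C1) x'"
    by (simp only: w'.el_mult)
  finally show ?thesis using transport_eq[OF r] transport_eq[OF s] by simp
qed

lemma transport_bij: "bij_betw transport w.F w.F"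
  unfolding bij_betw_def
proof
  show "inj_on transport w.F"
  proof (rule inj_onI)
    fix u v assume uv: "u \<in> w.F" "v \<in> w.F" "transport u = transport v"
    obtain A B C where r: "frac_rep u A B C" using frac_rep_exists[OF uv(1)] by blast
    obtain A1 B1 C1 where s: "frac_rep v A1 B1 C1" using frac_rep_exists[OF uv(2)] by blast
    have "w'.el A B / poly C x' = w'.el A1 B1 / poly C1 x'"
      using uv(3) transport_eq[OF r] transport_eq[OF s] by simp
    then show "u = v" using r s frac_eq_iff[of A B C A1 B1 C1] by (simp add: frac_rep_def)
  qed
  have "transport u \<in> w.F" if u: "u \<in> w.F" for u
  proof -
    obtain A B C where r: "frac_rep u A B C" using frac_rep_exists[OF u] by blast
    then have "w'.el A B / poly C x' \<in> w'.F"
      unfolding frac_rep_def by (intro w'.F_I w'.R_el) blast+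
    then show ?thesis using transport_eq[OF r] same_field by simp
  qed
  moreover have "v \<in> transport ` w.F" if "v \<in> w.F" for v
  proof -
    have "v \<in> w'.F" using that same_field by simp
    then obtain u C where u: "u \<in> w'.R" "C \<in> polys_over k" "C \<noteq> 0" "v = u / poly C x'"
      by (elim w'.F_E)
    moreover obtain A B where A: "A \<in> polys_over k" "B \<in> polys_over k" "u = w'.el A B"
      using u(1) by (elim w'.R_E)
    ultimately have "frac_rep (w.el A B / poly C x) A B C" "w.el A B / poly C x \<in> w.F"
      using w.F_I w.R_el by (auto simp: frac_rep_def)
    then show ?thesis using transport_eq u(4) A(3) by (intro image_eqI[of _ _
        "w.el A B / poly C x"]) simp_all
  qed
  ultimately show "transport ` w.F = w.F" by blast
qed

lemma transport_aut: "transport \<in> field_auts k w.F"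
  using transport_bij transport_add transport_mult transport_const w.k_closed(2)
  by (auto simp: field_auts_def ring_iso_def ring_hom_def bij_betw_def)

end

section \<open>Algebraic elements and the embedding \<open>to_ac\<close>\<close>

lemma type_ring_pow [simp]: "(z::'a::field) [^]\<^bsub>type_ring\<^esub> (n::nat) = z ^ n"
proof -
  interpret K: field "type_ring :: 'a ring" by (rule field_from_type_algebra)
  show ?thesis by (induction n) (simp_all add: mult.commute)
qed

text \<open>List polynomials carry the leading coefficient first, whereas \<open>Poly\<close>
  expects the constant term first.\<close>

lemma eval_eq_poly: "ring.eval type_ring xs (z::'a::field) = poly (Poly (rev xs)) z"
proof -
  interpret K: field "type_ring :: 'a ring" by (rule field_from_type_algebra)
  show ?thesis
    by (induction xs) (simp_all add: Poly_append poly_monom)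
qed

lemma algebraic_iff:
  fixes z :: "'a::field"
  assumes k: "subfield k type_ring"
  shows "(ring.algebraic type_ring over k) z \<longleftrightarrow> (\<exists>p\<in>polys_over k. p \<noteq> 0 \<and> poly p z = 0)"
proof -
  interpret K: field "type_ring :: 'a ring" by (rule field_from_type_algebra)
  have sr: "subring k type_ring" using k by (simp add: subfield_type_ring_iff)
  show ?thesis
  proof
    assume "(K.algebraic over k) z"
    then obtain xs where xs: "xs \<in> carrier (univ_poly type_ring k)" "xs \<noteq> []" "K.eval xs z = 0"
      using K.algebraicE[OF sr _] by (metis UNIV_I type_ring_sel(1,5))
    then have s: "set xs \<subseteq> k" "hd xs \<noteq> 0" by (auto simp: univ_poly_def polynomial_def)
    have "Poly (rev xs) \<in> polys_over k"
      using s(1) subfield_type_ringD(1)[OF k] by (auto simp: polys_over_def nth_default_def rev_nth)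
    moreover have "Poly (rev xs) \<noteq> 0"
    proof
      assume "Poly (rev xs) = 0"
      then obtain n where n: "rev xs = replicate n 0" by (auto simp: Poly_eq_0)
      then have "xs = replicate n 0" by (metis rev_replicate rev_rev_ident)
      then show False using s(2) xs(2) by (cases n) auto
    qed
    ultimately show "\<exists>p\<in>polys_over k. p \<noteq> 0 \<and> poly p z = 0"
      using xs(3) by (auto simp: eval_eq_poly)
  next
    assume "\<exists>p\<in>polys_over k. p \<noteq> 0 \<and> poly p z = 0"
    then obtain p where p: "p \<in> polys_over k" "p \<noteq> 0" "poly p z = 0" by blast
    have "set (Polynomial.coeffs p) \<subseteq> k"
      using p(1) by (auto simp: polys_over_def coeffs_def)
    then have "rev (Polynomial.coeffs p) \<in> carrier (univ_poly type_ring k)"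
      using p(2) by (auto simp: univ_poly_def polynomial_def hd_rev last_coeffs_eq_coeff_degree)
    moreover have "K.eval (rev (Polynomial.coeffs p)) z = 0"
      using p(3) by (simp add: eval_eq_poly)
    ultimately show "(K.algebraic over k) z"
      using K.algebraicI[of "rev (Polynomial.coeffs p)" k z] p(2) by simp
  qed
qed

text \<open>The coefficients of \<open>p\<close> generate a finite extension \<open>L\<close>;
  \<open>z\<close> is algebraic over \<open>L\<close>, so by the tower law it lies in a finite
  extension of \<open>K\<close>.\<close>

lemma algebraic_trans:
  fixes z :: "'a::field"
  assumes K: "subfield K type_ring" and p: "p \<noteq> 0" "poly p z = 0"
    and alg: "\<And>i. (ring.algebraic type_ring over K) (Polynomial.coeff p i)"
  shows "(ring.algebraic type_ring over K) z"
proof -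
  interpret T: field "type_ring :: 'a ring" by (rule field_from_type_algebra)
  define cs where "cs = Polynomial.coeffs p"
  define L where "L = T.finite_extension K cs"
  have algc: "(T.algebraic over K) c" if "c \<in> set cs" for c
    using that alg p(1) unfolding cs_def coeffs_def by auto
  have cs: "set cs \<subseteq> carrier type_ring" by simp
  have L: "subfield L type_ring" "T.finite_dimension K L"
    unfolding L_def using T.finite_extension_is_subfield[OF K cs]
        T.finite_extension_finite_dimension(1)[OF K cs] algc
    by blast+
  have "set cs \<subseteq> L"
    unfolding L_def by (rule T.finite_extension_mem[OF subfieldE(1)[OF K] cs])
  then have "p \<in> polys_over L"
    using subfield_type_ringD(1)[OF L(1)] by (auto simp: polys_over_def cs_def)
      (metis coeff_in_coeffs coeff_eq_0 leI p(1) subsetD)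
  then have z: "(T.algebraic over L) z" using algebraic_iff[OF L(1)] p by blast
  have "T.finite_dimension L (T.simple_extension L z)"
    using T.finite_dimension_simple_extension[OF L(1)] z by simp
  then have "T.finite_dimension K (T.simple_extension L z)"
    by (rule T.telescopic_base_dim(1)[OF K L])
  moreover have "subring (T.simple_extension L z) type_ring"
    by (rule T.simple_extension_is_subring[OF subfieldE(1)[OF L(1)]]) simp
  moreover have "z \<in> T.simple_extension L z"
    by (rule T.simple_extension_mem[OF subfieldE(1)[OF L(1)]]) simp
  ultimately show ?thesis using T.finite_dimension_imp_algebraic[OF K] by blast
qed

lemma subfield_to_ac: assumes "subfield K type_ring" shows "subfield (to_ac ` K) type_ring"
  unfolding subfield_type_ring_iff subring_type_ring_iff
  using subfield_type_ringD[OF assms]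
  by (auto simp flip: to_ac_add to_ac_mult to_ac_minus to_ac_inverse to_ac_1)

lemma const_closure_subfield:
  assumes "subfield K type_ring" shows "subfield (const_closure K) type_ring"
  using field.subfield_of_algebraics[OF field_from_type_algebra subfield_to_ac[OF assms]]
  by (simp add: const_closure_def)

lemma const_closure_closed:
  assumes "subfield K type_ring" "p \<in> polys_over (const_closure K)" "p \<noteq> 0" "poly p z = 0"
  shows "z \<in> const_closure K"
  using algebraic_trans[OF subfield_to_ac[OF assms(1)] assms(3,4)] assms(2)
  by (simp add: const_closure_def polys_over_def)

lemma to_ac_const_closure: assumes "subfield K type_ring" "c \<in> K" shows "to_ac c \<in> const_closure K"
proof -
  note K = subfield_to_ac[OF assms(1)]
  have "[:- to_ac c, 1:] \<in> polys_over (to_ac ` K)"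
    using subfield_type_ringD(1,2,3)[OF K] assms(2) by (simp add: polys_over_simps[OF K])
  then show ?thesis
    unfolding const_closure_def using algebraic_iff[OF K]
        by (intro CollectI iffD2[OF algebraic_iff[OF K]] bexI[of _ "[:- to_ac c, 1:]"]) auto
qed

lemma poly_map_to_ac: "poly (map_poly to_ac p) (to_ac z) = to_ac (poly p z)"
  by (induction p) (simp_all add: map_poly_pCons)

text \<open>A root of a nonzero polynomial over \<open>const_closure K\<close> is algebraic over the
  image of \<open>K\<close>. The coefficients of its equation are pulled back along
  \<open>to_ac\<close> by the left inverse \<open>of_ac\<close>, which contradicts the transcendence
  of \<open>x\<close> over \<open>K\<close>.\<close>

lemma transcendental_to_ac:
  assumes K: "subfield K type_ring" and x: "\<And>p. p \<in> polys_over K \<Longrightarrow> poly p x = 0 \<Longrightarrow> p = 0"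
    and p: "p \<in> polys_over (const_closure K)" "poly p (to_ac x) = 0"
  shows "p = 0"
proof (rule ccontr)
  assume "p \<noteq> 0"
  then have "to_ac x \<in> const_closure K" using const_closure_closed[OF K] p by blast
  then obtain q where q: "q \<in> polys_over (to_ac ` K)" "q \<noteq> 0" "poly q (to_ac x) = 0"
    using algebraic_iff[OF subfield_to_ac[OF K]] by (auto simp: const_closure_def)
  define r where "r = map_poly of_ac q"
  have qr: "q = map_poly to_ac r"
  proof (rule poly_eqI)
    fix i
    have "Polynomial.coeff q i \<in> to_ac ` K" using q(1) by (simp add: polys_over_def)
    then show "Polynomial.coeff q i = Polynomial.coeff (map_poly to_ac r) i"
      by (auto simp: r_def coeff_map_poly)
  qed
  have "r \<in> polys_over K"
  proof -
    have "Polynomial.coeff r i \<in> K" for i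
    proof -
      have "Polynomial.coeff q i \<in> to_ac ` K" using q(1) by (simp add: polys_over_def)
      then show ?thesis by (auto simp: r_def coeff_map_poly)
    qed
    then show ?thesis by (simp add: polys_over_def)
  qed
  moreover have "poly r x = 0" using q(3) unfolding qr poly_map_to_ac by simp
  ultimately have "r = 0" by (rule x)
  then show False using q(2) qr by simp
qed

lemma to_ac_weierstrass:
  "weierstrass (to_ac a1) (to_ac a2) (to_ac a3) (to_ac a4) (to_ac a6) (to_ac u) (to_ac v) =
    to_ac (weierstrass a1 a2 a3 a4 a6 u v)"
  by (simp add: weierstrass_def)

lemma subfield_UNIV: "subfield (UNIV :: 'a::field set) type_ring"
  by (simp add: subfield_type_ring_iff subring_type_ring_iff)

section \<open>Commutativity of a group with two generators\<close>

lemma (in group) commutes_with_generate: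
  assumes S: "S \<subseteq> carrier G" and g: "g \<in> carrier G" "\<And>s. s \<in> S \<Longrightarrow> g \<otimes> s = s \<otimes> g"
    and h: "h \<in> generate G S"
  shows "g \<otimes> h = h \<otimes> g"
  using h
proof induction
  case (inv s)
  then have s: "s \<in> carrier G" using S by blast
  have "g = s \<otimes> g \<otimes> inv s" using g(2)[OF inv] g(1) s by (metis inv_solve_right m_closed)
  then have "inv s \<otimes> g = g \<otimes> inv s" using g(1) s
    by (metis inv_closed inv_solve_left m_assoc m_closed)
  then show ?case by simp
next
  case (eng h1 h2)
  then have "h1 \<in> carrier G" "h2 \<in> carrier G" using generate_in_carrier[OF S] by auto
  then show ?case using eng g(1) by (metis m_assoc)
qed (use g S in auto)

text \<open>Commutation spreads in two rounds: from a generator to the whole generated group, and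
  from there to any two of its elements.\<close>

lemma (in group) comm_group_generated_pair_iff:
  assumes a: "a \<in> carrier G" and b: "b \<in> carrier G"
  shows "comm_group (subgroup_generated G {a, b}) \<longleftrightarrow> a \<otimes> b = b \<otimes> a"
proof -
  have car: "carrier (subgroup_generated G {a, b}) = generate G {a, b}"
    using a b by (simp add: carrier_subgroup_generated Int_absorb1)
  show ?thesis
  proof
    assume "comm_group (subgroup_generated G {a, b})"
    then interpret c: comm_group "subgroup_generated G {a, b}" .
    have "a \<in> generate G {a, b}" "b \<in> generate G {a, b}" by (auto intro: generate.incl)
    then show "a \<otimes> b = b \<otimes> a" using c.m_comm[of a b] car by simp
  next
    assume ab: "a \<otimes> b = b \<otimes> a"
    have sub: "{a, b} \<subseteq> carrier G" using a b by simp
    have gc: "g \<in> carrier G" if "g \<in> generate G {a, b}" for g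
      using generate_in_carrier[OF sub that] .
    have s: "g \<otimes> s = s \<otimes> g" if "g \<in> generate G {a, b}" "s \<in> {a, b}" for g s
    proof -
      have "s \<otimes> g = g \<otimes> s"
        using that ab a b by (intro commutes_with_generate[OF sub _ _ that(1)]) auto
      then show ?thesis by simp
    qed
    have "g \<otimes> h = h \<otimes> g" if "g \<in> generate G {a, b}" "h \<in> generate G {a, b}" for g h
      using commutes_with_generate[OF sub gc[OF that(1)] s[OF that(1)] that(2)] .
    then show "comm_group (subgroup_generated G {a, b})"
      using group.group_comm_groupI[OF group_subgroup_generated, of "{a, b}"] car by simp
  qed
qed

lemma group_aut_group:
  fixes K :: "'e::field set"
  assumes K: "subfield K type_ring"
  shows "group (aut_group K)"
proof (rule groupI)
  have aut: "field_aut K UNIV \<phi>" if "\<phi> \<in> field_auts K UNIV" for \<phi> :: "'e \<Rightarrow> 'e"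
    by (rule field_aut.intro) (use K subfield_UNIV that in auto)
  show "\<phi> \<otimes>\<^bsub>aut_group K\<^esub> \<psi> \<in> carrier (aut_group K)"
    if "\<phi> \<in> carrier (aut_group K)" "\<psi> \<in> carrier (aut_group K)" for \<phi> \<psi>
  proof -
    have "\<phi> \<in> field_auts K UNIV" "\<psi> \<in> field_auts K UNIV" using that by (simp_all add: aut_group_def)
    then have "\<phi> \<circ> \<psi> \<in> field_auts K UNIV"
      by (auto simp: field_auts_def ring_iso_def ring_hom_def intro: bij_comp)
    then show ?thesis by (simp add: aut_group_def)
  qed
  show "\<one>\<^bsub>aut_group K\<^esub> \<in> carrier (aut_group K)"
    by (auto simp: aut_group_def field_auts_def ring_iso_def ring_hom_def)
  show "\<exists>\<psi>\<in>carrier (aut_group K). \<psi> \<otimes>\<^bsub>aut_group K\<^esub> \<phi> = \<one>\<^bsub>aut_group K\<^esub>"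
    if "\<phi> \<in> carrier (aut_group K)" for \<phi>
  proof -
    interpret f: field_aut K UNIV \<phi> using aut that by (simp add: aut_group_def)
    have "inv_into UNIV \<phi> \<in> field_auts K UNIV" using f.inv_aut by (simp add: field_aut_def)
    moreover have "inv_into UNIV \<phi> \<circ> \<phi> = id" using f.bij by (simp add: bij_betw_def)
    ultimately show ?thesis by (auto simp: aut_group_def)
  qed
qed (auto simp: aut_group_def)

text \<open>\<open>e\<close> has a pole, which keeps the contracted ring from being all of
  \<open>E\<close>; its inverse lies in that ring but not in \<open>K\<close>, which keeps the ring
  from being \<open>K\<close>.\<close>

lemma place_restrict:
  fixes K :: "'e::field set"
  assumes K: "subfield K type_ring" and P: "field_place (const_closure K) F P V"
    and F: "range to_ac \<subseteq> F" and e: "to_ac e \<notin> V"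
  shows "field_place K UNIV (to_ac -` P) (to_ac -` V)"
proof -
  interpret p: field_place "const_closure K" F P V by (rule P)
  have KV: "to_ac c \<in> V" if "c \<in> K" for c
    using p.k_sub to_ac_const_closure[OF K that] by blast
  show ?thesis
  proof (rule field_place.intro)
    show "subring (to_ac -` V) type_ring"
      unfolding subring_type_ring_iff using p.V_closed(2,3,4,5) by simp
    show "K \<subset> to_ac -` V"
    proof
      show "K \<subseteq> to_ac -` V" using KV by blast
      have "to_ac (inverse e) \<in> V" using p.val[of "to_ac e"] e F by auto
      moreover have "inverse e \<notin> K"
        using KV[of "inverse (inverse e)"] subfield_type_ringD(7)[OF K, of "inverse e"] e by auto
      ultimately show "K \<noteq> to_ac -` V" by auto
    qed
    show "to_ac -` V \<subset> UNIV" using e by auto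
    show "z \<in> to_ac -` V \<or> inverse z \<in> to_ac -` V" for z
      using p.val[of "to_ac z"] F by auto
    show "to_ac -` P = {z \<in> to_ac -` V. z = 0 \<or> inverse z \<notin> to_ac -` V}"
      by (auto simp: p.P_eq)
  qed (rule K subfield_UNIV)+
qed

text \<open>As \<open>\<phi>\<close> is onto, \<open>\<phi>'\<close> maps the copy of
  \<open>E\<close> onto itself; injectivity of \<open>\<phi>'\<close> then lets contraction and
  automorphism be exchanged.\<close>

lemma vimage_to_ac_image:
  fixes \<phi> :: "'e::field \<Rightarrow> 'e"
  assumes inj: "inj_on \<phi>' F" and surj: "surj \<phi>" and ext: "\<And>z. \<phi>' (to_ac z) = to_ac (\<phi> z)"
    and F: "range to_ac \<subseteq> F" "P \<subseteq> F"
  shows "to_ac -` (\<phi>' ` P) = \<phi> ` (to_ac -` P)"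
proof (intro equalityI subsetI)
  fix z assume "z \<in> to_ac -` (\<phi>' ` P)"
  then obtain v where v: "v \<in> P" "to_ac z = \<phi>' v" by auto
  obtain z' where z': "z = \<phi> z'" using surj by auto
  then have "\<phi>' (to_ac z') = \<phi>' v" using v(2) ext by simp
  moreover have "to_ac z' \<in> F" "v \<in> F" using F v(1) by blast+
  ultimately have "to_ac z' = v" by (rule inj_onD[OF inj])
  then show "z \<in> \<phi> ` (to_ac -` P)" using v(1) z' by blast
next
  fix z assume "z \<in> \<phi> ` (to_ac -` P)"
  then obtain z' where "to_ac z' \<in> P" "z = \<phi> z'" by auto
  then show "z \<in> to_ac -` (\<phi>' ` P)" using ext by (metis image_eqI vimageI)
qed

text \<open>Reduces the equality of two homomorphisms to their values on generators of the
  field.\<close>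

lemma equalizer_subfield:
  fixes \<phi> \<psi> :: "'a::field \<Rightarrow> 'b::field"
  assumes "\<phi> 1 = 1" "\<And>u v. \<phi> (u + v) = \<phi> u + \<phi> v" "\<And>u v. \<phi> (u * v) = \<phi> u * \<phi> v"
    and "\<psi> 1 = 1" "\<And>u v. \<psi> (u + v) = \<psi> u + \<psi> v" "\<And>u v. \<psi> (u * v) = \<psi> u * \<psi> v"
  shows "subfield {z. \<phi> z = \<psi> z} type_ring"
proof -
  have m: "\<chi> (- u) = - \<chi> u" "\<chi> (inverse u) = inverse (\<chi> u)"
    if h: "\<chi> 1 = 1" "\<And>u v. \<chi> (u + v) = \<chi> u + \<chi> v" "\<And>u v. \<chi> (u * v) = \<chi> u * \<chi> v"
    for \<chi> :: "'a \<Rightarrow> 'b" and u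
  proof -
    have "\<chi> 0 = 0" using h(2)[of 0 0] by (metis add.right_neutral add_left_cancel)
    then show "\<chi> (- u) = - \<chi> u" using h(2)[of u "-u"] by (simp add: eq_neg_iff_add_eq_0 add.commute)
    show "\<chi> (inverse u) = inverse (\<chi> u)"
      using h(3)[of u "inverse u"] h(1) \<open>\<chi> 0 = 0\<close> by (cases "u = 0") (simp_all add: inverse_unique)
  qed
  show ?thesis
    unfolding subfield_type_ring_iff subring_type_ring_iff
    using assms m[OF assms(1-3)] m[OF assms(4-6)] by auto
qed

section \<open>The curve over \<open>K\<close> and over the algebraic closure of
  \<open>K\<close>\<close>

locale elliptic =
  e: weierstrass_field K a1 a2 a3 a4 a6 x y +
  w: weierstrass_closed "const_closure K" "to_ac a1" "to_ac a2" "to_ac a3" "to_ac a4" "to_ac a6"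
      "to_ac x" "to_ac y"
  for K :: "'e::field set" and a1 a2 a3 a4 a6 x y +
  assumes generated: "e.F = UNIV"

lemma elliptic_function_field_elliptic:
  assumes "elliptic_function_field K x y"
  obtains a1 a2 a3 a4 a6 where "elliptic K a1 a2 a3 a4 a6 x y"
proof -
  obtain a1 a2 a3 a4 a6 where a: "a1 \<in> K" "a2 \<in> K" "a3 \<in> K" "a4 \<in> K" "a6 \<in> K"
      "weierstrass_nonsingular K a1 a2 a3 a4 a6" "weierstrass a1 a2 a3 a4 a6 x y = 0"
    and K: "subfield K type_ring" and t: "(ring.transcendental type_ring over K) x"
    and gen: "generate_field type_ring (K \<union> {x, y}) = UNIV"
    using assms unfolding elliptic_function_field_def by blast
  have tr: "p = 0" if "p \<in> polys_over K" "poly p x = 0" for p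
    using algebraic_iff[OF K, of x] t that by (auto simp: over_def)
  have e: "weierstrass_field K a1 a2 a3 a4 a6 x y"
    by (rule weierstrass_field.intro) (use K a tr in auto)
  have "weierstrass_field (const_closure K) (to_ac a1) (to_ac a2) (to_ac a3) (to_ac a4) (to_ac a6)
      (to_ac x) (to_ac y)"
  proof (rule weierstrass_field.intro)
    show "p = 0" if "p \<in> polys_over (const_closure K)" "poly p (to_ac x) = 0" for p
      using transcendental_to_ac[OF K tr that] .
  qed (simp_all add: const_closure_subfield[OF K] to_ac_const_closure[OF K] a to_ac_weierstrass)
  then have "weierstrass_closed (const_closure K) (to_ac a1) (to_ac a2) (to_ac a3) (to_ac a4)
      (to_ac a6) (to_ac x) (to_ac y)"
  proof (rule weierstrass_closed.intro)
    show "weierstrass_closed_axioms (const_closure K) (to_ac a1) (to_ac a2) (to_ac a3) (to_ac a4)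
        (to_ac a6)"
    proof
      fix p :: "'a alg_closure poly"
      assume p: "p \<in> polys_over (const_closure K)" "Polynomial.degree p > 0"
      obtain z where z: "poly p z = 0" using alg_closed_imp_poly_has_root[OF p(2)] by blast
      moreover have "p \<noteq> 0" using p(2) by auto
      then have "z \<in> const_closure K" using const_closure_closed[OF K p(1) _ z] by blast
      ultimately show "\<exists>c\<in>const_closure K. poly p c = 0" by blast
    qed (use a(6) in \<open>unfold weierstrass_nonsingular_def, blast\<close>)
  qed
  moreover have "weierstrass_field.F K x y = UNIV"
    using weierstrass_field.F_eq_generate_field[OF e] gen by simp
  ultimately have "elliptic K a1 a2 a3 a4 a6 x y"
    using e by (simp add: elliptic_def elliptic_axioms_def)
  then show ?thesis by (rule that)
qed

context elliptic
begin

lemma subfield_eq_UNIV: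
  assumes "subfield L type_ring" "K \<subseteq> L" "x \<in> L" "y \<in> L" shows "L = UNIV"
  using e.F_minimal[OF assms] generated by blast

text \<open>The elements that \<open>\<phi>\<close> sends into \<open>L\<close> form a subfield
  containing \<open>K\<close>, \<open>x\<close> and \<open>y\<close>. The map is general because
  both \<open>to_ac\<close> and \<open>to_ac \<circ> \<sigma>\<close> occur.\<close>

lemma range_to_ac_sub:
  assumes L: "subfield L type_ring" and sub: "const_closure K \<subseteq> L"
    and hom: "\<phi> 1 = 1" "\<And>u v. \<phi> (u + v) = \<phi> u + \<phi> v" "\<And>u v. \<phi> (u * v) = \<phi> u * \<phi> v"
    and const: "\<And>c. c \<in> K \<Longrightarrow> \<phi> c \<in> const_closure K" and xy: "\<phi> x \<in> L" "\<phi> y \<in> L"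
  shows "range \<phi> \<subseteq> L"
proof -
  have z: "\<phi> 0 = 0" using hom(2)[of 0 0] by (metis add.right_neutral add_left_cancel)
  have m: "\<phi> (- u) = - \<phi> u" for u using hom(2)[of u "-u"] z
      by (simp add: eq_neg_iff_add_eq_0 add.commute)
  have i: "\<phi> (inverse u) = inverse (\<phi> u)" for u
    using hom(3)[of u "inverse u"] hom(1) z by (cases "u = 0") (simp_all add: inverse_unique)
  have "{z. \<phi> z \<in> L} = UNIV"
  proof (rule subfield_eq_UNIV)
    show "subfield {z. \<phi> z \<in> L} type_ring"
      unfolding subfield_type_ring_iff subring_type_ring_iff
      using subfield_type_ringD(2,3,4,5,7)[OF L] by (simp add: hom m i)
  qed (use const sub xy in auto)
  then show ?thesis by blast
qed

lemma to_ac_in_F: "range to_ac \<subseteq> w.F"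
  by (rule range_to_ac_sub[OF w.F_subfield]) (use w.F_k w.F_x w.F_y to_ac_const_closure[OF e.k] in
      auto)

lemma const_ext_eq: "const_ext K = w.F"
proof
  interpret T: field "type_ring :: 'e alg_closure ring" by (rule field_from_type_algebra)
  show "const_ext K \<subseteq> w.F" unfolding const_ext_def
    by (rule T.generate_field_min_subfield1) (use w.F_subfield w.F_k to_ac_in_F in auto)
  have sub: "const_closure K \<union> range to_ac \<subseteq> const_ext K"
    unfolding const_ext_def by (auto intro: generate_field.incl)
  have "subfield (const_ext K) type_ring"
    unfolding const_ext_def by (rule T.generate_field_is_subfield) simp
  then show "w.F \<subseteq> const_ext K"
    using sub by (intro w.F_minimal) auto
qed

text \<open>\<open>\<sigma>\<close> fixes the coefficients, so \<open>\<sigma> x\<close> and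
  \<open>\<sigma> y\<close> satisfy the same equation, and over the closed constants they generate
  the same field because \<open>\<sigma>\<close> is onto. Exchanging the generators is the
  extension; it agrees with \<open>\<sigma>\<close> on \<open>E\<close> since it does on
  \<open>K\<close>, \<open>x\<close> and \<open>y\<close>.\<close>

lemma extend_automorphism:
  assumes \<sigma>: "\<sigma> \<in> field_auts K UNIV"
  obtains \<sigma>' where "\<sigma>' \<in> field_auts (const_closure K) w.F" "\<And>z. \<sigma>' (to_ac z) = to_ac (\<sigma> z)"
proof -
  interpret s: field_aut K UNIV \<sigma>
    by (rule field_aut.intro) (use e.k subfield_UNIV \<sigma> in auto)
  have hom: "\<sigma> 1 = 1" "\<And>u v. \<sigma> (u + v) = \<sigma> u + \<sigma> v" "\<And>u v. \<sigma> (u * v) = \<sigma> u * \<sigma> v"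
    by (simp_all add: s.one s.add s.mult)
  have tr: "p = 0" if p: "p \<in> polys_over K" "poly p (\<sigma> x) = 0" for p
  proof -
    have "poly q (\<sigma> x) = \<sigma> (poly q x)" if "q \<in> polys_over K" for q
      using that by (induction q) (simp_all add: e.pk hom s.const s.zero)
    then have "\<sigma> (poly p x) = 0" using p by simp
    then show ?thesis using p(1) e.transc s.eq_0 by simp
  qed
  interpret w': weierstrass_field "const_closure K" "to_ac a1" "to_ac a2" "to_ac a3" "to_ac a4"
      "to_ac a6"
    "to_ac (\<sigma> x)" "to_ac (\<sigma> y)"
  proof (rule weierstrass_field.intro)
    show "p = 0" if "p \<in> polys_over (const_closure K)" "poly p (to_ac (\<sigma> x)) = 0" for p
      using transcendental_to_ac[OF e.k tr that] .
    have "\<sigma> (weierstrass a1 a2 a3 a4 a6 x y) = weierstrass a1 a2 a3 a4 a6 (\<sigma> x) (\<sigma> y)"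
      using e.coeffs by (simp add: weierstrass_def s.diff hom s.power s.const)
    then show "weierstrass (to_ac a1) (to_ac a2) (to_ac a3) (to_ac a4) (to_ac a6) (to_ac (\<sigma> x))
        (to_ac (\<sigma> y)) = 0"
      using e.curve s.zero by (simp add: to_ac_weierstrass)
  qed (rule w.k w.coeffs)+
  have "w'.F = w.F"
  proof
    show "w'.F \<subseteq> w.F"
      using to_ac_in_F w.F_k by (intro w'.F_minimal w.F_subfield) auto
    have "range (to_ac \<circ> \<sigma>) \<subseteq> w'.F"
      by (rule range_to_ac_sub[OF w'.F_subfield])
        (use w'.F_k w'.F_x w'.F_y to_ac_const_closure[OF e.k] s.const in \<open>auto simp: hom\<close>)
    then have "to_ac z \<in> w'.F" for z using s.surj[of z] by auto
    then show "w.F \<subseteq> w'.F"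
      using w'.F_k by (intro w.F_minimal w'.F_subfield) auto
  qed
  then interpret p: weierstrass_pair "const_closure K" "to_ac a1" "to_ac a2" "to_ac a3" "to_ac a4"
      "to_ac a6"
    "to_ac x" "to_ac y" "to_ac (\<sigma> x)" "to_ac (\<sigma> y)"
    by unfold_locales
  have F: "to_ac z \<in> w.F" for z using to_ac_in_F by blast
  have "{z. p.transport (to_ac z) = to_ac (\<sigma> z)} = UNIV"
  proof (rule subfield_eq_UNIV)
    show "subfield {z. p.transport (to_ac z) = to_ac (\<sigma> z)} type_ring"
      using p.transport_const[OF w.k_closed(2)]
      by (intro equalizer_subfield) (simp_all add: hom p.transport_add p.transport_mult F)
  qed (use p.transport_x p.transport_y p.transport_const to_ac_const_closure[OF e.k] s.const in
      auto)
  then show ?thesis using that[OF p.transport_aut] by blast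
qed

end

section \<open>Translations and automorphisms fixing the infinite place\<close>

lemma (in elliptic) translation_commutes_iff:
  assumes Z: "infinite_place K UNIV x y Z" and Q: "Q \<in> rational_places K UNIV"
    and \<tau>: "is_translation K x y Q \<tau>" and \<sigma>: "\<sigma> \<in> aut_fixing K Z"
  shows "\<tau> \<circ> \<sigma> = \<sigma> \<circ> \<tau> \<longleftrightarrow> \<sigma> ` Q = Q"
proof -
  define k where "k = const_closure K"
  define F where "F = w.F"
  have sk: "subfield k type_ring" and sF: "subfield F type_ring"
    using w.k w.F_subfield by (simp_all add: k_def F_def)
  have kF: "k \<subseteq> F" using w.F_k by (auto simp: k_def F_def)
  have acF: "range to_ac \<subseteq> F" using to_ac_in_F by (simp add: F_def)
  have \<sigma>aut: "\<sigma> \<in> field_auts K UNIV" and \<sigma>Z: "\<sigma> ` Z = Z"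
    using \<sigma> by (auto simp: aut_fixing_def aut_group_def)
  obtain \<tau>' Q' Z' where \<tau>aut: "\<tau> \<in> field_auts K UNIV" and \<tau>'aut: "\<tau>' \<in> field_auts k F"
    and \<tau>': "\<And>z. \<tau>' (to_ac z) = to_ac (\<tau> z)"
    and Q': "Q' \<in> rational_places k F" "to_ac -` Q' = Q"
    and Z': "infinite_place k F (to_ac x) (to_ac y) Z'"
    and sum: "\<And>P. P \<in> rational_places k F \<Longrightarrow> place_sum k F Z' P Q' (\<tau>' ` P)"
    using \<tau> unfolding is_translation_def const_ext_eq k_def F_def by (auto simp: aut_group_def)
  obtain \<sigma>' where \<sigma>'aut: "\<sigma>' \<in> field_auts k F" and \<sigma>': "\<And>z. \<sigma>' (to_ac z) = to_ac (\<sigma> z)"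
    using extend_automorphism[OF \<sigma>aut] unfolding k_def F_def by blast
  interpret s: field_aut K UNIV \<sigma>
    by (rule field_aut.intro) (use e.k subfield_UNIV \<sigma>aut in auto)
  interpret t: field_aut K UNIV \<tau>
    by (rule field_aut.intro) (use e.k subfield_UNIV \<tau>aut in auto)
  interpret s': field_aut k F \<sigma>' by (rule field_aut.intro) (rule sk sF kF \<sigma>'aut)+
  interpret t': field_aut k F \<tau>' by (rule field_aut.intro) (rule sk sF kF \<tau>'aut)+
  have surj: "surj \<sigma>" "surj \<tau>" using s.bij t.bij by (auto simp: bij_betw_def)
  have vim: "to_ac -` (\<sigma>' ` P) = \<sigma> ` (to_ac -` P)" "to_ac -` (\<tau>' ` P) =
      \<tau> ` (to_ac -` P)" if "P \<subseteq> F" for P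
    using vimage_to_ac_image[of \<sigma>' F \<sigma> P] vimage_to_ac_image[of \<tau>' F \<tau> P] that surj \<sigma>' \<tau>' acF
        s'.bij t'.bij
    by (auto simp: bij_betw_def)

  define V where "V = place_ring F Z'"
  have Z'pl: "Z' \<in> places k F" and xyV: "to_ac x \<notin> V" "to_ac y \<notin> V"
    using Z' by (auto simp: infinite_place_def V_def)
  have fZ': "field_place k F Z' V" unfolding V_def by (rule placesD[OF Z'pl sk sF])
  have Z'rat: "Z' \<in> rational_places k F"
    using w.inf_degree[of Z' V] fZ' xyV Z'pl by (simp add: rational_places_def k_def F_def)
  have Zpl: "Z \<in> places K UNIV" "x \<notin> place_ring UNIV Z" "y \<notin> place_ring UNIV Z"
    using Z by (auto simp: infinite_place_def)
  have fZ: "field_place K UNIV Z (place_ring UNIV Z)" by (rule placesD[OF Zpl(1) e.k subfield_UNIV])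
  have fZ0: "field_place K UNIV (to_ac -` Z') (to_ac -` V)"
    using place_restrict[OF e.k _ acF xyV(1)] fZ' unfolding k_def by blast
  \<comment> \<open>The place of \<open>E\<close> below \<open>Z'\<close> is a common pole of
    \<open>x\<close> and \<open>y\<close>, and there is only one.\<close>
  have Z_eq: "to_ac -` Z' = Z"
    using e.infinite_place_unique[of "to_ac -` Z'" "to_ac -` V" Z "place_ring UNIV Z"]
      fZ fZ0 Zpl(2,3) xyV generated by simp
  have V_eq: "to_ac -` V = place_ring UNIV Z"
    using field_place.place_ring_eq[OF fZ0] Z_eq by simp
  have inf_unique: "P = Z'" if "P \<in> places k F" "to_ac x \<notin> place_ring F P"
      "to_ac y \<notin> place_ring F P" for P
    using w.infinite_place_unique[of P "place_ring F P" Z' V] placesD[OF that(1) sk sF] that(2,3)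
        fZ' xyV
    by (simp add: k_def F_def)
  have eq_rat: "P = P'"
    if "P \<in> rational_places k F" "P' \<in> rational_places k F"
        "lin_equiv k F (frag_of P) (frag_of P')" for P P'
    using w.lin_equiv_rational_eq[of Z' V P P'] fZ' xyV that by (simp add: k_def F_def)
  have pl: "P \<in> places k F" if "P \<in> rational_places k F" for P
    using that by (simp add: rational_places_def)
  note sub = s'.places_sub[OF pl]

  \<comment> \<open>For \<open>P = Z'\<close> the defining property of the translation reads
    \<open>Z' + Q' ~ \<tau>' Z' + Z'\<close>. Cancelling \<open>Z'\<close> gives
    \<open>\<tau>' Z' = Q'\<close>, which is then contracted to \<open>E\<close>.\<close>
  have \<tau>Z: "\<tau> ` Z = Q"
  proof -
    have "lin_equiv k F (frag_of Q' + frag_of Z') (frag_of (\<tau>' ` Z') + frag_of Z')"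
      using sum[OF Z'rat] by (simp add: place_sum_def add.commute)
    then have "Q' = \<tau>' ` Z'"
      using eq_rat[OF Q'(1) t'.rational_places_image[OF Z'rat]] by (simp add: lin_equiv_cancel)
    then show ?thesis using vim(2)[OF sub[OF Z'rat]] Q'(2) Z_eq by simp
  qed

  show ?thesis
  proof
    assume "\<tau> \<circ> \<sigma> = \<sigma> \<circ> \<tau>"
    then have "\<sigma> ` \<tau> ` Z = \<tau> ` \<sigma> ` Z" by (metis image_comp)
    then show "\<sigma> ` Q = Q" using \<sigma>Z \<tau>Z by simp
  next
    assume \<sigma>Q: "\<sigma> ` Q = Q"
    \<comment> \<open>The ring of \<open>\<sigma>' Z'\<close> contracts to that of
      \<open>\<sigma> Z = Z\<close>, so \<open>x\<close> and \<open>y\<close> have poles at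
      \<open>\<sigma>' Z'\<close>, and the common pole in the extension is unique.\<close>
    have \<sigma>'Z: "\<sigma>' ` Z' = Z'"
    proof (rule inf_unique)
      show "\<sigma>' ` Z' \<in> places k F" by (rule s'.places_image[OF Z'pl])
      have "V \<subseteq> F" using field_place.V_sub[OF fZ'] by blast
      then have "to_ac -` (\<sigma>' ` V) = \<sigma> ` place_ring UNIV Z" using vim(1) V_eq by simp
      also have "\<dots> = place_ring UNIV Z" using s.place_ring_image[OF Zpl(1)] \<sigma>Z by simp
      finally have "to_ac -` place_ring F (\<sigma>' ` Z') = place_ring UNIV Z"
        using s'.place_ring_image[OF Z'pl] by (simp add: V_def)
      then show "to_ac x \<notin> place_ring F (\<sigma>' ` Z')" "to_ac y \<notin> place_ring F (\<sigma>' ` Z')"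
        using Zpl(2,3) by auto
    qed
    \<comment> \<open>\<open>\<sigma>' Q'\<close> lies over \<open>\<sigma> Q = Q\<close>, as
      \<open>Q'\<close> does; the point is that only one place lies over \<open>Q\<close>.\<close>
    have \<sigma>'Q: "\<sigma>' ` Q' = Q'"
      using Q'(1) unfolding k_def F_def
    proof (cases rule: w.rational_place_cases)
      case infinite
      then have "Q' = Z'" using inf_unique[OF pl[OF Q'(1)]] by (simp add: F_def)
      then show ?thesis using \<sigma>'Z by simp
    next
      case (point a b)
      note fQ' = placesD[OF pl[OF Q'(1)] sk sF]

      have Qpl: "Q \<in> places K UNIV" "has_degree K UNIV Q 1" using Q
          by (auto simp: rational_places_def)
      interpret q: field_place K UNIV Q "place_ring UNIV Q"
          by (rule placesD[OF Qpl(1) e.k subfield_UNIV])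
      \<comment> \<open>The inverse of \<open>c\<close> has a pole at \<open>Q'\<close>: the witness
        that \<open>place_restrict\<close> asks for.\<close>
      obtain c where c: "c \<in> Q" "c \<noteq> 0" using q.P_nontrivial by blast
      have "to_ac c \<in> Q'" using c(1) Q'(2) by blast
      then have "to_ac (inverse c) \<notin> place_ring F Q'" using c(2) by (simp add: place_ring_def)
      then have "field_place K UNIV (to_ac -` Q') (to_ac -` place_ring F Q')"
        using place_restrict[OF e.k _ acF] fQ' unfolding k_def by blast
      then have ring_eq: "place_ring UNIV Q = to_ac -` place_ring F Q'"
        using field_place.place_ring_eq Q'(2) by blast
      have "to_ac x \<in> w.pt_ring a b" "to_ac y \<in> w.pt_ring a b"
        using w.R_pt_ring[OF point(1)] w.R_x w.R_y by blast+
      moreover have "place_ring F Q' = w.pt_ring a b"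
        using field_place.place_ring_eq[OF w.pt_place_in[OF point(1)]] point(2) by (simp add: F_def)
      ultimately have "x \<in> place_ring UNIV Q" "y \<in> place_ring UNIV Q" using ring_eq by auto
      then obtain a0 b0 where ab: "a0 \<in> K" "b0 \<in> K" "x - a0 \<in> Q" "y - b0 \<in> Q"
        using q.has_degree_one_iff Qpl(2) by blast
      \<comment> \<open>The residues \<open>a0\<close>, \<open>b0\<close> lie in \<open>K\<close>
        because \<open>Q\<close> has degree one. Any place over \<open>Q\<close> contains
        \<open>x - a0\<close> and \<open>y - b0\<close>, and these determine it.\<close>
      have uniq: "P = w.pt_place (to_ac a0) (to_ac b0)" if P: "P \<in> places k F" "to_ac -` P =
          Q" for P
      proof -
        have fP: "field_place (const_closure K) w.F P (place_ring F P)"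
          using placesD[OF P(1) sk sF] by (simp add: k_def F_def)
        have m: "to_ac x - to_ac a0 \<in> P" "to_ac y - to_ac b0 \<in> P"
          using ab(3,4) P(2) by (auto simp flip: to_ac_diff)
        have "w.on_curve (to_ac a0) (to_ac b0)"
          using w.on_curve_if_in_place[OF fP _ _ m] to_ac_const_closure[OF e.k] ab(1,2) by blast
        then show ?thesis by (rule w.pt_place_unique[OF _ fP m])
      qed
      have "to_ac -` (\<sigma>' ` Q') = Q" using vim(1)[OF sub[OF Q'(1)]] Q'(2) \<sigma>Q by simp
      then have "\<sigma>' ` Q' = w.pt_place (to_ac a0) (to_ac b0)"
        by (rule uniq[OF s'.places_image[OF pl[OF Q'(1)]]])
      then show ?thesis using uniq[OF pl[OF Q'(1)] Q'(2)] by (rule trans[OF _ sym])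
    qed
    have comm: "\<sigma>' ` \<tau>' ` P = \<tau>' ` \<sigma>' ` P" if P: "P \<in> rational_places k F" for P
    proof -
      note \<tau>P = t'.rational_places_image[OF P] and \<sigma>P = s'.rational_places_image[OF P]
      have "lin_equiv k F (frag_of P + frag_of Q') (frag_of (\<tau>' ` P) + frag_of Z')"
        using sum[OF P] by (simp add: place_sum_def)
      \<comment> \<open>\<open>\<sigma>'\<close> carries the sum relation for \<open>P\<close> to
        one with the same left side as the sum relation for the image of \<open>P\<close> under
        \<open>\<sigma>'\<close>.\<close>
      then have "lin_equiv k F (frag_of (\<sigma>' ` P) + frag_of Q') (frag_of (\<sigma>' ` \<tau>' ` P) + frag_of Z')"
        using s'.lin_equiv_image[OF pl[OF P] pl[OF Q'(1)] pl[OF \<tau>P] Z'pl] \<sigma>'Q \<sigma>'Z by simp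
      moreover have "lin_equiv k F (frag_of (\<sigma>' ` P) + frag_of Q') (frag_of (\<tau>' ` \<sigma>' ` P) +
          frag_of Z')"
        using sum[OF \<sigma>P] by (simp add: place_sum_def)
      ultimately have "lin_equiv k F (frag_of (\<sigma>' ` \<tau>' ` P)) (frag_of (\<tau>' ` \<sigma>' ` P))"
        using lin_equiv_trans[OF sk sF] lin_equiv_cancel by blast
      then show ?thesis
        by (rule eq_rat[OF s'.rational_places_image[OF \<tau>P] t'.rational_places_image[OF \<sigma>P]])
    qed
    have agree: "\<sigma>' (\<tau>' z) = \<tau>' (\<sigma>' z)"
      if z: "z \<in> F" and val: "\<And>a b. w.on_curve a b \<Longrightarrow> \<exists>c\<in>k. z - c \<in> w.pt_place a b" for z
    proof -
      define u where "u = \<sigma>' (\<tau>' z) - \<tau>' (\<sigma>' z)"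
      have cl: "\<sigma>' v \<in> F" "\<tau>' v \<in> F" if "v \<in> F" for v using that s'.closed t'.closed by blast+
      have "u \<in> F" unfolding u_def using cl z subfield_type_ringD(6)[OF sF] by blast
      obtain u1 where u1: "u1 \<in> F" "u = \<sigma>' u1" using s'.surj[OF \<open>u \<in> F\<close>] by blast
      \<comment> \<open>\<open>u\<close> vanishes at the images of the points under
        \<open>\<sigma>' \<circ> \<tau>'\<close>; its preimage \<open>u2\<close> vanishes at the
        points themselves, as \<open>zero_at_all_points\<close> demands.\<close>
      obtain u2 where u2: "u2 \<in> F" "u1 = \<tau>' u2" using t'.surj[OF u1(1)] by blast
      have "u2 \<in> w.pt_place a b" if ab: "w.on_curve a b" for a b
      proof -
        define P where "P = w.pt_place a b"
        have P: "P \<in> rational_places k F"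
          using w.pt_place_rational[OF ab] by (simp add: P_def k_def F_def)
        interpret p: field_place k F "\<sigma>' ` \<tau>' ` P" "\<sigma>' ` \<tau>' ` place_ring F P"
          by (rule s'.place_image[OF t'.place_image[OF placesD[OF pl[OF P] sk sF]]])
        obtain c where c: "c \<in> k" "z - c \<in> P" using val[OF ab] by (auto simp: P_def)
        have cF: "c \<in> F" using c kF by blast
        have "\<sigma>' (\<tau>' (z - c)) \<in> \<sigma>' ` \<tau>' ` P" "\<tau>' (\<sigma>' (z - c)) \<in> \<tau>' ` \<sigma>' ` P"
          using c(2) by blast+
        \<comment> \<open>Both compositions fix the value \<open>c\<close> of \<open>z\<close> at
          \<open>P\<close>, and they send \<open>P\<close> to the same place, so both images of
          \<open>z\<close> take the value \<open>c\<close> there.\<close>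
        then have "\<sigma>' (\<tau>' (z - c)) - \<tau>' (\<sigma>' (z - c)) \<in> \<sigma>' ` \<tau>' ` P"
          unfolding comm[OF P, symmetric] by (rule p.P_diff)
        moreover have "\<sigma>' (\<tau>' (z - c)) = \<sigma>' (\<tau>' z) - c" "\<tau>' (\<sigma>' (z - c)) = \<tau>' (\<sigma>' z) - c"
          using z cF cl c(1) by (simp_all add: s'.diff t'.diff s'.const t'.const)
        ultimately have "\<sigma>' (\<tau>' u2) \<in> \<sigma>' ` \<tau>' ` P" using u1 u2 by (simp add: u_def)
        then have "\<tau>' u2 \<in> \<tau>' ` P"
          using s'.image_mem_iff[of "\<tau>' ` P" "\<tau>' u2"] sub[OF t'.rational_places_image[OF P]]
              cl(2)[OF u2(1)] by blast
        then show "u2 \<in> w.pt_place a b"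
          using t'.image_mem_iff[of P u2] sub[OF P] u2(1) by (simp add: P_def)
      qed
      then have "u2 = 0" using w.zero_at_all_points u2(1) by (simp add: F_def)
      then have "u = 0" using u1 u2 s'.zero t'.zero by simp
      then show ?thesis by (simp add: u_def)
    qed
    have "\<sigma>' (\<tau>' (to_ac x)) = \<tau>' (\<sigma>' (to_ac x))"
    proof (rule agree)
      show "\<exists>c\<in>k. to_ac x - c \<in> w.pt_place a b" if "w.on_curve a b" for a b
        using w.pt_place_mem(1)[OF that] w.ak[OF that] unfolding k_def by (rule bexI)
    qed (use acF in blast)
    moreover have "\<sigma>' (\<tau>' (to_ac y)) = \<tau>' (\<sigma>' (to_ac y))"
    proof (rule agree)
      show "\<exists>c\<in>k. to_ac y - c \<in> w.pt_place a b" if "w.on_curve a b" for a b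
        using w.pt_place_mem(2)[OF that] w.bk[OF that] unfolding k_def by (rule bexI)
    qed (use acF in blast)
    ultimately have "\<sigma> (\<tau> x) = \<tau> (\<sigma> x)" "\<sigma> (\<tau> y) = \<tau> (\<sigma> y)" by (simp_all add: \<sigma>' \<tau>')
    then have "{z. \<tau> (\<sigma> z) = \<sigma> (\<tau> z)} = UNIV"
    proof (intro subfield_eq_UNIV)
      show "subfield {z. \<tau> (\<sigma> z) = \<sigma> (\<tau> z)} type_ring"
        by (intro equalizer_subfield) (simp_all add: s.one t.one s.add t.add s.mult t.mult)
    qed (use s.const t.const in auto)
    then show "\<tau> \<circ> \<sigma> = \<sigma> \<circ> \<tau>" by (auto simp: fun_eq_iff)
  qed
qed

theorem proposition3p9:
  fixes K :: "'e::field set" and x y :: 'e and Z Q :: "'e set" and \<tau> \<sigma> :: "'e \<Rightarrow> 'e"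
  assumes "finite K"
    and "elliptic_function_field K x y"
    and "infinite_place K UNIV x y Z"
    and "Q \<in> rational_places K UNIV"
    and "is_translation K x y Q \<tau>"
    and "\<sigma> \<in> aut_fixing K Z"
  shows "comm_group (subgroup_generated (aut_group K) {\<tau>, \<sigma>}) \<longleftrightarrow> \<sigma> ` Q = Q"
proof -
  obtain a1 a2 a3 a4 a6 where e: "elliptic K a1 a2 a3 a4 a6 x y"
    using elliptic_function_field_elliptic[OF assms(2)] .
  interpret elliptic K a1 a2 a3 a4 a6 x y by (rule e)
  interpret G: group "aut_group K" by (rule group_aut_group[OF e.k])
  have "\<tau> \<in> carrier (aut_group K)" "\<sigma> \<in> carrier (aut_group K)"
    using assms(5,6) by (simp_all add: is_translation_def aut_fixing_def)
  then have "comm_group (subgroup_generated (aut_group K) {\<tau>, \<sigma>}) \<longleftrightarrow> \<tau> \<circ> \<sigma> = \<sigma> \<circ> \<tau>"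
    using G.comm_group_generated_pair_iff by (simp add: aut_group_def)
  then show ?thesis using translation_commutes_iff[OF assms(3-6)] by simp
qed

end
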